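(* With $G$, $H$, $\operatorname{Log}$, $\omega_f$, $\Phi$, $\tilde\pi_\Phi$ as defined in the context, and $U\in\mathbb C_\infty$, the following equalities hold. (1) The Anderson–Thakur function coincides with a special evaluation of the Pellarin-type generating function: $\omega_f(\mathfrak t)=G(\tilde\pi_\Phi;\mathfrak t)$. (2) The generating function $G(U;\mathfrak t)$ satisfies the Frobenius differential equation $\tau\diamond G(U;\mathfrak t)=f(\mathfrak t)\cdot G(U;\mathfrak t)+\exp_\Phi(U)$. (3) Let $\xi=\exp_\Phi(U)$. The three types of generating functions are related by $$G(U;\mathfrak t)=H(U;\mathfrak t)=-\frac1{f(\mathfrak t)}\cdot\operatorname{Log}(\xi;\mathfrak t).$$
   Context: Let $\mathcal K=\mathbb F_q(t)$, $K=\mathbb F_q(\theta)$, $\iota:t\mapsto\theta$. Let $\rho\in\mathbb F_q[t]$ be monic irreducible of degree $N\ge 2$, $\eta$ a root of $\rho$, $\eta^{(i)}=\eta^{q^i}$ for $i\in\mathbb Z$ (depending only on $i$ mod $N$). Let $\mathcal A$ be the ring of elements of $\mathcal K$ regular away from the place $P_\rho$ of $\rho$, $T_i=t^i/\rho(t)$ ($0\le i\le N-1$). Let $K_\rho$ be the completion of $K$ at the place of $\rho(\theta)$, containing $\mathbb F_q(\eta)$ with $\theta-\eta$ a uniformizer, and $\mathbb C_\infty$ the completion of an algebraic closure of $K_\rho$ with $|\theta-\eta|_\eta=q^{-1}$. Let $\sigma$ be the automorphism of $K(\eta)$ over $K$ with $\eta\mapsto\eta^q$; $x^{\sum a_i\sigma^i}=\prod\sigma^i(x)^{a_i}$;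 $\Theta=\frac1{\theta-\eta}$, $\Theta^{\sigma^k}=\frac1{\theta-\eta^{(k)}}$. Twist: $g^{(k)}$ raises coefficients in $\mathbb C_\infty$ to the $q^k$-th power, fixing $t$ or $\mathfrak t$; $\tau\diamond g=g^{(1)}$. Tate algebra: with $\mathcal D=\{z\in\mathbb C_\infty:|T_i(z)|_\eta\le1,\ 0\le i\le N-1\}$, $\mathbb T_\eta$ is the algebra of those elements of the completion of $\mathbb C_\infty[T_0(\mathfrak t),\dots,T_{N-1}(\mathfrak t)]$ at the ideal $(T_0(\mathfrak t),\dots,T_{N-1}(\mathfrak t))$ that converge on $\mathcal D$. Let $f(t)=\frac1{t-\eta}-\frac1{\theta-\eta}$, so $f^{(k)}(t)=\frac1{t-\eta^{(k)}}-\Theta^{q^k}$; let $\mathbf s_0=1$, $\mathbf s_i=f^{(0)}\cdots f^{(i-1)}$, a $\mathbb C_\infty$-basis of $\mathcal A\otimes_{\mathbb F_q}\mathbb C_\infty$. $\Psi:\mathcal A\to\mathbb C_\infty\{\tau\}$ is the rank-one Drinfeld module with $\Psi_a=\sum_ic_i\tau^i$ where $a=\sum_ic_i\mathbf s_i$; its coefficients lie in $K(\eta)$. Its exponential is $\sum_n\xi^{q^n}/D_n$ with $D_0=1$, $D_n=D_{n-1}^q\frac{\theta-\theta^{q^n}}{(\theta^{q^n}-\eta)(\theta-\eta)}$. $\Psi^{(2)}$ is obtained by applying $\sigma^2$ to the coefficients of $\Psi$. Let $C_{0,2}=\sqrt[q-1]{\Theta^{\sigma^2-1}}\,\Theta^{\sigma-1}$,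 where $\sqrt[q-1]{\Theta^{\sigma^2-1}}$ denotes a $(q-1)$-th root of $\Theta^{\sigma^2-1}$, and $\Phi_a=C_{0,2}^{-1}\circ\Psi^{(2)}_a\circ C_{0,2}$. $\exp_\Phi$ is the exponential of $\Phi$ (entire, $\mathbb F_q$-linear, derivative $1$ at $0$, $\Phi_a(\exp_\Phi(\xi))=\exp_\Phi(a(\theta)\xi)$ for $a\in\mathcal A$). Put $$\tilde\pi=(-\Theta)^{\frac{\sigma^2}{q-1}}\Theta^\sigma\prod_{k\ge1}\frac{\Theta^{q^k}}{\Theta^{q^k}-\Theta^{\sigma^k}},\quad \tilde\pi_\Phi=\tilde\pi/C_{0,2},\quad \omega_f(\mathfrak t)=(-\Theta)^{\frac1{q-1}}\prod_{k\ge0}\frac{\Theta^{q^k}}{\Theta^{q^k}-\frac1{\mathfrak t-\eta^{(k)}}},$$ where $(-\Theta)^{\frac{\sigma^2}{q-1}}$ denotes a $(q-1)$-th root of $-\Theta^{\sigma^2}$ and $(-\Theta)^{\frac1{q-1}}$ a $(q-1)$-th root of $-\Theta$. The constant $\tilde\pi_\Phi$ is the Carlitz period of $\Phi$ (a generator of the lattice $\ker\exp_\Phi$ over $\iota(\mathcal A)$), and $\omega_f$ is the Anderson–Thakur function. Pellarin type: for $U\in\mathbb C_\infty$, $G(U;\mathfrak t)=\sum_{n\ge0}\frac{U^{q^n}}{D_nQ_n(\mathfrak t)}$, where $Q_n(\mathfrak t)=\Bigl(\frac{\theta^{q^n}-\eta}{\theta^{q^n}-\eta^{(n)}}\Bigr)^2\Bigl(\frac1{\theta^{q^n}-\eta}-\frac1{\mathfrak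 t-\eta}\Bigr)$. Exponential action: for $g=\frac1a\sum_i b_i\otimes l_i\in\mathcal K\otimes_{\mathbb F_q}\mathbb C_\infty$ with $a,b_i\in\mathcal A$, $l_i\in\mathbb C_\infty$, and $U\in\mathbb C_\infty$, put $g\triangleright_\Phi U=\sum_il_i\,\Phi_{b_i}\bigl(\exp_\Phi(U/a(\theta))\bigr)$ (well defined); extend to convergent sums by $\bigl(\sum_k g_k(t)\,h_k(\mathfrak t)\bigr)\triangleright_\Phi U=\sum_k(g_k\triangleright_\Phi U)\,h_k(\mathfrak t)$ with $h_k\in\mathbb T_\eta$. Anderson type: for $U\in\mathbb C_\infty$, $H(U;\mathfrak t)=\frac{\theta-\eta}{\theta-\eta^{(1)}}\cdot\Bigl(\frac{t-\eta^{(1)}}{t-\eta}\bigl(\frac1{t-\eta}-\frac1{\mathfrak t-\eta}\bigr)^{-1}\triangleright_\Phi U\Bigr)$, where the kernel is expanded as $(t-\eta^{(1)})\sum_{k\ge0}\frac{(t-\eta)(t-\eta^{(-1)})\cdots(t-\eta^{(-k+1)})}{(\mathfrak t-\eta^{(-1)})(\mathfrak t-\eta^{(-2)})\cdots(\mathfrak t-\eta^{(-k)})}$. Deformed logarithm: for $\xi\in\mathbb C_\infty$, $\operatorname{Log}(\xi;\mathfrak t)=\xi+\sum_{n\ge1}\frac{\xi^{q^n}}{f^{(1)}(\mathfrak t)\cdots f^{(n)}(\mathfrak t)}$.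
   Formalization: The equality with Log in (3) is proved for |U| < q^{q/(q-1)} only: beyond it Log diverges or the equality fails (U = period). The (q-1)-th roots are chosen compatibly: the root of -Θ^{σ²} is the root of Θ^{σ²-1} times that of -Θ; else (1) holds only up to a factor in F_q^*. *)

theory Defs
  imports "HOL-Analysis.Analysis" "HOL-Computational_Algebra.Computational_Algebra"
begin

text \<open>
  The constant field is the finite type \<open>'k\<close>, so \<open>q = CARD('k)\<close>, and \<open>'c\<close> is the field
  \<open>C_\<infinity>\<close>; its absolute value is the distance to \<open>0\<close>.  The last three components are the
  chosen \<open>(q-1)\<close>-th roots occurring in \<open>C_{0,2}\<close>, in the period and in the Anderson-Thakur
  function, respectively.
\<close>

record (overloaded) ('k::zero, 'c) carlitz_data =
  emb :: "'k \<Rightarrow> 'c"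
  rho :: "'k poly"
  theta :: 'c
  eta :: 'c
  sigma :: "'c \<Rightarrow> 'c"
  root_C :: 'c
  root_pi :: 'c
  root_om :: 'c

definition absv :: "'c::{zero,metric_space} \<Rightarrow> real" where
  "absv x = dist x 0"

definition qq :: "('k::zero, 'c) carlitz_data \<Rightarrow> nat" where
  "qq S = CARD('k)"

definition NN :: "('k::zero, 'c) carlitz_data \<Rightarrow> nat" where
  "NN S = degree (rho S)"

definition rhoC :: "('k::zero, 'c::zero) carlitz_data \<Rightarrow> 'c poly" where
  "rhoC S = map_poly (emb S) (rho S)"

text \<open>
  \<open>etac S i\<close> is \<open>\<eta>\<^sup>(\<^sup>i\<^sup>)\<close>; reducing \<open>i\<close> modulo \<open>N\<close> gives it a meaning for negative \<open>i\<close>.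
  \<open>Thc S k\<close> is the conjugate of \<open>\<Theta>\<close> under \<open>\<sigma>^k\<close>.
\<close>

definition etac :: "('k::zero, 'c::field) carlitz_data \<Rightarrow> int \<Rightarrow> 'c" where
  "etac S i = eta S ^ (qq S ^ nat (i mod int (NN S)))"

definition Thc :: "('k::zero, 'c::field) carlitz_data \<Rightarrow> int \<Rightarrow> 'c" where
  "Thc S k = 1 / (theta S - etac S k)"

inductive_set field_gen :: "'c::field set \<Rightarrow> 'c set" for X where
  base: "x \<in> X \<Longrightarrow> x \<in> field_gen X"
| one: "1 \<in> field_gen X"
| diff: "x \<in> field_gen X \<Longrightarrow> y \<in> field_gen X \<Longrightarrow> x - y \<in> field_gen X"
| mult: "x \<in> field_gen X \<Longrightarrow> y \<in> field_gen X \<Longrightarrow> x * y \<in> field_gen X"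
| inverse: "x \<in> field_gen X \<Longrightarrow> inverse x \<in> field_gen X"

definition Kfield :: "('k::zero, 'c::field) carlitz_data \<Rightarrow> 'c set" where
  "Kfield S = field_gen (insert (theta S) (range (emb S)))"

definition Keta :: "('k::zero, 'c::field) carlitz_data \<Rightarrow> 'c set" where
  "Keta S = field_gen (insert (eta S) (Kfield S))"

definition Krho :: "('k::zero, 'c::{field,metric_space}) carlitz_data \<Rightarrow> 'c set" where
  "Krho S = closure (Kfield S)"

definition algebraic_over :: "'c::field set \<Rightarrow> 'c \<Rightarrow> bool" where
  "algebraic_over F x \<longleftrightarrow> (\<exists>p. p \<noteq> 0 \<and> (\<forall>i. coeff p i \<in> F) \<and> poly p x = 0)"

text \<open>
  Together with the type classes of \<open>'c\<close> (algebraically closed, complete), the conditions on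
  \<open>dist\<close> say that \<open>'c\<close> is a completion of an algebraic closure of \<open>K\<^sub>\<rho>\<close>: since
  \<open>|\<theta> - \<eta>| = 1/q < 1\<close>, \<open>\<theta>\<close> is transcendental over the constants and the absolute value
  restricts to \<open>K\<close> as the absolute value of the place of \<open>\<rho>(\<theta>)\<close>; hence \<open>K\<^sub>\<rho>\<close> is the
  closure of \<open>K\<close>.

  The identity \<open>roots_compatible\<close> is the convention
  \<open>(-\<Theta>)^{\<sigma>^2/(q-1)} = (\<Theta>^{\<sigma>^2-1})^{1/(q-1)} (-\<Theta>)^{1/(q-1)}\<close>.  For independently chosen
  roots the period would change by a factor in the multiplicative group of the constant field.
\<close>

locale carlitz_setting =
  fixes S :: "('k::{field,finite}, 'c::{alg_closed_field,complete_space}) carlitz_data"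
  assumes dist_absv: "dist (x::'c) y = absv (x - y)"
    and absv_mult: "absv ((x::'c) * y) = absv x * absv y"
    and absv_ultrametric: "absv ((x::'c) + y) \<le> max (absv x) (absv y)"
    and emb_one: "emb S 1 = 1"
    and emb_add: "emb S (u + v) = emb S u + emb S v"
    and emb_mult: "emb S (u * v) = emb S u * emb S v"
    and rho_monic: "lead_coeff (rho S) = 1"
    and rho_irreducible: "irreducible (rho S)"
    and N_ge_2: "NN S \<ge> 2"
    and eta_root: "poly (rhoC S) (eta S) = 0"
    and uniformizer: "absv (theta S - eta S) = 1 / real (qq S)"
    and algebraic_dense: "closure {x. algebraic_over (Krho S) x} = UNIV"
    and sigma_bij: "bij_betw (sigma S) (Keta S) (Keta S)"
    and sigma_add: "x \<in> Keta S \<Longrightarrow> y \<in> Keta S \<Longrightarrow> sigma S (x + y) = sigma S x + sigma S y"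
    and sigma_mult: "x \<in> Keta S \<Longrightarrow> y \<in> Keta S \<Longrightarrow> sigma S (x * y) = sigma S x * sigma S y"
    and sigma_fixes: "x \<in> Kfield S \<Longrightarrow> sigma S x = x"
    and sigma_eta: "sigma S (eta S) = eta S ^ qq S"
    and root_C: "root_C S ^ (qq S - 1) = Thc S 2 / Thc S 0"
    and root_pi: "root_pi S ^ (qq S - 1) = - Thc S 2"
    and root_om: "root_om S ^ (qq S - 1) = - Thc S 0"
    and roots_compatible: "root_pi S = root_C S * root_om S"


definition regular_at :: "'k::field poly \<Rightarrow> 'k poly fract \<Rightarrow> bool" where
  "regular_at p x \<longleftrightarrow> (\<exists>a b. \<not> p dvd b \<and> x = Fract a b)"

definition regular_at_infinity :: "'k::field poly fract \<Rightarrow> bool" where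
  "regular_at_infinity x \<longleftrightarrow> (\<exists>a b. b \<noteq> 0 \<and> degree a \<le> degree b \<and> x = Fract a b)"

definition ringA :: "('k::field, 'c) carlitz_data \<Rightarrow> 'k poly fract set" where
  "ringA S = {x. regular_at_infinity x \<and>
     (\<forall>p. irreducible p \<and> lead_coeff p = 1 \<and> p \<noteq> rho S \<longrightarrow> regular_at p x)}"

text \<open>
  \<open>\<K> \<otimes> C_\<infinity>\<close> is regarded as a subring of \<open>C_\<infinity>(t)\<close>; \<open>base_ext\<close> is the inclusion of \<open>\<K>\<close>.
  Evaluation of rational functions is meant at points that are not poles.
\<close>

definition base_ext :: "('k::field, 'c::field) carlitz_data \<Rightarrow> 'k poly fract \<Rightarrow> 'c poly fract" where
  "base_ext S x = (THE y. \<exists>a b. b \<noteq> 0 \<and> x = Fract a b \<and>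
     y = Fract (map_poly (emb S) a) (map_poly (emb S) b))"

definition constC :: "'c::field \<Rightarrow> 'c poly fract" where
  "constC c = Fract [:c:] 1"

definition tvar :: "'c::field poly fract" where
  "tvar = Fract [:0, 1:] 1"

definition rat_eval :: "'c::field poly fract \<Rightarrow> 'c \<Rightarrow> 'c" where
  "rat_eval r x = (THE v. \<exists>a b. poly b x \<noteq> 0 \<and> r = Fract a b \<and> v = poly a x / poly b x)"

definition iota :: "('k::field, 'c::field) carlitz_data \<Rightarrow> 'k poly fract \<Rightarrow> 'c" where
  "iota S a = rat_eval (base_ext S a) (theta S)"


text \<open>Both \<open>f_rat\<close> (in \<open>t\<close>) and \<open>f_val\<close> (at a point of \<open>\<D>\<close>) are the twist \<open>f\<^sup>(\<^sup>k\<^sup>)\<close>.\<close>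

definition f_rat :: "('k::zero, 'c::field) carlitz_data \<Rightarrow> nat \<Rightarrow> 'c poly fract" where
  "f_rat S k = 1 / (tvar - constC (etac S (int k))) - constC (Thc S 0 ^ (qq S ^ k))"

definition f_val :: "('k::zero, 'c::field) carlitz_data \<Rightarrow> nat \<Rightarrow> 'c \<Rightarrow> 'c" where
  "f_val S k z = 1 / (z - etac S (int k)) - Thc S 0 ^ (qq S ^ k)"

definition s_rat :: "('k::zero, 'c::field) carlitz_data \<Rightarrow> nat \<Rightarrow> 'c poly fract" where
  "s_rat S i = (\<Prod>j<i. f_rat S j)"

text \<open>
  The type \<open>'c poly\<close> merely stores the finitely many coefficients of the twisted polynomial
  \<open>\<Psi>\<^sub>a = \<Sum> c\<^sub>i \<tau>\<^sup>i\<close>.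
\<close>

definition Psi :: "('k::field, 'c::field) carlitz_data \<Rightarrow> 'k poly fract \<Rightarrow> 'c poly" where
  "Psi S a = (THE c. base_ext S a = (\<Sum>i\<le>degree c. constC (coeff c i) * s_rat S i))"

definition Psi2_map :: "('k::field, 'c::field) carlitz_data \<Rightarrow> 'k poly fract \<Rightarrow> 'c \<Rightarrow> 'c" where
  "Psi2_map S a x =
     (\<Sum>i\<le>degree (Psi S a). sigma S (sigma S (coeff (Psi S a) i)) * x ^ (qq S ^ i))"

definition C02 :: "('k::zero, 'c::field) carlitz_data \<Rightarrow> 'c" where
  "C02 S = root_C S * (Thc S 1 / Thc S 0)"

definition Phi_map :: "('k::field, 'c::field) carlitz_data \<Rightarrow> 'k poly fract \<Rightarrow> 'c \<Rightarrow> 'c" where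
  "Phi_map S a x = inverse (C02 S) * Psi2_map S a (C02 S * x)"

text \<open>The coefficient \<open>c 1\<close> is the derivative at \<open>0\<close>.\<close>

definition is_exponential ::
  "('k::field, 'c::{field,metric_space}) carlitz_data \<Rightarrow> ('c \<Rightarrow> 'c) \<Rightarrow> bool" where
  "is_exponential S e \<longleftrightarrow>
     (\<exists>c. (\<forall>x. (\<lambda>n. c n * x ^ n) sums e x) \<and> c 1 = 1) \<and>
     (\<forall>x y. e (x + y) = e x + e y) \<and>
     (\<forall>u x. e (emb S u * x) = emb S u * e x) \<and>
     (\<forall>a\<in>ringA S. \<forall>x. Phi_map S a (e x) = e (iota S a * x))"

definition exp_Phi :: "('k::field, 'c::{field,metric_space}) carlitz_data \<Rightarrow> 'c \<Rightarrow> 'c" where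
  "exp_Phi S = (THE e. is_exponential S e)"


text \<open>
  Elements of the Tate algebra are identified with the functions they define on \<open>\<D>\<close>; only
  values on \<open>\<D>\<close> matter.  The condition \<open>\<rho>(z) \<noteq> 0\<close> is needed because division by zero is total.
\<close>

definition Tfun :: "('k::zero, 'c::field) carlitz_data \<Rightarrow> nat \<Rightarrow> 'c \<Rightarrow> 'c" where
  "Tfun S i z = z ^ i / poly (rhoC S) z"

definition Dom :: "('k::zero, 'c::{field,metric_space}) carlitz_data \<Rightarrow> 'c set" where
  "Dom S = {z. poly (rhoC S) z \<noteq> 0 \<and> (\<forall>i<NN S. absv (Tfun S i z) \<le> 1)}"

definition multi_idx :: "('k::zero, 'c) carlitz_data \<Rightarrow> (nat \<Rightarrow> nat) set" where
  "multi_idx S = {I. \<forall>i\<ge>NN S. I i = 0}"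

definition Tmonom :: "('k::zero, 'c::field) carlitz_data \<Rightarrow> (nat \<Rightarrow> nat) \<Rightarrow> 'c \<Rightarrow> 'c" where
  "Tmonom S I z = (\<Prod>i<NN S. Tfun S i z ^ I i)"

definition tate_expansion ::
  "('k::zero, 'c::{field,metric_space}) carlitz_data \<Rightarrow> ((nat \<Rightarrow> nat) \<Rightarrow> 'c) \<Rightarrow> ('c \<Rightarrow> 'c) \<Rightarrow> bool" where
  "tate_expansion S c g \<longleftrightarrow>
     (\<forall>z\<in>Dom S. ((\<lambda>I. c I * Tmonom S I z) has_sum g z) (multi_idx S))"

definition tate :: "('k::zero, 'c::{field,metric_space}) carlitz_data \<Rightarrow> ('c \<Rightarrow> 'c) set" where
  "tate S = {g. \<exists>c. tate_expansion S c g}"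

text \<open>
  Raising the coefficients of an expansion to the \<open>q\<close>-th power fixes the variable, because the
  \<open>T\<^sub>i\<close> have coefficients in the constant field.
\<close>

definition twist ::
  "('k::zero, 'c::{field,metric_space}) carlitz_data \<Rightarrow> ('c \<Rightarrow> 'c) \<Rightarrow> 'c \<Rightarrow> 'c" where
  "twist S g z = (THE w. \<exists>c. tate_expansion S c g \<and>
     ((\<lambda>I. c I ^ qq S * Tmonom S I z) has_sum w) (multi_idx S))"

text \<open>Convergence for the supremum norm on \<open>\<D>\<close>, with a limit in the Tate algebra.\<close>

definition tate_limit ::
  "('k::zero, 'c::{field,metric_space}) carlitz_data \<Rightarrow> (nat \<Rightarrow> 'c \<Rightarrow> 'c) \<Rightarrow> ('c \<Rightarrow> 'c) \<Rightarrow> bool" where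
  "tate_limit S u g \<longleftrightarrow> g \<in> tate S \<and> uniform_limit (Dom S) u g sequentially"


definition pi_factor :: "('k::zero, 'c::field) carlitz_data \<Rightarrow> nat \<Rightarrow> 'c" where
  "pi_factor S k = Thc S 0 ^ (qq S ^ k) / (Thc S 0 ^ (qq S ^ k) - Thc S (int k))"

definition pi_tilde :: "('k::zero, 'c::{field,metric_space}) carlitz_data \<Rightarrow> 'c" where
  "pi_tilde S = root_pi S * Thc S 1 * (\<Prod>k. pi_factor S (Suc k))"

definition pi_Phi :: "('k::zero, 'c::{field,metric_space}) carlitz_data \<Rightarrow> 'c" where
  "pi_Phi S = pi_tilde S / C02 S"

definition omega_factor :: "('k::zero, 'c::field) carlitz_data \<Rightarrow> nat \<Rightarrow> 'c \<Rightarrow> 'c" where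
  "omega_factor S k z =
     Thc S 0 ^ (qq S ^ k) / (Thc S 0 ^ (qq S ^ k) - 1 / (z - etac S (int k)))"

definition omega :: "('k::zero, 'c::{field,metric_space}) carlitz_data \<Rightarrow> 'c \<Rightarrow> 'c" where
  "omega S z = root_om S * (\<Prod>k. omega_factor S k z)"

primrec Dn :: "('k::zero, 'c::field) carlitz_data \<Rightarrow> nat \<Rightarrow> 'c" where
  "Dn S 0 = 1"
| "Dn S (Suc n) = Dn S n ^ qq S *
     ((theta S - theta S ^ (qq S ^ Suc n)) /
      ((theta S ^ (qq S ^ Suc n) - eta S) * (theta S - eta S)))"

definition Qn :: "('k::zero, 'c::field) carlitz_data \<Rightarrow> nat \<Rightarrow> 'c \<Rightarrow> 'c" where
  "Qn S n z =
     ((theta S ^ (qq S ^ n) - eta S) / (theta S ^ (qq S ^ n) - etac S (int n)))\<^sup>2 *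
     (1 / (theta S ^ (qq S ^ n) - eta S) - 1 / (z - eta S))"

definition G_term :: "('k::zero, 'c::field) carlitz_data \<Rightarrow> 'c \<Rightarrow> nat \<Rightarrow> 'c \<Rightarrow> 'c" where
  "G_term S U n z = U ^ (qq S ^ n) / (Dn S n * Qn S n z)"

definition G_fun :: "('k::zero, 'c::{field,metric_space}) carlitz_data \<Rightarrow> 'c \<Rightarrow> 'c \<Rightarrow> 'c" where
  "G_fun S U z = (\<Sum>n. G_term S U n z)"

definition exp_act ::
  "('k::field, 'c::{field,metric_space}) carlitz_data \<Rightarrow> 'c poly fract \<Rightarrow> 'c \<Rightarrow> 'c" where
  "exp_act S g U = (THE w. \<exists>a m b l.
     a \<in> ringA S \<and> a \<noteq> 0 \<and> (\<forall>i<m. b i \<in> ringA S) \<and>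
     g = 1 / base_ext S a * (\<Sum>i<(m::nat). base_ext S (b i) * constC (l i)) \<and>
     w = (\<Sum>i<m. l i * Phi_map S (b i) (exp_Phi S (U / iota S a))))"

text \<open>The \<open>k\<close>-th term of the expanded kernel is \<open>kernel_t S k \<otimes> kernel_z S k\<close>.\<close>

definition kernel_t :: "('k::zero, 'c::field) carlitz_data \<Rightarrow> nat \<Rightarrow> 'c poly fract" where
  "kernel_t S k = (tvar - constC (etac S 1)) * (\<Prod>j<k. tvar - constC (etac S (- int j)))"

definition kernel_z :: "('k::zero, 'c::field) carlitz_data \<Rightarrow> nat \<Rightarrow> 'c \<Rightarrow> 'c" where
  "kernel_z S k z = 1 / (\<Prod>j=1..k. z - etac S (- int j))"

definition H_term :: "('k::field, 'c::{field,metric_space}) carlitz_data \<Rightarrow> 'c \<Rightarrow> nat \<Rightarrow> 'c \<Rightarrow> 'c" where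
  "H_term S U k z = exp_act S (kernel_t S k) U * kernel_z S k z"

definition H_fun :: "('k::field, 'c::{field,metric_space}) carlitz_data \<Rightarrow> 'c \<Rightarrow> 'c \<Rightarrow> 'c" where
  "H_fun S U z = (theta S - eta S) / (theta S - etac S 1) * (\<Sum>k. H_term S U k z)"

text \<open>
  On \<open>\<D>\<close> one has \<open>|f\<^sup>(\<^sup>i\<^sup>)(z)| = q^(q^i)\<close>, so the deformed logarithm converges there exactly
  for \<open>|\<xi>| < q^(q/(q-1))\<close>, and \<open>q^(q/(q-1))\<close> is the absolute value of the period \<open>pi_Phi S\<close>.
\<close>

definition Log_term :: "('k::zero, 'c::field) carlitz_data \<Rightarrow> 'c \<Rightarrow> nat \<Rightarrow> 'c \<Rightarrow> 'c" where
  "Log_term S \<xi> n z = \<xi> ^ (qq S ^ n) / (\<Prod>i=1..n. f_val S i z)"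

definition Log_fun :: "('k::zero, 'c::{field,metric_space}) carlitz_data \<Rightarrow> 'c \<Rightarrow> 'c \<Rightarrow> 'c" where
  "Log_fun S \<xi> z = (\<Sum>n. Log_term S \<xi> n z)"

end

theory Submission
  imports Defs
begin

text \<open>
  Everything is expanded at the nodes \<open>\<theta>\<^bsup>q\<^sup>n\<^esup>\<close>.  The functions \<open>s\<^sub>i\<close> are a Newton basis for these nodes, with
  \<open>s\<^sub>i(\<theta>\<^bsup>q\<^sup>n\<^esup>) = D\<^sub>n / D\<^bsub>n-i\<^esub>\<^bsup>q\<^sup>i\<^esup>\<close>, which is the functional equation of the exponential of \<open>\<Psi>\<close>; conjugating by
  \<open>\<sigma>\<^sup>2\<close> and rescaling gives \<open>exp\<^sub>\<Phi>(U) = \<Sum>\<^sub>n E\<^sub>n U\<^bsup>q\<^sup>n\<^esup>\<close> with \<open>E\<^sub>n\<close> in closed form.  Hence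
  \<open>g \<triangleright> U = \<Sum>\<^sub>n E\<^sub>n g(\<theta>\<^bsup>q\<^sup>n\<^esup>) U\<^bsup>q\<^sup>n\<^esup>\<close>, and the kernel of \<open>H\<close> telescopes at each node to the term
  \<open>(z - \<eta>)/(z - \<theta>\<^bsup>q\<^sup>n\<^esup>)\<close> of \<open>G\<close>.  The difference equation for \<open>G\<close> is a comparison of coefficients of \<open>U\<^bsup>q\<^sup>n\<^esup>\<close>,
  and its iteration yields the logarithm.  Finally \<open>\<omega>\<^sub>f\<close> is a multiple of \<open>\<Prod>\<^sub>k (z - \<eta>\<^sup>(\<^sup>k\<^sup>))/(z - \<theta>\<^bsup>q\<^sup>k\<^esup>)\<close>, whose
  partial fraction decomposition is \<open>G\<close> at the period.
\<close>

subsection \<open>Ultrametric analysis\<close>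

text \<open>Why these nodes: \<open>f^(j)\<close> is \<open>1/(t - \<eta>^(j))\<close> minus the
  value of this function at the \<open>q^j\<close>-th power of \<theta>, so it vanishes there; and a
  rational function over the constants takes at the n-th node the \<open>q^n\<close>-th power of its
  value at \<theta>. Evaluation therefore gives a triangular system for the coefficients of
  \<open>Psi\<close>. All estimates rest on one fact: the n-th node is within
  \<open>q^(-q^n)\<close> of \<open>\<eta>^(n)\<close> and at distance 1 from every other conjugate,
  while points of \<open>Dom S\<close> stay at distance at least 1 from all conjugates. The
  exponential, the action and the twist are definite descriptions, so existence and uniqueness have
  to be proved for each. Twists are handled pointwise: every z is some \<open>y^q\<close>, and the
  twist of g takes the value \<open>g(y)^q\<close> at z. In the partial fractions of a finite
  product for \<omega> the coefficients depend on the length of the product, so termwise convergence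
  is not enough and a uniform estimate is required. The bound on U for the logarithm is the one that
  gives \<open>|G| < r\<close> with \<open>r = q^(1/(q-1))\<close>, the positive solution of
  \<open>r^q = q r\<close>.\<close>

locale ultrametric_field =
  fixes type_token :: "'c::{field,complete_space} itself"
  assumes dist_conv_absv: "dist (x::'c) y = absv (x - y)"
    and absv_times: "absv ((x::'c) * y) = absv x * absv y"
    and absv_add_max: "absv ((x::'c) + y) \<le> max (absv x) (absv y)"
begin

lemma absv_zero [simp]: "absv (0::'c) = 0"
  by (simp add: absv_def)

lemma absv_eq_0_iff [simp]: "absv (x::'c) = 0 \<longleftrightarrow> x = 0"
  by (simp add: absv_def)

lemma absv_nonneg [simp]: "0 \<le> absv (x::'c)"
  by (simp add: absv_def)

lemma absv_pos_iff [simp]: "0 < absv (x::'c) \<longleftrightarrow> x \<noteq> 0"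
  by (simp add: absv_def)

lemma absv_one [simp]: "absv (1::'c) = 1"
  using absv_times[of 1 1] absv_eq_0_iff[of 1] by simp

lemma absv_power: "absv ((x::'c) ^ n) = absv x ^ n"
  by (induction n) (auto simp: absv_times)

lemma absv_minus [simp]: "absv (- (x::'c)) = absv x"
proof -
  have "absv (-1::'c) ^ 2 = 1"
    by (subst absv_power [symmetric]) simp
  then have "absv (-1::'c) = 1"
    by (metis abs_of_nonneg absv_nonneg abs_square_eq_1)
  then show ?thesis
    using absv_times[of "-1" x] by simp
qed

lemma absv_minus_commute: "absv ((x::'c) - y) = absv (y - x)"
  using absv_minus[of "x - y"] by simp

lemma absv_inverse: "absv (inverse (x::'c)) = inverse (absv x)"
proof (cases "x = 0")
  case False
  then have "absv x * absv (inverse x) = 1"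
    by (simp flip: absv_times)
  then show ?thesis
    by (metis inverse_unique)
qed simp

lemma absv_divide: "absv ((x::'c) / y) = absv x / absv y"
  by (simp add: divide_inverse absv_times absv_inverse)

lemma absv_prod: "absv (\<Prod>i\<in>A. f i :: 'c) = (\<Prod>i\<in>A. absv (f i))"
  by (induction A rule: infinite_finite_induct) (auto simp: absv_times)

lemma absv_diff_max: "absv ((x::'c) - y) \<le> max (absv x) (absv y)"
  using absv_add_max[of x "- y"] by simp

lemma absv_add_le: "absv (x::'c) \<le> B \<Longrightarrow> absv y \<le> B \<Longrightarrow> absv (x + y) \<le> B"
  using absv_add_max[of x y] by simp

lemma absv_diff_le: "absv (x::'c) \<le> B \<Longrightarrow> absv y \<le> B \<Longrightarrow> absv (x - y) \<le> B"
  using absv_diff_max[of x y] by simp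

lemma absv_add_less: "absv (x::'c) < B \<Longrightarrow> absv y < B \<Longrightarrow> absv (x + y) < B"
  using absv_add_max[of x y] by simp

lemma absv_triangle: "absv ((x::'c) + y) \<le> absv x + absv y"
  by (rule order_trans[OF absv_add_max]) simp

text \<open>Isosceles triangle principle: writing \<open>y = (x + y) - x\<close>, the summand x is
  too small to account for the size of y.\<close>

lemma absv_add_eq:
  assumes "absv (x::'c) < absv y"
  shows "absv (x + y) = absv y"
proof (rule antisym)
  show "absv (x + y) \<le> absv y"
    using absv_add_max[of x y] assms by simp
  show "absv y \<le> absv (x + y)"
    using absv_diff_max[of "x + y" x] assms by simp
qed

lemma absv_diff_eq: "absv (x::'c) < absv y \<Longrightarrow> absv (x - y) = absv y"
  using absv_add_eq[of x "- y"] by simp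

lemma absv_eq_of_close: "absv ((x::'c) - y) < absv y \<Longrightarrow> absv x = absv y"
  using absv_add_eq[of "x - y" y] by simp

lemma absv_sum_le:
  "(\<And>i. i \<in> A \<Longrightarrow> absv (f i :: 'c) \<le> B) \<Longrightarrow> 0 \<le> B \<Longrightarrow> absv (\<Sum>i\<in>A. f i) \<le> B"
  by (induction A rule: infinite_finite_induct) (auto intro!: absv_add_le)

lemma absv_sum_less:
  "(\<And>i. i \<in> A \<Longrightarrow> absv (f i :: 'c) < B) \<Longrightarrow> 0 < B \<Longrightarrow> absv (\<Sum>i\<in>A. f i) < B"
  by (induction A rule: infinite_finite_induct) (auto intro!: absv_add_less)

text \<open>\<open>'c\<close> is given only as a field with a complete metric; through this
  equivalence the limit laws for it reduce to limits of real sequences.\<close>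

lemma tendsto_iff_absv: "(X \<longlongrightarrow> (L::'c)) F \<longleftrightarrow> ((\<lambda>n. absv (X n - L)) \<longlongrightarrow> 0) F"
  by (simp add: tendsto_dist_iff[of X] dist_conv_absv)

lemma tendsto_absv: "(X \<longlongrightarrow> (L::'c)) F \<Longrightarrow> ((\<lambda>n. absv (X n)) \<longlongrightarrow> absv L) F"
  unfolding absv_def by (intro tendsto_intros)

lemma tendsto_plus:
  assumes "(X \<longlongrightarrow> (L::'c)) F" "(Y \<longlongrightarrow> M) F"
  shows "((\<lambda>n. X n + Y n) \<longlongrightarrow> L + M) F"
proof -
  have "((\<lambda>n. absv (X n - L) + absv (Y n - M)) \<longlongrightarrow> 0) F"
    using assms[unfolded tendsto_iff_absv] by (rule tendsto_add_zero)
  moreover have "absv (X n + Y n - (L + M)) \<le> absv (X n - L) + absv (Y n - M)" for n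
    using absv_triangle[of "X n - L" "Y n - M"] by (simp add: algebra_simps)
  ultimately show ?thesis
    unfolding tendsto_iff_absv[of _ "L + M"]
    by (rule_tac tendsto_sandwich[of "\<lambda>_. 0"]) auto
qed

lemma tendsto_times_left: "(X \<longlongrightarrow> (L::'c)) F \<Longrightarrow> ((\<lambda>n. c * X n) \<longlongrightarrow> c * L) F"
  unfolding tendsto_iff_absv
  by (auto simp: absv_times simp flip: right_diff_distrib intro: tendsto_mult_right_zero)

lemma tendsto_minus_iff: "((\<lambda>n. - X n) \<longlongrightarrow> - (L::'c)) F \<longleftrightarrow> (X \<longlongrightarrow> L) F"
  by (simp add: tendsto_iff_absv absv_minus_commute)

lemma tendsto_minus_diff:
  assumes "(X \<longlongrightarrow> (L::'c)) F" "(Y \<longlongrightarrow> M) F"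
  shows "((\<lambda>n. X n - Y n) \<longlongrightarrow> L - M) F"
  using tendsto_plus[of X L F "\<lambda>n. - Y n" "- M"] assms by (simp add: tendsto_minus_iff)

lemma sums_plus: "f sums (s::'c) \<Longrightarrow> g sums t \<Longrightarrow> (\<lambda>n. f n + g n) sums (s + t)"
  unfolding sums_def by (simp add: sum.distrib tendsto_plus)

lemma sums_times_left: "f sums (s::'c) \<Longrightarrow> (\<lambda>n. c * f n) sums (c * s)"
  unfolding sums_def by (simp flip: sum_distrib_left add: tendsto_times_left)

lemma sums_minus_diff: "f sums (s::'c) \<Longrightarrow> g sums t \<Longrightarrow> (\<lambda>n. f n - g n) sums (s - t)"
  unfolding sums_def by (simp add: sum_subtractf tendsto_minus_diff)

lemma sums_finite_sum:
  "(\<And>i. i \<in> A \<Longrightarrow> f i sums (s i::'c)) \<Longrightarrow> (\<lambda>n. \<Sum>i\<in>A. f i n) sums (\<Sum>i\<in>A. s i)"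
  by (induction A rule: infinite_finite_induct) (auto intro!: sums_plus sums_zero)

text \<open>Aligns series by exponent: the \<open>q^k\<close>-th power of a series in the
  \<open>x^(q^n)\<close> starts at \<open>x^(q^k)\<close>.\<close>

lemma sums_shift_zero:
  assumes "f sums (s::'c)"
  shows "(\<lambda>n. if n < k then 0 else f (n - k)) sums s"
proof -
  have "(\<lambda>n. \<Sum>i<n + k. if i < k then 0 else f (i - k)) = (\<lambda>n. \<Sum>i<n. f i)"
  proof
    fix n
    have "(\<Sum>i<n + k. if i < k then 0 else f (i - k)) = (\<Sum>i\<in>{k..<n+k}. f (i - k))"
      by (rule sum.mono_neutral_cong_right) auto
    also have "\<dots> = (\<Sum>i<n. f i)"
      by (rule sum.reindex_bij_witness[of _ "\<lambda>i. i + k" "\<lambda>i. i - k"]) auto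
    finally show "(\<Sum>i<n + k. if i < k then 0 else f (i - k)) = (\<Sum>i<n. f i)" .
  qed
  then show ?thesis
    using assms unfolding sums_def by (subst LIMSEQ_offset[of _ k]) auto
qed

lemma tendsto_absv_le:
  assumes "(X \<longlongrightarrow> (L::'c)) sequentially" "\<And>n. n \<ge> m \<Longrightarrow> absv (X n) \<le> B"
  shows "absv L \<le> B"
  by (rule LIMSEQ_le_const2[OF tendsto_absv[OF assms(1)]]) (use assms(2) in blast)

lemma sums_absv_le:
  assumes "f sums (s::'c)" "\<And>n. absv (f n) \<le> B"
  shows "absv s \<le> B"
proof -
  have "0 \<le> B"
    using assms(2)[of 0] absv_nonneg order_trans by blast
  then show ?thesis
    using assms by (intro tendsto_absv_le[OF assms(1)[unfolded sums_def], of 0] absv_sum_le) auto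
qed

text \<open>A single bound replaces the sum of all remaining bounds, so uniform convergence only
  asks for uniformly small terms.\<close>

lemma sums_absv_tail_le:
  assumes "f sums (s::'c)" "\<And>n. n \<ge> m \<Longrightarrow> absv (f n) \<le> B" "0 \<le> B"
  shows "absv ((\<Sum>n<m. f n) - s) \<le> B"
proof -
  have "(\<lambda>k. (\<Sum>n<m. f n) - (\<Sum>n<k. f n)) \<longlonglongrightarrow> (\<Sum>n<m. f n) - s"
    using assms(1) unfolding sums_def by (intro tendsto_minus_diff tendsto_const)
  then show ?thesis
  proof (rule tendsto_absv_le[of _ _ m])
    fix k assume "m \<le> k"
    then have "(\<Sum>n<k. f n) - (\<Sum>n<m. f n) = (\<Sum>n\<in>{m..<k}. f n)"
      using sum_diff_nat_ivl[of 0 m k f] by (simp add: lessThan_atLeast0)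
    then show "absv ((\<Sum>n<m. f n) - (\<Sum>n<k. f n)) \<le> B"
      using assms by (subst absv_minus_commute) (auto intro!: absv_sum_le)
  qed
qed

text \<open>A block of consecutive terms is no larger than its largest term, so null terms already
  make the partial sums Cauchy.\<close>

lemma summable_absv:
  assumes "(\<lambda>n. absv (f n :: 'c)) \<longlonglongrightarrow> 0"
  shows "summable f"
proof -
  have "Cauchy (\<lambda>n. \<Sum>i<n. f i)"
  proof (rule metric_CauchyI)
    fix e :: real assume "0 < e"
    then obtain M where M: "\<And>n. n \<ge> M \<Longrightarrow> absv (f n) < e"
      using order_tendstoD(2)[OF assms] unfolding eventually_sequentially by blast
    have *: "absv ((\<Sum>i<n. f i) - (\<Sum>i<m. f i)) < e" if "M \<le> m" "m \<le> n" for m n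
    proof -
      have "(\<Sum>i<n. f i) - (\<Sum>i<m. f i) = (\<Sum>i\<in>{m..<n}. f i)"
        using sum_diff_nat_ivl[of 0 m n f] that by (simp add: lessThan_atLeast0)
      then show ?thesis
        using M that \<open>0 < e\<close> by (auto intro!: absv_sum_less)
    qed
    show "\<exists>M. \<forall>m\<ge>M. \<forall>n\<ge>M. dist (\<Sum>i<m. f i) (\<Sum>i<n. f i) < e"
    proof (intro exI allI impI)
      fix m n assume "M \<le> m" "M \<le> n"
      then show "dist (\<Sum>i<m. f i) (\<Sum>i<n. f i) < e"
        unfolding dist_conv_absv
        using *[of m n] *[of n m] by (cases "m \<le> n") (auto simp: absv_minus_commute)
    qed
  qed
  then show ?thesis
    unfolding summable_def sums_def using Cauchy_convergent convergent_def by blast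
qed

lemma summable_absv_bound:
  assumes "r \<longlonglongrightarrow> 0" "\<And>n. absv (f n :: 'c) \<le> r n"
  shows "summable f"
  by (rule summable_absv, rule tendsto_sandwich[of "\<lambda>_. 0" _ _ r]) (use assms in auto)

lemma sums_imp_absv_tendsto_zero:
  assumes "f sums (s::'c)"
  shows "(\<lambda>n. absv (f n)) \<longlonglongrightarrow> 0"
proof -
  have "(\<lambda>n. (\<Sum>i<Suc n. f i) - (\<Sum>i<n. f i)) \<longlonglongrightarrow> s - s"
    using assms unfolding sums_def by (intro tendsto_minus_diff LIMSEQ_Suc)
  then show ?thesis
    by (simp add: tendsto_iff_absv)
qed

lemma uniform_limit_sums:
  assumes "r \<longlonglongrightarrow> 0" "\<And>n z. z \<in> A \<Longrightarrow> absv (f n z :: 'c) \<le> r n"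
    and "\<And>z. z \<in> A \<Longrightarrow> (\<lambda>n. f n z) sums g z"
  shows "uniform_limit A (\<lambda>m z. \<Sum>n<m. f n z) g sequentially"
proof (rule uniform_limitI)
  fix e :: real assume "0 < e"
  then obtain M where M: "\<And>n. n \<ge> M \<Longrightarrow> r n < e / 2"
    using order_tendstoD(2)[OF assms(1), of "e / 2"] unfolding eventually_sequentially by auto
  show "\<forall>\<^sub>F m in sequentially. \<forall>z\<in>A. dist (\<Sum>n<m. f n z) (g z) < e"
    unfolding eventually_sequentially
  proof (intro exI allI impI ballI)
    fix m z assume "M \<le> m" "z \<in> A"
    then have "absv ((\<Sum>n<m. f n z) - g z) \<le> e / 2"
      using assms(3) \<open>0 < e\<close> order_trans[OF assms(2) less_imp_le[OF M]]
      by (intro sums_absv_tail_le) (auto simp del: divide_le_eq_numeral1 le_divide_eq_numeral1)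
    then show "dist (\<Sum>n<m. f n z) (g z) < e"
      using \<open>0 < e\<close> by (simp add: dist_conv_absv)
  qed
qed

lemma has_sum_iff_absv:
  "((f has_sum (s::'c)) A) \<longleftrightarrow>
     (\<forall>e>0. \<exists>F0. finite F0 \<and> F0 \<subseteq> A \<and>
        (\<forall>F. finite F \<and> F0 \<subseteq> F \<and> F \<subseteq> A \<longrightarrow> absv (sum f F - s) < e))"
  unfolding has_sum_def tendsto_iff eventually_finite_subsets_at_top dist_conv_absv
  by (auto simp: conj_assoc)

text \<open>Enlarging \<open>F\<close> changes the finite sum by no more than the largest added
  term, so one good finite set with small terms outside controls all larger ones.\<close>

lemma has_sum_absvI:
  assumes "\<And>e. 0 < e \<Longrightarrow> \<exists>F. finite F \<and> F \<subseteq> A \<and> absv (sum f F - (s::'c)) < e \<and>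
     (\<forall>a\<in>A - F. absv (f a) < e)"
  shows "(f has_sum s) A"
  unfolding has_sum_iff_absv
proof (intro allI impI)
  fix e :: real assume "0 < e"
  then obtain F where F: "finite F" "F \<subseteq> A" "absv (sum f F - s) < e"
    "\<And>a. a \<in> A - F \<Longrightarrow> absv (f a) < e"
    using assms by metis
  show "\<exists>F0. finite F0 \<and> F0 \<subseteq> A \<and>
        (\<forall>F. finite F \<and> F0 \<subseteq> F \<and> F \<subseteq> A \<longrightarrow> absv (sum f F - s) < e)"
  proof (intro exI[of _ F] conjI allI impI)
    fix F' assume F': "finite F' \<and> F \<subseteq> F' \<and> F' \<subseteq> A"
    then have "sum f F' - s = (sum f F - s) + sum f (F' - F)"
      by (simp add: sum_diff)
    moreover have "absv (sum f (F' - F)) < e"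
      using F F' \<open>0 < e\<close> by (intro absv_sum_less) auto
    ultimately show "absv (sum f F' - s) < e"
      using F(3) by (metis absv_add_less)
  qed (use F in auto)
qed

text \<open>The increments of the partial products are \<open>P_m (p_m - 1)\<close>, bounded by
  \<open>r m\<close>; the product thus becomes a series, and the series tail bound gives the rate of
  convergence.\<close>

lemma prod_minus_one_le:
  assumes "\<And>k. absv (p k :: 'c) \<le> 1" "\<And>k. absv (p k - 1) \<le> r k" "r \<longlonglongrightarrow> 0"
  obtains L where "(\<lambda>m. \<Prod>k<m. p k) \<longlonglongrightarrow> L"
    "\<And>m B. 0 \<le> B \<Longrightarrow> (\<And>k. k \<ge> m \<Longrightarrow> r k \<le> B) \<Longrightarrow> absv ((\<Prod>k<m. p k) - L) \<le> B"
proof -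
  define f where "f m = (\<Prod>k<m. p k) * (p m - 1)" for m
  have P: "absv (\<Prod>k<m. p k) \<le> 1" for m
    using assms(1) by (auto simp: absv_prod intro!: prod_le_1)
  have f: "absv (f m) \<le> r m" for m
    using mult_mono[OF P assms(2)] by (simp add: f_def absv_times)
  have sum_f: "(\<Sum>k<m. f k) = (\<Prod>k<m. p k) - 1" for m
    by (induction m) (auto simp: f_def algebra_simps)
  obtain s where s: "f sums s"
    using summable_absv_bound[OF assms(3) f] unfolding summable_def by blast
  show thesis
  proof (rule that)
    show "(\<lambda>m. \<Prod>k<m. p k) \<longlonglongrightarrow> s + 1"
      using tendsto_plus[OF s[unfolded sums_def] tendsto_const[of 1]] by (simp add: sum_f)
    show "absv ((\<Prod>k<m. p k) - (s + 1)) \<le> B" if "0 \<le> B" "\<And>k. k \<ge> m \<Longrightarrow> r k \<le> B" for m B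
      using sums_absv_tail_le[OF s, of m B] that f by (simp add: sum_f algebra_simps)
        (meson order_trans)
  qed
qed

text \<open>\<open>has_prod\<close> demands a nonzero limit; factors of absolute value 1 force
  \<open>absv L = 1\<close>.\<close>

lemma has_prod_unit_factors:
  assumes "\<And>k. absv (p k :: 'c) = 1" "(\<lambda>m. \<Prod>k<m. p k) \<longlonglongrightarrow> L"
  shows "p has_prod L"
proof -
  have "(\<lambda>m. absv (\<Prod>k<m. p k)) \<longlonglongrightarrow> absv L"
    by (rule tendsto_absv[OF assms(2)])
  then have "absv L = 1"
    by (simp add: absv_prod assms(1) LIMSEQ_const_iff)
  then have "L \<noteq> 0"
    by auto
  moreover have "(\<lambda>m. \<Prod>k\<le>m. p k) \<longlonglongrightarrow> L"
    using LIMSEQ_Suc[OF assms(2)] by (simp add: lessThan_Suc_atMost)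
  ultimately show ?thesis
    by (auto simp: has_prod_def raw_has_prod_def)
qed

end

section \<open>Finite fields of constants and the Frobenius map\<close>

lemma power_card_eq_self:
  fixes E :: "'a::field set"
  assumes "finite E" "0 \<in> E" "\<And>x y. x \<in> E \<Longrightarrow> y \<in> E \<Longrightarrow> x * y \<in> E" "x \<in> E"
  shows "x ^ card E = x"
proof (cases "x = 0")
  case True
  then show ?thesis
    using assms(1,2) by (auto simp: power_0_left card_eq_0_iff)
next
  case False
  define A where "A = E - {0}"
  have A: "finite A" "card E = Suc (card A)"
    using assms(1) card.remove[OF assms(1,2)] by (auto simp: A_def)
  have inj: "inj_on ((*) x) A"
    using False by (auto simp: inj_on_def)
  have "(*) x ` A = A"
    by (rule endo_inj_surj[OF A(1) _ inj]) (use assms False in \<open>auto simp: A_def\<close>)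
  then have "(\<Prod>y\<in>A. y) = (\<Prod>y\<in>A. x * y)"
    using prod.reindex[OF inj, of "\<lambda>y. y"] by simp
  also have "\<dots> = x ^ card A * (\<Prod>y\<in>A. y)"
    by (simp add: prod.distrib)
  finally have "x ^ card A = 1"
    using A(1) by (auto simp: A_def)
  then show ?thesis
    by (simp add: A(2))
qed

text \<open>The leading terms cancel, so the difference has degree below \<open>card A\<close> and
  yet vanishes on \<open>A\<close>. Monicity is what allows degree equal to \<open>card A\<close>:
  identities of degree \<open>q\<close> can be tested on the \<open>q\<close> constants.\<close>

lemma monic_poly_eqI:
  fixes p r :: "'a::idom poly"
  assumes "lead_coeff p = 1" "lead_coeff r = 1" "degree p = degree r" "degree p \<le> card A"
    and "\<And>x. x \<in> A \<Longrightarrow> poly p x = poly r x"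
  shows "p = r"
proof (rule ccontr)
  assume neq: "p \<noteq> r"
  have "degree (p - r) \<noteq> degree p"
  proof
    assume deg: "degree (p - r) = degree p"
    have "coeff (p - r) (degree p) = 0"
      using assms(1-3) by simp
    then show False
      using neq leading_coeff_0_iff[of "p - r"] unfolding deg by simp
  qed
  then have "degree (p - r) < degree p"
    using degree_diff_le[of p "degree p" r] assms(3) by simp
  moreover have "card A \<le> degree (p - r)"
  proof -
    have "card A \<le> card {x. poly (p - r) x = 0}"
      using assms(5) neq poly_roots_finite[of "p - r"] by (intro card_mono) auto
    also have "\<dots> \<le> degree (p - r)"
      using neq by (intro card_poly_roots_bound) auto
    finally show ?thesis .
  qed
  ultimately show False
    using assms(4) by linarith
qed

sublocale carlitz_setting \<subseteq> ultrametric_field "TYPE('c)"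
  by unfold_locales (fact dist_absv absv_mult absv_ultrametric)+

context carlitz_setting
begin

abbreviation q :: nat where "q \<equiv> qq S"
abbreviation N :: nat where "N \<equiv> NN S"
abbreviation ep :: "'k poly \<Rightarrow> 'c poly" where "ep \<equiv> map_poly (emb S)"
abbreviation th :: "nat \<Rightarrow> 'c" where "th n \<equiv> theta S ^ q ^ n"

lemma q_ge_2: "q \<ge> 2"
proof -
  have "card {0, 1::'k} \<le> CARD('k)"
    by (intro card_mono) auto
  then show ?thesis
    by (simp add: qq_def)
qed

lemma q_pos [simp]: "0 < q" and real_q_gt_1: "1 < real q"
  using q_ge_2 by auto

lemma q_power_pos [simp]: "0 < q ^ n"
  by simp

lemma N_pos [simp]: "0 < N"
  using N_ge_2 by simp

lemma emb_zero [simp]: "emb S 0 = 0"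
  using emb_add[of 0 0] by (metis add_cancel_right_right)

lemma emb_eq_0_iff [simp]: "emb S u = 0 \<longleftrightarrow> u = 0"
proof
  assume "emb S u = 0"
  then show "u = 0"
    using emb_mult[of u "inverse u"] emb_one by (cases "u = 0") auto
qed simp

lemma emb_diff: "emb S (u - v) = emb S u - emb S v"
  using emb_add[of "u - v" v] by simp

lemma emb_eq_iff: "emb S u = emb S v \<longleftrightarrow> u = v"
  using emb_diff[of u v] by (metis emb_eq_0_iff eq_iff_diff_eq_0)

lemma emb_power: "emb S (u ^ n) = emb S u ^ n"
  by (induction n) (auto simp: emb_one emb_mult)

lemma emb_power_q: "emb S u ^ q = emb S u"
  using power_card_eq_self[of "UNIV :: 'k set" u] by (simp add: qq_def flip: emb_power)

lemma ep_add: "ep (p + r) = ep p + ep r"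
  by (rule poly_eqI) (simp add: coeff_map_poly emb_add)

lemma ep_diff: "ep (p - r) = ep p - ep r"
  by (rule poly_eqI) (simp add: coeff_map_poly emb_diff)

lemma ep_smult: "ep (smult c p) = smult (emb S c) (ep p)"
  by (simp add: map_poly_smult emb_mult)

lemma ep_pCons [simp]: "ep (pCons c p) = pCons (emb S c) (ep p)"
  by (simp add: map_poly_pCons)

lemma ep_mult: "ep (p * r) = ep p * ep r"
  by (induction p) (auto simp: ep_add ep_smult)

lemma ep_one [simp]: "ep 1 = 1"
  by (simp add: emb_one)

lemma ep_power: "ep (p ^ n) = ep p ^ n"
  by (induction n) (auto simp: ep_mult)

lemma ep_eq_0_iff [simp]: "ep p = 0 \<longleftrightarrow> p = 0"
  by (simp add: map_poly_eq_0_iff)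

lemma degree_ep [simp]: "degree (ep p) = degree p"
  by (simp add: degree_map_poly)

lemma poly_X_power_q_minus_X: "(\<Prod>u\<in>UNIV. x - emb S u) = x ^ q - (x::'c)"
proof -
  have inj: "inj (emb S)"
    by (auto simp: inj_def emb_eq_iff)
  have "(\<Prod>u\<in>UNIV. [:- emb S u, 1:]) = monom 1 q - [:0, 1:]"
  proof (rule monic_poly_eqI[of _ _ "range (emb S)"])
    have deg: "degree (monom 1 q - [:0, 1::'c:]) = q"
      using q_ge_2 by (subst diff_conv_add_uminus, subst degree_add_eq_left) (auto simp: degree_monom_eq)
    then show "degree (\<Prod>u\<in>UNIV. [:- emb S u, 1:]) = degree (monom 1 q - [:0, 1::'c:])"
      by (subst degree_prod_eq_sum_degree) (auto simp: qq_def)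
    then show "degree (\<Prod>u\<in>UNIV. [:- emb S u, 1:]) \<le> card (range (emb S))"
      using deg inj by (simp add: card_image qq_def)
    have "coeff (monom 1 q - [:0, 1::'c:]) q = 1"
      using q_ge_2 by (simp add: coeff_pCons split: nat.splits)
    then show "lead_coeff (monom 1 q - [:0, 1::'c:]) = 1"
      using deg by simp
  next
    show "lead_coeff (\<Prod>u\<in>UNIV. [:- emb S u, 1:]) = 1"
      by (simp add: lead_coeff_prod)
  next
    fix x assume "x \<in> range (emb S)"
    then show "poly (\<Prod>u\<in>UNIV. [:- emb S u, 1:]) x = poly (monom 1 q - [:0, 1:]) x"
      by (auto simp: poly_prod poly_monom emb_power_q prod_zero_iff)
  qed
  then have "poly (\<Prod>u\<in>UNIV. [:- emb S u, 1:]) x = poly (monom 1 q - [:0, 1:]) x"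
    by simp
  then show ?thesis
    by (simp add: poly_prod poly_monom)
qed

text \<open>
  Both sides are monic of degree \<open>q\<close> in \<open>x\<close>.  They agree on the constants because
  \<open>x\<^sup>q - x\<close> is invariant under translation by its roots.
\<close>

lemma frobenius_add: "((x::'c) + y) ^ q = x ^ q + y ^ q"
proof -
  have trans: "(emb S v + y) ^ q = emb S v + y ^ q" for v
  proof -
    have "(emb S v + y) ^ q - (emb S v + y) = (\<Prod>u\<in>UNIV. emb S v + y - emb S u)"
      by (rule poly_X_power_q_minus_X [symmetric])
    also have "\<dots> = (\<Prod>u\<in>UNIV. y - emb S u)"
      by (rule prod.reindex_bij_witness[of _ "\<lambda>u. u + v" "\<lambda>u. u - v"])
        (auto simp: emb_add emb_diff)
    also have "\<dots> = y ^ q - y"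
      by (rule poly_X_power_q_minus_X)
    finally show ?thesis
      by (simp add: algebra_simps)
  qed
  have inj: "inj (emb S)"
    by (auto simp: inj_def emb_eq_iff)
  have deg: "degree (monom 1 q + [:y ^ q:]) = q"
    by (subst degree_add_eq_left) (auto simp: degree_monom_eq)
  have "[:y, 1:] ^ q = monom 1 q + [:y ^ q:]"
  proof (rule monic_poly_eqI[of _ _ "range (emb S)"])
    show "degree ([:y, 1:] ^ q) = degree (monom 1 q + [:y ^ q:])"
      by (simp add: deg degree_power_eq)
    show "degree ([:y, 1:] ^ q) \<le> card (range (emb S))"
      using inj by (simp add: degree_power_eq card_image qq_def)
    have "coeff (monom 1 q + [:y ^ q:]) q = 1"
      using q_ge_2 by (simp add: coeff_pCons split: nat.splits)
    then show "lead_coeff (monom 1 q + [:y ^ q:]) = 1"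
      by (simp add: deg)
  next
    show "lead_coeff ([:y, 1:] ^ q) = 1"
      by (simp add: lead_coeff_power)
  next
    fix x assume "x \<in> range (emb S)"
    then show "poly ([:y, 1:] ^ q) x = poly (monom 1 q + [:y ^ q:]) x"
      using trans by (auto simp: poly_power poly_monom emb_power_q add.commute)
  qed
  then have "poly ([:y, 1:] ^ q) x = poly (monom 1 q + [:y ^ q:]) x"
    by simp
  then show ?thesis
    by (simp add: poly_power poly_monom add.commute)
qed

lemma power_q_Suc: "(x::'c) ^ q ^ Suc n = (x ^ q ^ n) ^ q"
  by (simp add: mult.commute flip: power_mult)

lemma power_q_add: "(x::'c) ^ q ^ (m + n) = (x ^ q ^ m) ^ q ^ n"
  by (simp add: power_add flip: power_mult)

lemma frob_add: "((x::'c) + y) ^ q ^ n = x ^ q ^ n + y ^ q ^ n"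
  by (induction n) (simp_all only: power_q_Suc frobenius_add power_0 power_one_right)

lemma frob_diff: "((x::'c) - y) ^ q ^ n = x ^ q ^ n - y ^ q ^ n"
  using frob_add[of "x - y" y n] by simp

lemma frobenius_diff: "((x::'c) - y) ^ q = x ^ q - y ^ q"
  using frob_diff[of x y 1] by simp

lemma frob_minus: "(- (x::'c)) ^ q ^ n = - (x ^ q ^ n)"
  using frob_diff[of 0 x n] by (simp add: power_0_left)

lemma frob_sum: "(\<Sum>i\<in>A. f i :: 'c) ^ q ^ n = (\<Sum>i\<in>A. f i ^ q ^ n)"
  by (induction A rule: infinite_finite_induct) (auto simp: frob_add power_0_left)

lemma frob_inj: "(x::'c) ^ q ^ n = y ^ q ^ n \<Longrightarrow> x = y"
  using frob_diff[of x y n] by simp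

lemma emb_power_q_power: "emb S u ^ q ^ n = emb S u"
  by (induction n) (auto simp: power_q_Suc emb_power_q simp del: power_Suc)

lemma poly_ep_frob: "poly (ep p) x ^ q ^ n = poly (ep p) (x ^ q ^ n)"
  by (induction p) (auto simp: frob_add power_mult_distrib emb_power_q_power power_0_left)

lemma tendsto_frob: "(X \<longlongrightarrow> (L::'c)) F \<Longrightarrow> ((\<lambda>n. X n ^ q ^ k) \<longlongrightarrow> L ^ q ^ k) F"
  unfolding tendsto_iff_absv[of X] tendsto_iff_absv[of "\<lambda>n. X n ^ q ^ k"]
  using tendsto_power[of "\<lambda>n. absv (X n - L)" 0 F "q ^ k"]
  by (simp add: absv_power power_0_left flip: frob_diff)

lemma sums_frob: "f sums (s::'c) \<Longrightarrow> (\<lambda>n. f n ^ q ^ k) sums (s ^ q ^ k)"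
  unfolding sums_def by (simp flip: frob_sum add: tendsto_frob)

lemma frob_root_exists: "\<exists>y. y ^ q ^ n = (z::'c)"
  using nth_root_exists[of "q ^ n" z] by auto


subsection \<open>The conjugates of \<open>\<eta>\<close>\<close>

lemma rho_nonzero: "rho S \<noteq> 0"
  using rho_irreducible by auto

text \<open>Minimal polynomial argument: a nonzero polynomial of least degree vanishing at \<eta>
  divides every other one by division with remainder; it divides \<open>rho S\<close> too, and
  irreducibility makes the two associated.\<close>

lemma rho_dvd_if_root:
  assumes "poly (ep p) (eta S) = 0"
  shows "rho S dvd p"
proof -
  define P where "P n \<longleftrightarrow> (\<exists>d. d \<noteq> 0 \<and> poly (ep d) (eta S) = 0 \<and> degree d = n)" for n
  have "P (degree (rho S))"
    using rho_nonzero eta_root by (auto simp: P_def rhoC_def)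
  then obtain d where d: "d \<noteq> 0" "poly (ep d) (eta S) = 0" "degree d = (LEAST n. P n)"
    using LeastI[of P] unfolding P_def by blast
  have dvd: "d dvd r" if "poly (ep r) (eta S) = 0" for r
  proof (rule ccontr)
    assume "\<not> d dvd r"
    then have "r mod d \<noteq> 0"
      by (simp add: dvd_eq_mod_eq_0)
    moreover have "ep r = ep (r div d) * ep d + ep (r mod d)"
      by (simp flip: ep_mult ep_add)
    then have "poly (ep (r mod d)) (eta S) = 0"
      using that d(2) by simp
    ultimately have "(LEAST n. P n) \<le> degree (r mod d)"
      by (intro Least_le) (auto simp: P_def)
    then show False
      using d \<open>r mod d \<noteq> 0\<close> degree_mod_less[of d r] by simp
  qed
  obtain e where e: "rho S = d * e"
    using dvd[of "rho S"] eta_root by (auto simp: rhoC_def elim: dvdE)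
  have "\<not> d dvd 1"
  proof
    assume "d dvd 1"
    then obtain c where "d = [:c:]"
      using is_unit_polyE by (metis is_unit_poly_iff)
    then show False
      using d by simp
  qed
  then have "e dvd 1"
    using rho_irreducible e by (auto simp: irreducible_def)
  then have "rho S dvd d"
    by (auto simp: e mult.commute)
  then show ?thesis
    using dvd[OF assms] by (rule dvd_trans)
qed

text \<open>The residue field \<open>F_q(\<eta>)\<close>, taken as the image of polynomial
  evaluation, which makes closure under products and compatibility with Frobenius immediate.\<close>

definition eta_field :: "'c set" where
  "eta_field = range (\<lambda>p. poly (ep p) (eta S))"

text \<open>Reduction modulo \<open>rho S\<close> leaves remainders of degree below
  \<open>N\<close>, that is, coefficient lists of length \<open>N\<close>; counting the field
  becomes counting lists.\<close>

lemma eta_field_eq_lists: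
  "eta_field = (\<lambda>xs. poly (ep (Poly xs)) (eta S)) ` {xs. set xs \<subseteq> UNIV \<and> length xs = N}"
proof (intro equalityI subsetI)
  fix x assume "x \<in> eta_field"
  then obtain p where p: "x = poly (ep p) (eta S)"
    by (auto simp: eta_field_def)
  define r where "r = p mod rho S"
  have "ep p = ep (p div rho S) * ep (rho S) + ep r"
    by (simp add: r_def flip: ep_mult ep_add)
  then have x: "x = poly (ep r) (eta S)"
    using eta_root by (simp add: p rhoC_def)
  have "degree r < N"
    using degree_mod_less[OF rho_nonzero, of p] N_pos by (auto simp: r_def NN_def)
  then have "Poly (map (coeff r) [0..<N]) = r"
    by (intro poly_eqI) (auto simp: coeff_Poly_eq nth_default_def coeff_eq_0)
  then show "x \<in> (\<lambda>xs. poly (ep (Poly xs)) (eta S)) ` {xs. set xs \<subseteq> UNIV \<and> length xs = N}"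
    using x by (intro image_eqI[of _ _ "map (coeff r) [0..<N]"]) auto
qed (auto simp: eta_field_def)

lemma card_eta_field: "card eta_field = q ^ N" and finite_eta_field: "finite eta_field"
proof -
  let ?L = "{xs :: 'k list. set xs \<subseteq> UNIV \<and> length xs = N}"
  have "inj_on (\<lambda>xs. poly (ep (Poly xs)) (eta S)) ?L"
  proof (rule inj_onI)
    fix xs ys :: "'k list"
    assume L: "xs \<in> ?L" "ys \<in> ?L" and "poly (ep (Poly xs)) (eta S) = poly (ep (Poly ys)) (eta S)"
    then have "rho S dvd Poly xs - Poly ys"
      by (intro rho_dvd_if_root) (simp add: ep_diff)
    moreover have deg: "degree (Poly zs) < N" if "length zs = N" for zs :: "'k list"
    proof -
      have "degree (Poly zs) \<le> N - 1"
        using that by (intro degree_le) (auto simp: coeff_Poly_eq nth_default_def)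
      then show ?thesis
        using N_ge_2 by simp
    qed
    have "degree (Poly xs - Poly ys) < degree (rho S)"
      using deg L by (intro degree_diff_less) (auto simp: NN_def)
    ultimately have "Poly xs = Poly ys"
      using dvd_imp_degree_le[of "rho S" "Poly xs - Poly ys"] by auto
    then have "nth_default 0 xs i = nth_default 0 ys i" for i
      by (metis coeff_Poly_eq)
    then show "xs = ys"
      using L by (intro nth_equalityI) (auto simp: nth_default_def, metis)
  qed
  moreover have "card ?L = q ^ N"
    unfolding qq_def by (rule card_lists_length_eq) simp
  ultimately show "card eta_field = q ^ N"
    unfolding eta_field_eq_lists by (simp only: card_image)
  show "finite eta_field"
    unfolding eta_field_eq_lists by (intro finite_imageI finite_lists_length_eq) auto
qed

lemma eta_field_power: "x \<in> eta_field \<Longrightarrow> x ^ q ^ N = x"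
proof (subst card_eta_field [symmetric], rule power_card_eq_self)
  show "0 \<in> eta_field"
    unfolding eta_field_def by (rule image_eqI[of _ _ 0]) auto
  show "x * y \<in> eta_field" if "x \<in> eta_field" "y \<in> eta_field" for x y
  proof -
    obtain p r where "x = poly (ep p) (eta S)" "y = poly (ep r) (eta S)"
      using \<open>x \<in> eta_field\<close> \<open>y \<in> eta_field\<close> by (auto simp: eta_field_def)
    then show ?thesis
      unfolding eta_field_def by (intro image_eqI[of _ _ "p * r"]) (auto simp: ep_mult)
  qed
qed (use finite_eta_field in auto)

text \<open>Since \<open>x\<close> equals its own \<open>q^N\<close>-th power, \<open>absv x\<close>
  is a positive real with some positive power equal to 1.\<close>

lemma absv_eta_field: "x \<in> eta_field \<Longrightarrow> x \<noteq> 0 \<Longrightarrow> absv x = 1"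
proof -
  assume x: "x \<in> eta_field" "x \<noteq> 0"
  then have "absv x ^ q ^ N = absv x"
    by (metis absv_power eta_field_power)
  moreover have "1 < q ^ N"
    using q_ge_2 N_pos by (intro one_less_power) auto
  then obtain m where "q ^ N = Suc (Suc m)"
    by (metis One_nat_def Suc_lessE not0_implies_Suc less_irrefl)
  ultimately have "absv x ^ Suc m = 1"
    using x by simp
  then show ?thesis
    using power_eq_iff_eq_base[of "Suc m" "absv x" 1] by simp
qed

lemma eta_in_eta_field: "eta S \<in> eta_field"
  unfolding eta_field_def by (rule image_eqI[of _ _ "[:0, 1:]"]) (auto simp: emb_one)

lemma eta_power_q_N: "eta S ^ q ^ N = eta S"
  by (rule eta_field_power[OF eta_in_eta_field])

text \<open>Otherwise the \<open>q^i\<close>-power map would fix all of \<open>eta_field\<close>,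
  giving \<open>q^N\<close> roots to a polynomial of degree \<open>q^i\<close>.\<close>

lemma eta_power_q_neq:
  assumes "0 < i" "i < N"
  shows "eta S ^ q ^ i \<noteq> eta S"
proof
  assume eq: "eta S ^ q ^ i = eta S"
  have 1: "1 < q ^ i"
    using assms q_ge_2 by (intro one_less_power) auto
  have deg: "degree (monom 1 (q ^ i) - [:0, 1::'c:]) = q ^ i"
    using 1 by (subst diff_conv_add_uminus, subst degree_add_eq_left) (auto simp: degree_monom_eq)
  then have nz: "monom 1 (q ^ i) - [:0, 1::'c:] \<noteq> 0"
    using 1 by (metis degree_0 not_less_zero)
  have "eta_field \<subseteq> {x. poly (monom 1 (q ^ i) - [:0, 1::'c:]) x = 0}"
    by (auto simp: eta_field_def poly_monom poly_ep_frob eq)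
  then have "q ^ N \<le> card {x. poly (monom 1 (q ^ i) - [:0, 1::'c:]) x = 0}"
    unfolding card_eta_field [symmetric] by (rule card_mono[OF poly_roots_finite[OF nz]])
  also have "\<dots> \<le> q ^ i"
    using card_poly_roots_bound[OF nz] deg by simp
  finally show False
    using power_strict_increasing[OF assms(2), of q] q_ge_2 by simp
qed

lemma eta_power_q_mult_N: "eta S ^ q ^ (N * m) = eta S"
  by (induction m) (simp_all add: power_add power_mult eta_power_q_N)

lemma etac_nat: "etac S (int n) = eta S ^ q ^ n"
proof -
  have "eta S ^ q ^ n = eta S ^ q ^ (N * (n div N) + n mod N)"
    by simp
  also have "\<dots> = eta S ^ q ^ (n mod N)"
    by (subst power_q_add) (simp only: eta_power_q_mult_N)
  finally show ?thesis
    by (simp add: etac_def flip: zmod_int)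
qed

lemma etac_0 [simp]: "etac S 0 = eta S"
  using etac_nat[of 0] by simp

lemma etac_cong: "i mod int N = j mod int N \<Longrightarrow> etac S i = etac S j"
  by (simp add: etac_def)

lemma etac_conv_nat: "etac S i = eta S ^ q ^ nat (i mod int N)"
  by (simp add: etac_def)

lemma etac_power: "etac S i ^ q ^ n = etac S (i + int n)"
proof -
  define m where "m = nat (i mod int N)"
  have m: "int m = i mod int N"
    by (simp add: m_def)
  have "etac S i ^ q ^ n = etac S (int (m + n))"
    by (simp only: etac_nat etac_conv_nat[of i] m_def power_q_add)
  also have "\<dots> = etac S (i + int n)"
    by (rule etac_cong) (simp add: m mod_add_left_eq)
  finally show ?thesis .
qed

lemma etac_power_q: "etac S i ^ q = etac S (i + 1)"
  using etac_power[of i 1] by simp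

lemma poly_ep_in_eta_field: "poly (ep p) (etac S i) \<in> eta_field"
  unfolding eta_field_def etac_conv_nat
  by (rule image_eqI[of _ _ "p ^ q ^ nat (i mod int N)"])
    (auto simp: ep_power poly_power poly_ep_frob)

lemma etac_eq_iff: "etac S i = etac S j \<longleftrightarrow> i mod int N = j mod int N"
proof
  have *: "\<not> eta S ^ q ^ m = eta S ^ q ^ n" if "m < n" "n < N" for m n
  proof
    assume "eta S ^ q ^ m = eta S ^ q ^ n"
    also have "\<dots> = (eta S ^ q ^ (n - m)) ^ q ^ m"
      using that by (simp flip: power_q_add)
    finally have "eta S = eta S ^ q ^ (n - m)"
      by (rule frob_inj)
    then show False
      using eta_power_q_neq[of "n - m"] that by (metis less_imp_diff_less zero_less_diff)
  qed
  assume "etac S i = etac S j"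
  then have "nat (i mod int N) = nat (j mod int N)"
    using *[of "nat (i mod int N)" "nat (j mod int N)"] *[of "nat (j mod int N)" "nat (i mod int N)"]
    by (metis (no_types, lifting) N_pos etac_conv_nat linorder_neqE_nat nat_less_iff of_nat_0_less_iff
        pos_mod_bound pos_mod_sign)
  then show "i mod int N = j mod int N"
    using N_pos by (simp add: eq_nat_nat_iff del: N_pos)
qed (rule etac_cong)

lemma poly_rhoC_etac: "poly (rhoC S) (etac S i) = 0"
proof -
  have "poly (rhoC S) (etac S i) = poly (rhoC S) (eta S) ^ q ^ nat (i mod int N)"
    by (simp add: rhoC_def etac_conv_nat poly_ep_frob)
  then show ?thesis
    by (simp add: eta_root power_0_left)
qed

lemma degree_rhoC [simp]: "degree (rhoC S) = N"
  by (simp add: rhoC_def NN_def)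

lemma lead_coeff_rhoC: "coeff (rhoC S) N = 1"
  using rho_monic by (simp add: rhoC_def NN_def coeff_map_poly emb_one)

lemma inj_on_etac: "inj_on (\<lambda>i. etac S (int i)) {..<N}"
  by (auto simp: inj_on_def etac_eq_iff)

lemma rhoC_eq_prod: "rhoC S = (\<Prod>i<N. [:- etac S (int i), 1:])"
proof (rule monic_poly_eqI[of _ _ "(\<lambda>i. etac S (int i)) ` {..<N}"])
  show "degree (rhoC S) = degree (\<Prod>i<N. [:- etac S (int i), 1:])"
    by (subst degree_prod_eq_sum_degree) auto
  show "degree (rhoC S) \<le> card ((\<lambda>i. etac S (int i)) ` {..<N})"
    using inj_on_etac by (simp add: card_image)
  show "lead_coeff (\<Prod>i<N. [:- etac S (int i), 1:]) = 1"
    by (simp add: lead_coeff_prod)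
  show "poly (rhoC S) x = poly (\<Prod>i<N. [:- etac S (int i), 1:]) x"
    if "x \<in> (\<lambda>i. etac S (int i)) ` {..<N}" for x
    using that by (auto simp: poly_rhoC_etac poly_prod prod_zero_iff)
qed (simp add: lead_coeff_rhoC)

lemma absv_emb_le: "absv (emb S u) \<le> 1"
proof (cases "u = 0")
  case False
  have "absv (emb S u) = 1"
  proof (rule absv_eta_field)
    show "emb S u \<in> eta_field"
      unfolding eta_field_def by (rule image_eqI[of _ _ "[:u:]"]) auto
  qed (use False in auto)
  then show ?thesis
    by simp
qed simp

lemma absv_etac [simp]: "absv (etac S i) = 1"
proof -
  have "eta S \<noteq> 0"
  proof
    assume "eta S = 0"
    then have "eta S ^ q ^ 1 = eta S"
      by (simp add: power_0_left)
    then show False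
      using eta_power_q_neq[of 1] N_ge_2 by simp
  qed
  then show ?thesis
    by (simp add: etac_conv_nat absv_power absv_eta_field eta_in_eta_field)
qed

lemma absv_etac_diff:
  "absv (etac S i - etac S j) = (if i mod int N = j mod int N then 0 else 1)"
proof (cases "i mod int N = j mod int N")
  case True
  then show ?thesis
    using etac_cong[of i j] by simp
next
  case False
  let ?m = "nat (i mod int N)" and ?n = "nat (j mod int N)"
  have "etac S i - etac S j \<in> eta_field"
    unfolding eta_field_def etac_conv_nat
    by (rule image_eqI[of _ _ "monom 1 (q ^ ?m) - monom 1 (q ^ ?n)"])
      (auto simp: ep_diff map_poly_monom poly_monom emb_one)
  then show ?thesis
    using False absv_eta_field etac_eq_iff by auto
qed


subsection \<open>Distances between powers of \<open>\<theta>\<close> and conjugates of \<open>\<eta>\<close>\<close>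

text \<open>The absolute value of the \<open>q^n\<close>-th power of the uniformizer
  \<open>\<theta> - \<eta>\<close>, hence the distance from \<open>th n\<close> to its nearest
  conjugate \<open>etac S (int n)\<close>.\<close>

definition rad :: "nat \<Rightarrow> real" where
  "rad n = (1 / real q) ^ q ^ n"

lemma rad_pos [simp]: "0 < rad n" and rad_nonneg [simp]: "0 \<le> rad n"
  by (simp_all add: rad_def)

lemma rad_neq_0 [simp]: "rad n \<noteq> 0"
  using rad_pos[of n] by linarith

lemma rad_strict: "m < n \<Longrightarrow> rad n < rad m"
  unfolding rad_def using real_q_gt_1 q_ge_2
  by (intro power_strict_decreasing power_strict_increasing) auto

lemma rad_mono: "m \<le> n \<Longrightarrow> rad n \<le> rad m"
  using rad_strict[of m n] by (cases "m = n") auto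

lemma rad_0: "rad 0 = 1 / real q"
  by (simp add: rad_def)

lemma rad_le: "rad n \<le> 1 / real q"
  using rad_mono[of 0 n] by (simp add: rad_0)

lemma rad_less_1 [simp]: "rad n < 1"
  using rad_le[of n] real_q_gt_1 by (auto intro: le_less_trans)

lemma rad_le_1 [simp]: "rad n \<le> 1"
  by (rule less_imp_le) simp

lemma rad_Suc: "rad (Suc n) = rad n ^ q"
  by (simp add: rad_def mult.commute flip: power_mult)

lemma q_power_gt: "n < q ^ n"
  using q_ge_2 by (metis less_exp less_le_trans power_mono zero_le)

lemma rad_le_power: "rad n \<le> (1 / real q) ^ n"
  unfolding rad_def using real_q_gt_1 q_power_gt[of n] by (intro power_decreasing) auto

lemma rad_tendsto_0: "rad \<longlonglongrightarrow> 0"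
proof (rule tendsto_sandwich[of "\<lambda>_. 0" _ _ "\<lambda>n. (1 / real q) ^ n"])
  show "(\<lambda>n. (1 / real q) ^ n) \<longlonglongrightarrow> 0"
    using real_q_gt_1 by (intro LIMSEQ_power_zero) auto
qed (auto intro: always_eventually rad_le_power)

lemma th_minus_etac: "th n - etac S (int n) = (theta S - eta S) ^ q ^ n"
  by (simp add: frob_diff etac_nat)

lemma absv_th_minus_etac_self: "absv (th n - etac S (int n)) = rad n"
  by (simp add: th_minus_etac absv_power uniformizer rad_def)

text \<open>Distinct conjugates of \<eta> are at distance 1, and \<open>th n\<close> lies within
  \<open>rad n < 1\<close> of just one of them.\<close>

lemma absv_th_minus_etac:
  "absv (th n - etac S i) = (if int n mod int N = i mod int N then rad n else 1)"
proof (cases "int n mod int N = i mod int N")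
  case True
  then show ?thesis
    using absv_th_minus_etac_self[of n] etac_cong[of "int n" i] by simp
next
  case False
  have "absv (th n - etac S i) = absv ((th n - etac S (int n)) + (etac S (int n) - etac S i))"
    by simp
  also have "\<dots> = 1"
    using False by (subst absv_add_eq) (auto simp: absv_th_minus_etac_self absv_etac_diff)
  finally show ?thesis
    using False by simp
qed

lemma absv_th_minus_etac_le_1: "absv (th n - etac S i) \<le> 1"
  and absv_th_minus_etac_ge: "rad n \<le> absv (th n - etac S i)"
  by (auto simp: absv_th_minus_etac)

lemma th_neq_etac [simp]: "th n \<noteq> etac S i" "etac S i \<noteq> th n"
  using absv_th_minus_etac[of n i] by (auto split: if_splits)

text \<open>\<open>th n\<close> is closer to \<open>etac S (int n)\<close> than \<open>th m\<close>
  can be to any conjugate, so it may be replaced by that conjugate.\<close>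

lemma absv_th_minus_th: "m < n \<Longrightarrow> absv (th m - th n) = absv (th m - etac S (int n))"
proof -
  assume "m < n"
  have "absv (th m - th n) = absv ((th n - etac S (int n)) - (th m - etac S (int n)))"
    by (simp add: absv_minus_commute)
  also have "\<dots> = absv (th m - etac S (int n))"
    using \<open>m < n\<close> absv_th_minus_etac_ge[of m "int n"] rad_strict[of m n]
    by (intro absv_diff_eq) (auto simp: absv_th_minus_etac_self)
  finally show ?thesis .
qed

lemma th_neq_th: "m \<noteq> n \<Longrightarrow> th m \<noteq> th n"
proof -
  have *: "th m \<noteq> th n" if "m < n" for m n
    using absv_th_minus_th[OF that] absv_th_minus_etac_ge[of m "int n"] rad_pos[of m]
    by (metis absv_zero cancel_comm_monoid_add_class.diff_cancel not_le)
  show "m \<noteq> n \<Longrightarrow> th m \<noteq> th n"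
    using *[of m n] *[of n m] by (metis linorder_neqE_nat)
qed

lemma th_eq_iff [simp]: "th m = th n \<longleftrightarrow> m = n"
  using th_neq_th by auto

lemma absv_th [simp]: "absv (th n) = 1"
  using absv_eq_of_close[of "th n" "etac S (int n)"] by (simp add: absv_th_minus_etac_self)

lemma absv_poly_le_1:
  assumes "\<And>i. absv (coeff p i) \<le> 1" "absv (x::'c) \<le> 1"
  shows "absv (poly p x) \<le> 1"
  unfolding poly_altdef
  using assms by (intro absv_sum_le) (auto simp: absv_times absv_power intro!: mult_le_one power_le_one)

lemma absv_coeff_ep: "absv (coeff (ep p) i) \<le> 1"
  by (simp add: coeff_map_poly absv_emb_le)

text \<open>The coefficients of the quotient are Horner values, that is, values at \<open>x\<close>
  of integral polynomials.\<close>

lemma coeff_synthetic_div_le_1: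
  assumes "\<And>i. absv (coeff p i) \<le> 1" "absv (x::'c) \<le> 1"
  shows "absv (coeff (synthetic_div p x) i) \<le> 1"
  using assms(1)
proof (induction p arbitrary: i)
  case (pCons a p)
  have p: "absv (coeff p i) \<le> 1" for i
    using pCons.prems[of "Suc i"] by simp
  show ?case
    using pCons.IH[OF p] absv_poly_le_1[OF p assms(2)]
    by (auto simp: coeff_pCons split: nat.splits)
qed simp

lemma poly_synthetic_div: "(z - x) * poly (synthetic_div p x) z = poly p z - poly p (x::'c)"
  using arg_cong[OF synthetic_div_correct'[of x p], of "\<lambda>r. poly r z"] by (simp add: algebra_simps)

lemma absv_poly_diff_le:
  assumes "\<And>i. absv (coeff p i) \<le> 1" "absv (x::'c) \<le> 1" "absv y \<le> 1"
  shows "absv (poly p x - poly p y) \<le> absv (x - y)"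
proof -
  have "absv (poly p x - poly p y) = absv (x - y) * absv (poly (synthetic_div p y) x)"
    by (simp add: poly_synthetic_div flip: absv_times)
  also have "\<dots> \<le> absv (x - y) * 1"
    using assms by (intro mult_left_mono absv_poly_le_1 coeff_synthetic_div_le_1) auto
  finally show ?thesis
    by simp
qed

lemma absv_rhoC_th: "absv (poly (rhoC S) (th n)) \<le> 1 / real q"
proof -
  have "absv (poly (rhoC S) (th n) - poly (rhoC S) (etac S (int n))) \<le> rad n"
    unfolding absv_th_minus_etac_self [symmetric]
    by (rule absv_poly_diff_le) (auto simp: rhoC_def absv_coeff_ep)
  then show ?thesis
    using rad_le[of n] by (simp add: poly_rhoC_etac)
qed

lemma rhoC_th_neq_0: "poly (rhoC S) (th n) \<noteq> 0"
  by (auto simp: rhoC_eq_prod poly_prod prod_zero_iff)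

text \<open>Transcendence of \<theta> over the constants. Factors \<open>rho S\<close> are split
  off; once none is left, the value at \<open>etac S (int n)\<close> is a unit and the value at
  \<open>th n\<close> differs from it by at most \<open>rad n < 1\<close>.\<close>

lemma poly_ep_th_neq_0: "p \<noteq> 0 \<Longrightarrow> poly (ep p) (th n) \<noteq> 0"
proof (induction "degree p" arbitrary: p rule: less_induct)
  case less
  show ?case
  proof (cases "rho S dvd p")
    case True
    then obtain r where r: "p = rho S * r"
      by (auto elim: dvdE)
    then have "r \<noteq> 0" "degree p = N + degree r"
      using less.prems rho_nonzero by (auto simp: degree_mult_eq NN_def)
    then have "poly (ep r) (th n) \<noteq> 0"
      using less.hyps[of r] by simp
    then show ?thesis
      using rhoC_th_neq_0[of n] by (simp add: r ep_mult rhoC_def)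
  next
    case False
    then have "poly (ep p) (eta S) \<noteq> 0"
      using rho_dvd_if_root by blast
    then have "absv (poly (ep p) (etac S (int n))) = 1"
      by (intro absv_eta_field poly_ep_in_eta_field) (simp add: etac_nat flip: poly_ep_frob)
    moreover have "absv (poly (ep p) (th n) - poly (ep p) (etac S (int n))) \<le> rad n"
      unfolding absv_th_minus_etac_self [symmetric]
      by (rule absv_poly_diff_le) (auto simp: absv_coeff_ep)
    ultimately have "absv (poly (ep p) (th n)) = 1"
      by (metis absv_eq_of_close rad_less_1 le_less_trans)
    then show ?thesis
      by auto
  qed
qed

text \<open>Dividing \<open>rhoC S\<close> by its linear factor at \<open>etac S i\<close> leaves an
  integral polynomial \<open>s\<close> of degree below \<open>N\<close>; so
  \<open>1/(z - etac S i) = s(z)/rho(z)\<close> is an integral linear combination of the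
  \<open>T_i\<close>, which are bounded by 1 on the domain.\<close>

lemma absv_inverse_diff_le_1:
  assumes z: "z \<in> Dom S"
  shows "absv (1 / (z - etac S i)) \<le> 1"
proof (cases "z = etac S i")
  case False
  define s where "s = synthetic_div (rhoC S) (etac S i)"
  have nz: "poly (rhoC S) z \<noteq> 0"
    using z by (simp add: Dom_def)
  have "(z - etac S i) * poly s z = poly (rhoC S) z"
    by (simp add: s_def poly_synthetic_div poly_rhoC_etac)
  then have "1 / (z - etac S i) = poly s z / poly (rhoC S) z"
    using False nz by (simp add: field_simps)
  also have "\<dots> = (\<Sum>j\<le>degree s. coeff s j * Tfun S j z)"
    by (simp add: poly_altdef sum_divide_distrib Tfun_def)
  also have "absv \<dots> \<le> 1"
  proof (rule absv_sum_le)
    fix j assume "j \<in> {..degree s}"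
    then have "j < N"
      using N_pos by (simp add: s_def degree_synthetic_div del: N_pos)
    then have "absv (Tfun S j z) \<le> 1"
      using z by (simp add: Dom_def)
    moreover have "absv (coeff s j) \<le> 1"
      unfolding s_def by (rule coeff_synthetic_div_le_1) (auto simp: rhoC_def absv_coeff_ep)
    ultimately show "absv (coeff s j * Tfun S j z) \<le> 1"
      by (simp add: absv_times mult_le_one)
  qed simp
  finally show ?thesis .
qed simp

lemma Dom_neq_etac: "z \<in> Dom S \<Longrightarrow> z \<noteq> etac S i"
  using poly_rhoC_etac by (auto simp: Dom_def)

lemma absv_Dom_minus_etac: "z \<in> Dom S \<Longrightarrow> 1 \<le> absv (z - etac S i)"
  using absv_inverse_diff_le_1[of z i] Dom_neq_etac[of z i]
  by (simp add: absv_divide divide_le_eq split: if_splits)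

lemma absv_Dom_minus_th: "z \<in> Dom S \<Longrightarrow> absv (z - th n) = absv (z - etac S (int n))"
proof -
  assume z: "z \<in> Dom S"
  have "absv (z - th n) = absv ((th n - etac S (int n)) - (z - etac S (int n)))"
    by (simp add: absv_minus_commute)
  also have "\<dots> = absv (z - etac S (int n))"
    using absv_Dom_minus_etac[OF z, of "int n"] rad_less_1[of n]
    by (intro absv_diff_eq) (auto simp: absv_th_minus_etac_self simp del: rad_less_1)
  finally show ?thesis .
qed

lemma Dom_neq_th: "z \<in> Dom S \<Longrightarrow> z \<noteq> th n"
  using absv_Dom_minus_th[of z n] absv_Dom_minus_etac[of z "int n"] by force

lemma absv_Dom_ratio_le:
  assumes "z \<in> Dom S"
  shows "absv ((z - etac S i) / (z - etac S j)) \<le> 1"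
proof -
  have "absv ((z - etac S i) / (z - etac S j)) = absv (1 + (etac S j - etac S i) * (1 / (z - etac S j)))"
    using Dom_neq_etac[OF assms, of j] by (simp add: field_simps)
  also have "\<dots> \<le> 1"
    using absv_inverse_diff_le_1[OF assms, of j]
    by (intro absv_add_le) (simp_all add: absv_times absv_etac_diff del: times_divide_eq_right)
  finally show ?thesis .
qed

text \<open>The \<open>T_i\<close> have coefficients in the constants and so commute with Frobenius.
  This allows \<open>q\<close>-th roots to be taken without leaving the domain.\<close>

lemma Dom_frob: "y ^ q \<in> Dom S \<longleftrightarrow> y \<in> Dom S"
proof -
  have rho: "poly (rhoC S) (y ^ q) = poly (rhoC S) y ^ q"
    using poly_ep_frob[of "rho S" y 1] by (simp add: rhoC_def)
  have "Tfun S i (y ^ q) = Tfun S i y ^ q" for i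
    by (simp add: Tfun_def rho power_divide mult.commute flip: power_mult)
  then have "absv (Tfun S i (y ^ q)) \<le> 1 \<longleftrightarrow> absv (Tfun S i y) \<le> 1" for i
    using power_le_one_iff[of "absv (Tfun S i y)" q] q_pos by (simp add: absv_power del: q_pos)
  then show ?thesis
    by (simp add: Dom_def rho)
qed

lemma Tmonom_frob: "Tmonom S I (y ^ q) = Tmonom S I y ^ q"
proof -
  have rho: "poly (rhoC S) (y ^ q) = poly (rhoC S) y ^ q"
    using poly_ep_frob[of "rho S" y 1] by (simp add: rhoC_def)
  have "Tfun S i (y ^ q) = Tfun S i y ^ q" for i
    by (simp add: Tfun_def rho power_divide mult.commute flip: power_mult)
  then show ?thesis
    by (simp add: Tmonom_def prod_power_distrib mult.commute flip: power_mult)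
qed


subsection \<open>The Tate algebra\<close>

lemma has_sum_frob:
  assumes "(f has_sum (s::'c)) A"
  shows "((\<lambda>x. f x ^ q) has_sum s ^ q) A"
proof -
  have "sum (\<lambda>x. f x ^ q) = (\<lambda>F. sum f F ^ q)"
    using frob_sum[of f _ 1] by auto
  then show ?thesis
    using tendsto_frob[of "sum f" s _ 1] assms by (simp add: has_sum_def)
qed

lemma has_sum_absv_le:
  assumes "(f has_sum (s::'c)) A" "\<And>a. a \<in> A \<Longrightarrow> absv (f a) \<le> B" "0 \<le> B"
  shows "absv s \<le> B"
proof (rule tendsto_upperbound)
  show "((\<lambda>F. absv (sum f F)) \<longlongrightarrow> absv s) (finite_subsets_at_top A)"
    using assms(1) unfolding has_sum_def by (rule tendsto_absv)
  show "\<forall>\<^sub>F F in finite_subsets_at_top A. absv (sum f F) \<le> B"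
    by (rule eventually_finite_subsets_at_top_weakI) (use assms in \<open>auto intro!: absv_sum_le\<close>)
qed simp

lemma absv_Tmonom_le_1: "z \<in> Dom S \<Longrightarrow> absv (Tmonom S I z) \<le> 1"
  by (auto simp: Tmonom_def absv_prod absv_power Dom_def intro!: prod_le_1 power_le_one)

lemma tate_expansion_frob:
  assumes "tate_expansion S c g" "y \<in> Dom S"
  shows "((\<lambda>I. c I ^ q * Tmonom S I (y ^ q)) has_sum g y ^ q) (multi_idx S)"
  using has_sum_frob[of "\<lambda>I. c I * Tmonom S I y" "multi_idx S" "g y"] assms
  by (simp add: tate_expansion_def Tmonom_frob power_mult_distrib)

text \<open>
  The monomials in the \<open>T\<^sub>i\<close> commute with Frobenius, so all expansions of \<open>g\<close> have the same twist.
\<close>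

lemma twist_eq:
  assumes "g \<in> tate S" "y \<in> Dom S"
  shows "twist S g (y ^ q) = g y ^ q"
proof -
  obtain c where c: "tate_expansion S c g"
    using assms(1) by (auto simp: tate_def)
  show ?thesis
    unfolding twist_def
  proof (rule the_equality)
    show "\<exists>c. tate_expansion S c g \<and> ((\<lambda>I. c I ^ q * Tmonom S I (y ^ q)) has_sum g y ^ q) (multi_idx S)"
      using c tate_expansion_frob[OF c assms(2)] by blast
  next
    fix w assume "\<exists>c. tate_expansion S c g \<and> ((\<lambda>I. c I ^ q * Tmonom S I (y ^ q)) has_sum w) (multi_idx S)"
    then obtain c where c: "tate_expansion S c g"
      and w: "((\<lambda>I. c I ^ q * Tmonom S I (y ^ q)) has_sum w) (multi_idx S)"
      by blast
    show "w = g y ^ q"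
      using infsumI[OF tate_expansion_frob[OF c assms(2)]] infsumI[OF w] by simp
  qed
qed

lemma tate_expansion_twist:
  assumes "tate_expansion S c g"
  shows "tate_expansion S (\<lambda>I. c I ^ q) (twist S g)"
  unfolding tate_expansion_def
proof
  fix z assume z: "z \<in> Dom S"
  have tate: "g \<in> tate S"
    using assms by (auto simp: tate_def)
  obtain y where y: "y ^ q = z"
    using frob_root_exists[of 1 z] by auto
  then have "y \<in> Dom S"
    using z Dom_frob by metis
  then show "((\<lambda>I. c I ^ q * Tmonom S I z) has_sum twist S g z) (multi_idx S)"
    using tate_expansion_frob[OF assms, of y] twist_eq[OF tate, of y] y by auto
qed

lemma twist_in_tate: "g \<in> tate S \<Longrightarrow> twist S g \<in> tate S"
  using tate_expansion_twist by (auto simp: tate_def)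

lemma tate_cong: "g \<in> tate S \<Longrightarrow> (\<And>z. z \<in> Dom S \<Longrightarrow> g z = h z) \<Longrightarrow> h \<in> tate S"
  by (auto simp: tate_def tate_expansion_def)

lemma has_sum_plus:
  assumes "(f has_sum (s::'c)) A" "(g has_sum t) A"
  shows "((\<lambda>x. f x + g x) has_sum (s + t)) A"
proof -
  have "sum (\<lambda>x. f x + g x) = (\<lambda>F. sum f F + sum g F)"
    by (rule ext) (simp add: sum.distrib)
  then show ?thesis
    using assms by (simp add: has_sum_def tendsto_plus)
qed

lemma has_sum_times_left:
  assumes "(f has_sum (s::'c)) A"
  shows "((\<lambda>x. c * f x) has_sum (c * s)) A"
proof -
  have "sum (\<lambda>x. c * f x) = (\<lambda>F. c * sum f F)"
    by (rule ext) (simp add: sum_distrib_left)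
  then show ?thesis
    using assms by (simp add: has_sum_def tendsto_times_left)
qed

text \<open>Needed for the logarithm, which will turn out to be the constant \<xi> minus the twist
  of \<open>G\<close>.\<close>

lemma const_minus_in_tate:
  assumes "g \<in> tate S"
  shows "(\<lambda>z. a - g z) \<in> tate S"
proof -
  obtain c where c: "tate_expansion S c g"
    using assms by (auto simp: tate_def)
  have "((\<lambda>I. (if I = (\<lambda>_. 0) then a else 0) * Tmonom S I z) has_sum a) (multi_idx S)" for z
  proof -
    have "((\<lambda>I. (if I = (\<lambda>_. 0) then a else 0) * Tmonom S I z) has_sum a) {\<lambda>_. 0}"
      by (rule has_sum_finiteI) (auto simp: Tmonom_def)
    then show ?thesis
      by (rule has_sum_cong_neutral[THEN iffD1, rotated -1]) (auto simp: multi_idx_def)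
  qed
  from has_sum_plus[OF this has_sum_times_left[of _ _ _ "-1"]] c
  have "tate_expansion S (\<lambda>I. (if I = (\<lambda>_. 0) then a else 0) - c I) (\<lambda>z. a - g z)"
    unfolding tate_expansion_def by (simp add: algebra_simps)
  then show ?thesis
    by (auto simp: tate_def)
qed

text \<open>Interchange of a series in \<open>n\<close> with the expansions in the
  \<open>T_i\<close>. By integrality, indices with \<open>absv (a n)\<close> small contribute little
  for every finite set of multi-indices; the finitely many others are controlled by the union of
  their own finite sets.\<close>

lemma tate_expansion_series:
  assumes exp: "\<And>n. tate_expansion S (c n) (h n)"
    and c: "\<And>n I. absv (c n I) \<le> 1"
    and a: "(\<lambda>n. absv (a n)) \<longlonglongrightarrow> 0"
    and g: "\<And>z. z \<in> Dom S \<Longrightarrow> (\<lambda>n. a n * h n z) sums g z"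
  shows "tate_expansion S (\<lambda>I. \<Sum>n. a n * c n I) g"
  unfolding tate_expansion_def
proof
  fix z assume z: "z \<in> Dom S"
  define T where "T I = Tmonom S I z" for I
  have T: "absv (T I) \<le> 1" for I
    using absv_Tmonom_le_1[OF z] by (simp add: T_def)
  have cT: "absv (c n I * T I) \<le> 1" for n I
    using c T by (simp add: absv_times mult_le_one)
  have hs: "((\<lambda>I. c n I * T I) has_sum h n z) (multi_idx S)" for n
    using exp z by (simp add: tate_expansion_def T_def)
  have h: "absv (h n z) \<le> 1" for n
    by (rule has_sum_absv_le[OF hs]) (use cT in auto)
  have sm: "(\<lambda>n. a n * c n I) sums (\<Sum>n. a n * c n I)" for I
  proof (rule summable_sums, rule summable_absv_bound[OF a])
    show "absv (a n * c n I) \<le> absv (a n)" for n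
      using c by (simp add: absv_times mult_left_le)
  qed
  have diff: "(\<lambda>n. a n * ((\<Sum>I\<in>F. c n I * T I) - h n z)) sums ((\<Sum>I\<in>F. (\<Sum>n. a n * c n I) * T I) - g z)" for F
  proof -
    have "(\<lambda>n. \<Sum>I\<in>F. T I * (a n * c n I)) sums (\<Sum>I\<in>F. T I * (\<Sum>n. a n * c n I))"
      by (intro sums_finite_sum sums_times_left sm)
    from sums_minus_diff[OF this g[OF z]] show ?thesis
      by (simp add: algebra_simps sum_distrib_left)
  qed
  show "((\<lambda>I. (\<Sum>n. a n * c n I) * Tmonom S I z) has_sum g z) (multi_idx S)"
    unfolding has_sum_iff_absv T_def [symmetric]
  proof (intro allI impI)
    fix e :: real assume e: "0 < e"
    obtain m where m: "\<And>n. n \<ge> m \<Longrightarrow> absv (a n) < e / 2"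
      using order_tendstoD(2)[OF a, of "e / 2"] e unfolding eventually_sequentially by auto
    \<comment> \<open>The tolerance is scaled so that multiplication by \<open>a n\<close> gives at
      most \<open>e/2\<close>; the summand 1 keeps the denominator positive when
      \<open>a n = 0\<close>.\<close>
    have "\<exists>F0. finite F0 \<and> F0 \<subseteq> multi_idx S \<and>
        (\<forall>F. finite F \<and> F0 \<subseteq> F \<and> F \<subseteq> multi_idx S \<longrightarrow>
           absv ((\<Sum>I\<in>F. c n I * T I) - h n z) < e / (2 * (absv (a n) + 1)))" for n
      using hs[of n, unfolded has_sum_iff_absv] e
      by (auto simp: add_nonneg_pos)
    then obtain F0 where F0: "\<And>n. finite (F0 n)" "\<And>n. F0 n \<subseteq> multi_idx S"
      "\<And>n F. finite F \<and> F0 n \<subseteq> F \<and> F \<subseteq> multi_idx S \<Longrightarrow>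
           absv ((\<Sum>I\<in>F. c n I * T I) - h n z) < e / (2 * (absv (a n) + 1))"
      by metis
    show "\<exists>F0. finite F0 \<and> F0 \<subseteq> multi_idx S \<and>
        (\<forall>F. finite F \<and> F0 \<subseteq> F \<and> F \<subseteq> multi_idx S \<longrightarrow>
           absv ((\<Sum>I\<in>F. (\<Sum>n. a n * c n I) * T I) - g z) < e)"
    proof (intro exI[of _ "\<Union>n<m. F0 n"] conjI allI impI)
      fix F assume F: "finite F \<and> (\<Union>n<m. F0 n) \<subseteq> F \<and> F \<subseteq> multi_idx S"
      have "absv ((\<Sum>I\<in>F. (\<Sum>n. a n * c n I) * T I) - g z) \<le> e / 2"
      proof (rule sums_absv_le[OF diff])
        fix n
        show "absv (a n * ((\<Sum>I\<in>F. c n I * T I) - h n z)) \<le> e / 2"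
        proof (cases "n < m")
          case True
          then have "absv ((\<Sum>I\<in>F. c n I * T I) - h n z) < e / (2 * (absv (a n) + 1))"
            using F by (intro F0(3)) auto
          then have "absv (a n) * absv ((\<Sum>I\<in>F. c n I * T I) - h n z)
              \<le> (absv (a n) + 1) * (e / (2 * (absv (a n) + 1)))"
            by (intro mult_mono) auto
          also have "\<dots> = e / 2"
            using absv_nonneg[of "a n"] by (simp add: field_simps add_nonneg_eq_0_iff del: absv_nonneg)
          finally show ?thesis
            by (simp add: absv_times)
        next
          case False
          have "absv ((\<Sum>I\<in>F. c n I * T I) - h n z) \<le> 1"
            using cT h by (intro absv_diff_le absv_sum_le) auto
          then have "absv (a n) * absv ((\<Sum>I\<in>F. c n I * T I) - h n z) \<le> (e / 2) * 1"
            using m[of n] False e by (intro mult_mono) (auto simp: not_less)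
          then show ?thesis
            by (simp add: absv_times)
        qed
      qed
      then show "absv ((\<Sum>I\<in>F. (\<Sum>n. a n * c n I) * T I) - g z) < e"
        using e by simp
    qed (use F0 in auto)
  qed
qed

text \<open>Exponent vector of \<open>T_i T_0^j\<close>. For \<open>i = 0\<close> the two
  contributions add up to \<open>T_0^(j+1)\<close>, which keeps the encoding injective and away from
  the zero vector.\<close>

definition pole_index :: "nat \<times> nat \<Rightarrow> nat \<Rightarrow> nat" where
  "pole_index = (\<lambda>(i, j) k. (if k = i then 1 else 0) + (if k = 0 then j else 0))"

lemma pole_index_inj: "inj pole_index"
proof (rule injI, clarify)
  fix i j i' j' assume "pole_index (i, j) = pole_index (i', j')"
  then have eq: "pole_index (i, j) k = pole_index (i', j') k" for k
    by simp
  have "i = i'"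
  proof (rule ccontr)
    assume "i \<noteq> i'"
    then show False
      using eq[of i] eq[of i'] by (cases "i = 0") (simp_all add: pole_index_def)
  qed
  with eq[of 0] show "i = i' \<and> j = j'"
    by (simp add: pole_index_def)
qed

lemma pole_index_neq_0: "pole_index p \<noteq> (\<lambda>_. 0)"
proof
  assume "pole_index p = (\<lambda>_. 0)"
  then have "pole_index p (fst p) = 0"
    by simp
  then show False
    by (cases p) (simp add: pole_index_def)
qed

lemma pole_index_in_multi_idx: "i < N \<Longrightarrow> pole_index (i, j) \<in> multi_idx S"
  by (auto simp: multi_idx_def pole_index_def)

lemma Tmonom_pole_index: "i < N \<Longrightarrow> Tmonom S (pole_index (i, j)) z = Tfun S i z * Tfun S 0 z ^ j"
proof -
  assume i: "i < N"
  have "Tmonom S (pole_index (i, j)) z =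
      (\<Prod>k<N. (if k = i then Tfun S k z else 1) * (if k = 0 then Tfun S k z ^ j else 1))"
    unfolding Tmonom_def pole_index_def by (intro prod.cong) auto
  also have "\<dots> = Tfun S i z * Tfun S 0 z ^ j"
    using i by (simp add: prod.distrib)
  finally show ?thesis .
qed

text \<open>
  With \<open>r = \<rho>(x)\<close> and \<open>s(z) = (\<rho>(z) - r) / (z - x)\<close>, a polynomial with integral coefficients,
  \<open>1/(z - x) = (s(z)/\<rho>(z)) \<Sum>\<^sub>j (r/\<rho>(z))\<^sup>j\<close> is a power series in \<open>T\<^sub>0, \<dots>, T\<^bsub>N-1\<^esub>\<close>.
\<close>

lemma tate_expansion_simple_pole:
  assumes x: "absv x \<le> 1" and r: "absv (poly (rhoC S) x) < 1" and b: "absv b \<le> 1"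
  obtains c where "tate_expansion S c (\<lambda>z. 1 + b / (z - x))" "\<And>I. absv (c I) \<le> 1"
proof -
  define r where "r = poly (rhoC S) x"
  define s where "s = synthetic_div (rhoC S) x"
  define d where "d = (\<lambda>(i, j). b * (coeff s i * r ^ j))"
  \<comment> \<open>The zero multi-index carries the summand 1 of the function; indices not of the
    form \<open>T_i T_0^j\<close> do not occur.\<close>
  define c where "c I = (if I = (\<lambda>_. 0) then 1 else
      if I \<in> pole_index ` ({..<N} \<times> UNIV) then d (inv pole_index I) else 0)" for I
  have s: "absv (coeff s i) \<le> 1" for i
    unfolding s_def by (rule coeff_synthetic_div_le_1) (use x in \<open>auto simp: rhoC_def absv_coeff_ep\<close>)
  have r1: "absv r < 1"
    using r by (simp add: r_def)
  have d: "absv (d (i, j)) \<le> absv r ^ j" for i j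
  proof -
    have "absv b * absv (coeff s i) * absv r ^ j \<le> 1 * absv r ^ j"
      using b s by (intro mult_right_mono mult_le_one) auto
    then show ?thesis
      by (simp add: d_def absv_times absv_power)
  qed
  have c_pole: "c (pole_index (i, j)) = d (i, j)" if "i < N" for i j
    using that pole_index_neq_0 pole_index_inj by (auto simp: c_def)
  show thesis
  proof (rule that)
    show "absv (c I) \<le> 1" for I
    proof -
      have "absv (d p) \<le> 1" for p
        using d[of "fst p" "snd p"] power_le_one[of "absv r" "snd p"] r1 by simp
      then show ?thesis
        by (simp add: c_def)
    qed
    show "tate_expansion S c (\<lambda>z. 1 + b / (z - x))"
      unfolding tate_expansion_def
    proof
      fix z assume z: "z \<in> Dom S"
      define w where "w = r * Tfun S 0 z"
      have nz: "poly (rhoC S) z \<noteq> 0"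
        using z by (simp add: Dom_def)
      have w: "absv w \<le> absv r"
        using z by (simp add: w_def absv_times Dom_def mult_left_le)
      then have w1: "w \<noteq> 1"
        using r1 by auto
      have sz: "(z - x) * poly s z = poly (rhoC S) z - r"
        by (simp add: s_def r_def poly_synthetic_div)
      have w_eq: "w = r / poly (rhoC S) z"
        by (simp add: w_def Tfun_def)
      then have "poly (rhoC S) z \<noteq> r"
        using nz w1 by auto
      then have zx: "z \<noteq> x"
        using r_def by auto
      have sum_s: "(\<Sum>i<N. coeff s i * Tfun S i z) = poly s z / poly (rhoC S) z"
      proof -
        have "{..<N} = {..degree s}"
          using N_ge_2 by (auto simp: s_def degree_synthetic_div)
        then show ?thesis
          by (simp add: poly_altdef sum_divide_distrib Tfun_def)
      qed
      show "((\<lambda>I. c I * Tmonom S I z) has_sum (1 + b / (z - x))) (multi_idx S)"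
      proof (rule has_sum_absvI)
        fix e :: real assume e: "0 < e"
        \<comment> \<open>Taking \<open>K\<close> at least 1 lets a single \<open>n\<close> serve
          both the remainder of the geometric series, which carries the factor
          \<open>1/(z - x)\<close>, and the individual omitted terms.\<close>
        define K where "K = max 1 (absv (1 / (z - x)))"
        have "(\<lambda>n. K * absv r ^ n) \<longlonglongrightarrow> K * 0"
          using r1 by (intro tendsto_intros LIMSEQ_power_zero) auto
        then obtain n where n: "K * absv r ^ n < e"
          using order_tendstoD(2)[of "\<lambda>n. K * absv r ^ n" "K * 0" sequentially e] e
          by (auto simp: eventually_sequentially)
        define F where "F = insert (\<lambda>_. 0) (pole_index ` ({..<N} \<times> {..<n}))"
        have "(\<Sum>I\<in>F. c I * Tmonom S I z) =
            1 + (\<Sum>(i,j)\<in>{..<N} \<times> {..<n}. b * (coeff s i * r ^ j) * (Tfun S i z * Tfun S 0 z ^ j))"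
        proof -
          have "(\<Sum>I\<in>F. c I * Tmonom S I z) =
            c (\<lambda>_. 0) * Tmonom S (\<lambda>_. 0) z + (\<Sum>I\<in>pole_index ` ({..<N} \<times> {..<n}). c I * Tmonom S I z)"
            unfolding F_def using pole_index_neq_0 by (subst sum.insert) (auto, metis)
          also have "(\<Sum>I\<in>pole_index ` ({..<N} \<times> {..<n}). c I * Tmonom S I z) =
             (\<Sum>p\<in>{..<N} \<times> {..<n}. c (pole_index p) * Tmonom S (pole_index p) z)"
            by (subst sum.reindex) (auto intro: inj_on_subset[OF pole_index_inj])
          also have "\<dots> = (\<Sum>(i,j)\<in>{..<N} \<times> {..<n}. b * (coeff s i * r ^ j) * (Tfun S i z * Tfun S 0 z ^ j))"
            by (rule sum.cong) (auto simp: c_pole Tmonom_pole_index d_def)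
          finally show ?thesis
            by (simp add: c_def Tmonom_def)
        qed
        also have "\<dots> = 1 + (\<Sum>i<N. \<Sum>j<n. b * ((coeff s i * Tfun S i z) * w ^ j))"
          by (simp add: sum.cartesian_product w_def power_mult_distrib mult_ac)
        also have "\<dots> = 1 + b * ((\<Sum>i<N. coeff s i * Tfun S i z) * (\<Sum>j<n. w ^ j))"
          by (subst sum_product) (simp only: sum_distrib_left)
        also have "(\<Sum>j<n. w ^ j) = (1 - w ^ n) / (1 - w)"
          using w1 by (simp add: sum_gp_strict)
        finally have sumF: "(\<Sum>I\<in>F. c I * Tmonom S I z) - (1 + b / (z - x)) =
            b * ((poly s z / poly (rhoC S) z) * ((1 - w ^ n) / (1 - w))) - b / (z - x)"
          by (simp add: sum_s)
        have "(poly s z / poly (rhoC S) z) / (1 - w) = 1 / (z - x)"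
        proof -
          have "poly (rhoC S) z * (1 - w) = (z - x) * poly s z"
            using nz by (simp add: w_eq sz field_simps)
          moreover have "1 - w \<noteq> 0"
            using w1 by simp
          moreover from calculation have "poly s z \<noteq> 0"
            using nz by auto
          ultimately show ?thesis
            using zx by (simp add: mult.commute)
        qed
        then have geo: "(poly s z / poly (rhoC S) z) * ((1 - w ^ n) / (1 - w)) = (1 - w ^ n) * (1 / (z - x))"
          by (metis mult.commute times_divide_eq_left times_divide_eq_right)
        have "(\<Sum>I\<in>F. c I * Tmonom S I z) - (1 + b / (z - x)) = - (b * w ^ n * (1 / (z - x)))"
          unfolding sumF geo by (simp add: divide_inverse algebra_simps)
        then have "absv ((\<Sum>I\<in>F. c I * Tmonom S I z) - (1 + b / (z - x))) =
            absv b * absv w ^ n * absv (1 / (z - x))"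
          by (simp only: absv_minus absv_times absv_power)
        also have "\<dots> \<le> (1 * absv r ^ n) * K"
          using b w unfolding K_def by (intro mult_mono power_mono mult_nonneg_nonneg) auto
        finally have close: "absv ((\<Sum>I\<in>F. c I * Tmonom S I z) - (1 + b / (z - x))) < e"
          using n by (simp add: mult.commute)
        have small: "absv (c I * Tmonom S I z) < e" if I: "I \<in> multi_idx S - F" for I
        proof (cases "I \<in> pole_index ` ({..<N} \<times> UNIV)")
          case False
          then show ?thesis
            using I e by (simp add: c_def F_def)
        next
          case True
          then obtain i j where ij: "I = pole_index (i, j)" "i < N"
            by auto
          then have "n \<le> j"
            using I by (force simp: F_def)
          have "absv (c I * Tmonom S I z) \<le> absv r ^ j * 1"
            using d[of i j] absv_Tmonom_le_1[OF z, of I] ij unfolding absv_times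
            by (intro mult_mono) (auto simp: c_pole)
          also have "\<dots> \<le> absv r ^ n"
            using \<open>n \<le> j\<close> r1 by (simp add: power_decreasing)
          also have "\<dots> \<le> K * absv r ^ n"
            using mult_right_mono[of 1 K "absv r ^ n"] by (simp add: K_def)
          finally show ?thesis
            using n by simp
        qed
        show "\<exists>F. finite F \<and> F \<subseteq> multi_idx S \<and>
            absv ((\<Sum>I\<in>F. c I * Tmonom S I z) - (1 + b / (z - x))) < e \<and>
            (\<forall>a\<in>multi_idx S - F. absv (c a * Tmonom S a z) < e)"
          using close small pole_index_in_multi_idx
          by (intro exI[of _ F]) (auto simp: F_def multi_idx_def)
      qed
    qed
  qed
qed


subsection \<open>Growth of \<open>D\<^sub>n\<close>\<close>

definition pole_ratio :: "nat \<Rightarrow> 'c \<Rightarrow> 'c" where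
  "pole_ratio n z = (z - eta S) / (z - th n)"

text \<open>Rewriting the ratio as \<open>1 + (th n - \<eta>)/(z - th n)\<close> exhibits a simple
  pole with integral numerator at a point where \<rho> has absolute value below 1.\<close>

lemma pole_ratio_expansion:
  obtains c where "tate_expansion S c (pole_ratio n)" "\<And>I. absv (c I) \<le> 1"
proof -
  have "absv (poly (rhoC S) (th n)) < 1"
    using absv_rhoC_th[of n] real_q_gt_1 by (auto intro: le_less_trans)
  then obtain c where c: "tate_expansion S c (\<lambda>z. 1 + (th n - etac S 0) / (z - th n))" "\<And>I. absv (c I) \<le> 1"
    using tate_expansion_simple_pole[of "th n" "th n - etac S 0"] absv_th_minus_etac_le_1[of n 0] by auto
  have "1 + (th n - etac S 0) / (z - th n) = pole_ratio n z" if "z \<in> Dom S" for z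
    using Dom_neq_th[OF that, of n] by (simp add: pole_ratio_def field_simps)
  then have "tate_expansion S c (pole_ratio n)"
    using c(1) by (simp add: tate_expansion_def)
  with c(2) that show thesis
    by blast
qed

lemma absv_pole_ratio_le_1: "z \<in> Dom S \<Longrightarrow> absv (pole_ratio n z) \<le> 1"
  using absv_Dom_ratio_le[of z 0 "int n"] by (simp add: pole_ratio_def absv_divide absv_Dom_minus_th)

text \<open>The multiplier in the recursion for \<open>Dn\<close>; it is
  \<open>f_val S 0 (th n)\<close>, and in particular \<open>Xn 0 = 0\<close>.\<close>

definition Xn :: "nat \<Rightarrow> 'c" where
  "Xn n = (theta S - th n) / ((th n - eta S) * (theta S - eta S))"

lemma Dn_Suc_Xn: "Dn S (Suc n) = Dn S n ^ q * Xn (Suc n)"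
  by (simp add: Xn_def)

text \<open>If \<open>N\<close> divides \<open>n\<close>, then \<open>th n\<close> approaches \<eta>
  itself: the numerator drops to \<open>1/q\<close>, cancelling the factor
  \<open>\<theta> - \<eta>\<close>, and \<open>th n - \<eta>\<close> has size \<open>rad n\<close>.
  Otherwise only \<open>\<theta> - \<eta>\<close> is not a unit.\<close>

lemma absv_Xn:
  assumes "0 < n"
  shows "absv (Xn n) = (if N dvd n then 1 / rad n else real q)"
proof -
  have iff: "(0 = int n mod int N) = (N dvd n)" "(int n mod int N = 0) = (N dvd n)"
    by (auto simp flip: zmod_int)
  have "absv (theta S - th n) = (if N dvd n then 1 / real q else 1)"
    using absv_th_minus_th[OF assms] absv_th_minus_etac[of 0 "int n"] by (simp add: iff rad_0)
  moreover have "absv (th n - eta S) = (if N dvd n then rad n else 1)"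
    using absv_th_minus_etac[of n 0] by (simp add: iff)
  ultimately show ?thesis
    using q_ge_2 by (simp add: Xn_def absv_divide absv_times uniformizer)
qed

lemma absv_Xn_ge: "0 < n \<Longrightarrow> real q \<le> absv (Xn n)"
  using rad_le[of n] real_q_gt_1 by (simp add: absv_Xn field_simps)

lemma absv_Dn_ge_1: "1 \<le> absv (Dn S n)"
proof (induction n)
  case (Suc n)
  have "1 * 1 \<le> absv (Dn S n) ^ q * absv (Xn (Suc n))"
    using Suc absv_Xn_ge[of "Suc n"] real_q_gt_1 by (intro mult_mono one_le_power) auto
  then show ?case
    by (simp only: Dn_Suc_Xn absv_times absv_power)
qed simp

lemma Dn_neq_0 [simp]: "Dn S n \<noteq> 0"
  using absv_Dn_ge_1[of n] by auto

text \<open>Each multiple of \<open>N\<close> raises the exponent of \<open>1 / rad n\<close> by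
  one; the factors at other indices exceed 1 and are discarded.\<close>

lemma absv_Dn_growth: "(1 / rad n) ^ (n div N) \<le> absv (Dn S n)"
proof (induction n)
  case (Suc n)
  have "(1 / rad (Suc n)) ^ (Suc n div N) =
      ((1 / rad n) ^ (n div N)) ^ q * (if N dvd Suc n then 1 / rad (Suc n) else 1)"
    by (simp add: div_Suc rad_Suc power_divide dvd_eq_mod_eq_0 mult.commute power_add flip: power_mult)
  also have "\<dots> \<le> absv (Dn S n) ^ q * absv (Xn (Suc n))"
    using Suc real_q_gt_1 absv_Xn[of "Suc n"] by (intro mult_mono power_mono) auto
  finally show ?case
    by (simp only: Dn_Suc_Xn absv_times absv_power)
qed simp

text \<open>As soon as the base falls below \<open>1/q\<close>, its \<open>q^n\<close>-th power is
  at most \<open>rad n\<close>. With the growth of \<open>Dn\<close> this yields convergence for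
  every \<open>U\<close>.\<close>

lemma growth_tendsto_0:
  assumes "0 \<le> B"
  shows "(\<lambda>n. (B * (1 / real q) ^ (n div N)) ^ q ^ n) \<longlonglongrightarrow> 0"
proof (rule tendsto_sandwich[of "\<lambda>_. 0" _ _ rad])
  have "(\<lambda>m. B * (1 / real q) ^ m) \<longlonglongrightarrow> B * 0"
    using real_q_gt_1 by (intro tendsto_intros LIMSEQ_power_zero) auto
  then obtain m0 where m0: "\<And>m. m \<ge> m0 \<Longrightarrow> B * (1 / real q) ^ m < 1 / real q"
    using order_tendstoD(2)[of _ "B * 0" sequentially "1 / real q"] real_q_gt_1
    by (auto simp: eventually_sequentially)
  show "\<forall>\<^sub>F n in sequentially. (B * (1 / real q) ^ (n div N)) ^ q ^ n \<le> rad n"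
    unfolding eventually_sequentially
  proof (intro exI allI impI)
    fix n assume "m0 * N \<le> n"
    then have "m0 \<le> n div N"
      by (simp add: less_eq_div_iff_mult_less_eq)
    then show "(B * (1 / real q) ^ (n div N)) ^ q ^ n \<le> rad n"
      unfolding rad_def using m0[of "n div N"] assms by (intro power_mono) auto
  qed
qed (use assms rad_tendsto_0 in auto)

lemma absv_power_div_Dn_le:
  "absv (U ^ q ^ n / Dn S n) \<le> (absv U * (1 / real q) ^ (n div N)) ^ q ^ n"
proof -
  have "absv U ^ q ^ n / absv (Dn S n) \<le> absv U ^ q ^ n / (1 / rad n) ^ (n div N)"
    using absv_Dn_growth[of n] by (intro divide_left_mono) (auto intro!: mult_pos_pos)
  also have "\<dots> = (absv U * (1 / real q) ^ (n div N)) ^ q ^ n"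
    by (simp add: rad_def power_divide power_mult_distrib mult.commute flip: power_mult)
  finally show ?thesis
    by (simp add: absv_divide absv_power)
qed

section \<open>The terms of \<open>G\<close> and their convergence on the domain\<close>

definition node_weight :: "nat \<Rightarrow> 'c" where
  "node_weight n = (th n - etac S (int n))\<^sup>2 / (th n - eta S)"

text \<open>One of the two factors \<open>rad n\<close> in the square pays for the denominator,
  which may itself be as small as \<open>rad n\<close>; the other one survives.\<close>

lemma absv_node_weight_le: "absv (node_weight n) \<le> rad n"
  using absv_th_minus_etac_ge[of n 0]
  by (simp add: node_weight_def absv_divide absv_times absv_th_minus_etac_self power2_eq_square
      divide_le_eq mult_left_mono)

lemma absv_node_weight_le_1: "absv (node_weight n) \<le> 1"
  using absv_node_weight_le[of n] rad_le_1[of n] by linarith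

lemma G_term_eq:
  assumes "z \<in> Dom S"
  shows "G_term S U n z = U ^ q ^ n / Dn S n * node_weight n * pole_ratio n z"
proof -
  have "th n - eta S \<noteq> 0" "z - eta S \<noteq> 0" "z - th n \<noteq> 0" "th n - etac S (int n) \<noteq> 0"
    using Dom_neq_etac[OF assms, of 0] Dom_neq_th[OF assms, of n] th_neq_etac(1)[of n 0]
      th_neq_etac(1)[of n "int n"] by auto
  then have "1 / Qn S n z = node_weight n * pole_ratio n z"
    by (simp add: Qn_def node_weight_def pole_ratio_def divide_simps power2_eq_square)
  then show ?thesis
    by (simp add: G_term_def divide_inverse mult_ac)
qed

definition G_coeff :: "'c \<Rightarrow> nat \<Rightarrow> 'c" where
  "G_coeff U n = U ^ q ^ n / Dn S n * node_weight n"

lemma G_term_coeff: "z \<in> Dom S \<Longrightarrow> G_term S U n z = G_coeff U n * pole_ratio n z"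
  by (simp add: G_term_eq G_coeff_def)

lemma absv_G_coeff_le: "absv (G_coeff U n) \<le> (absv U * (1 / real q) ^ (n div N)) ^ q ^ n"
proof -
  have "absv (U ^ q ^ n / Dn S n) * absv (node_weight n) \<le> absv (U ^ q ^ n / Dn S n) * 1"
    using absv_node_weight_le_1 by (intro mult_left_mono) auto
  then show ?thesis
    using absv_power_div_Dn_le[of U n] unfolding G_coeff_def absv_times by linarith
qed

lemma G_coeff_tendsto_0: "(\<lambda>n. absv (G_coeff U n)) \<longlonglongrightarrow> 0"
  by (rule tendsto_sandwich[OF _ _ tendsto_const growth_tendsto_0[of "absv U"]])
    (auto intro: absv_G_coeff_le always_eventually)

lemma absv_G_term_le: "z \<in> Dom S \<Longrightarrow> absv (G_term S U n z) \<le> absv (G_coeff U n)"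
  using absv_pole_ratio_le_1[of z n] by (simp add: G_term_coeff absv_times mult_left_le)

lemma G_sums: "z \<in> Dom S \<Longrightarrow> (\<lambda>n. G_term S U n z) sums G_fun S U z"
  unfolding G_fun_def
  by (rule summable_sums, rule summable_absv_bound[OF G_coeff_tendsto_0 absv_G_term_le])

lemma G_in_tate: "G_fun S U \<in> tate S"
proof -
  have "\<exists>c. tate_expansion S c (pole_ratio n) \<and> (\<forall>I. absv (c I) \<le> 1)" for n
    using pole_ratio_expansion by metis
  then obtain c where c: "\<And>n. tate_expansion S (c n) (pole_ratio n)" "\<And>n I. absv (c n I) \<le> 1"
    by metis
  have "(\<lambda>n. G_coeff U n * pole_ratio n z) sums G_fun S U z" if "z \<in> Dom S" for z
    using G_sums[OF that, of U] that by (simp add: G_term_coeff)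
  then have "tate_expansion S (\<lambda>I. \<Sum>n. G_coeff U n * c n I) (G_fun S U)"
    by (rule tate_expansion_series[OF c G_coeff_tendsto_0])
  then show ?thesis
    by (auto simp: tate_def)
qed

lemma G_tate_limit: "tate_limit S (\<lambda>m z. \<Sum>n<m. G_term S U n z) (G_fun S U)"
  unfolding tate_limit_def
  using G_in_tate uniform_limit_sums[OF G_coeff_tendsto_0 absv_G_term_le G_sums] by simp

end

subsection \<open>Values of rational functions\<close>

text \<open>Relational form of \<open>rat_eval\<close> that includes regularity at the point, so
  that values can be computed compositionally without handling a description operator.\<close>

definition has_val :: "'a::field poly fract \<Rightarrow> 'a \<Rightarrow> 'a \<Rightarrow> bool" where
  "has_val r x v \<longleftrightarrow> (\<exists>a b. poly b x \<noteq> 0 \<and> r = Fract a b \<and> v = poly a x / poly b x)"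

lemma has_valI: "poly b x \<noteq> 0 \<Longrightarrow> has_val (Fract a b) x (poly a x / poly b x)"
  by (auto simp: has_val_def)

lemma has_val_unique:
  assumes "has_val r x v" "has_val r x w"
  shows "v = w"
proof -
  obtain a b where ab: "poly b x \<noteq> 0" "r = Fract a b" "v = poly a x / poly b x"
    using assms(1) unfolding has_val_def by blast
  obtain c d where cd: "poly d x \<noteq> 0" "r = Fract c d" "w = poly c x / poly d x"
    using assms(2) unfolding has_val_def by blast
  note * = ab cd
  then have "b \<noteq> 0" "d \<noteq> 0"
    by auto
  then have "a * d = c * b"
    using * by (simp add: eq_fract)
  then have "poly a x * poly d x = poly c x * poly b x"
    by (metis poly_mult)
  then show ?thesis
    using * by (simp add: frac_eq_eq)
qed

lemma rat_eval_eq: "has_val r x v \<Longrightarrow> rat_eval r x = v"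
  unfolding rat_eval_def
  by (rule the_equality) (auto simp: has_val_def intro: has_val_unique[unfolded has_val_def])

lemma has_val_mult:
  assumes "has_val r x v" "has_val s x w"
  shows "has_val (r * s) x (v * w)"
proof -
  obtain a b c d where *: "poly b x \<noteq> 0" "r = Fract a b" "v = poly a x / poly b x"
    "poly d x \<noteq> 0" "s = Fract c d" "w = poly c x / poly d x"
    using assms by (auto simp: has_val_def)
  then show ?thesis
    using has_valI[of "b * d" x "a * c"] by simp
qed

lemma has_val_add:
  assumes "has_val r x v" "has_val s x w"
  shows "has_val (r + s) x (v + w)"
proof -
  obtain a b c d where *: "poly b x \<noteq> 0" "r = Fract a b" "v = poly a x / poly b x"
    "poly d x \<noteq> 0" "s = Fract c d" "w = poly c x / poly d x"
    using assms by (auto simp: has_val_def)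
  then have "b \<noteq> 0" "d \<noteq> 0"
    by auto
  then show ?thesis
    using * has_valI[of "b * d" x "a * d + c * b"] by (simp add: add_frac_eq)
qed

lemma has_val_const: "has_val (constC c) x c"
  using has_valI[of 1 x "[:c:]"] by (simp add: constC_def)

lemma has_val_0: "has_val 0 x 0"
  using has_valI[of 1 x 0] by (simp add: Zero_fract_def)

lemma has_val_1: "has_val 1 x 1"
  using has_valI[of 1 x 1] by (simp add: One_fract_def)

lemma has_val_sum: "(\<And>i. i \<in> A \<Longrightarrow> has_val (r i) x (v i)) \<Longrightarrow> has_val (\<Sum>i\<in>A. r i) x (\<Sum>i\<in>A. v i)"
  by (induction A rule: infinite_finite_induct) (auto intro: has_val_add has_val_0)

lemma has_val_prod: "(\<And>i. i \<in> A \<Longrightarrow> has_val (r i) x (v i)) \<Longrightarrow> has_val (\<Prod>i\<in>A. r i) x (\<Prod>i\<in>A. v i)"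
  by (induction A rule: infinite_finite_induct) (auto intro: has_val_mult has_val_1)

lemma has_val_inverse:
  assumes "has_val r x v" "v \<noteq> 0"
  shows "has_val (1 / r) x (1 / v)"
proof -
  obtain a b where "poly b x \<noteq> 0" "r = Fract a b" "v = poly a x / poly b x"
    using assms by (auto simp: has_val_def)
  then show ?thesis
    using assms has_valI[of a x b] by (simp add: One_fract_def)
qed

lemma tvar_minus_const: "tvar - constC c = Fract [:- c, 1:] 1"
  by (simp add: tvar_def constC_def)

lemma has_val_tvar_minus_const: "has_val (tvar - constC c) x (x - c)"
  using has_valI[of 1 x "[:- c, 1:]"] by (simp add: tvar_minus_const)


subsection \<open>The ring \<open>\<A>\<close>\<close>

text \<open>A nonconstant divisor of least degree is irreducible; it is normalized because
  \<open>ringA\<close> tests only monic irreducibles.\<close>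

lemma nonunit_has_monic_irreducible_factor:
  fixes p :: "'a::field poly"
  assumes "degree p > 0"
  obtains r where "irreducible r" "lead_coeff r = 1" "r dvd p"
proof -
  define P where "P n \<longleftrightarrow> (\<exists>d. d dvd p \<and> degree d > 0 \<and> degree d = n)" for n
  have "P (degree p)"
    using assms unfolding P_def by (intro exI[of _ p]) simp
  then obtain d where d: "d dvd p" "degree d > 0" "degree d = (LEAST n. P n)"
    using LeastI[of P] unfolding P_def by blast
  define r where "r = smult (inverse (lead_coeff d)) d"
  have d0: "d \<noteq> 0"
    using d by auto
  have r: "lead_coeff r = 1" "r dvd p" "degree r = degree d"
    using d(1) d0 by (auto simp: r_def smult_dvd_iff)
  have "irreducible r"
  proof (rule irreducibleI)
    show "r \<noteq> 0"
      using r by auto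
    show "\<not> r dvd 1"
      using r d by (simp add: is_unit_iff_degree \<open>r \<noteq> 0\<close>)
    fix a b assume ab: "r = a * b"
    then have nz: "a \<noteq> 0" "b \<noteq> 0"
      using \<open>r \<noteq> 0\<close> by auto
    have deg: "degree a + degree b = degree d"
      using nz r ab by (metis degree_mult_eq)
    show "a dvd 1 \<or> b dvd 1"
    proof (cases "degree a = 0")
      case True
      then show ?thesis
        using nz by (simp add: is_unit_iff_degree)
    next
      case False
      have "a dvd p"
        using ab r(2) by (metis dvd_mult_left)
      then have "degree d \<le> degree a"
        unfolding d(3) using False by (intro Least_le) (auto simp: P_def)
      then have "degree b = 0"
        using deg by simp
      then show ?thesis
        using nz by (simp add: is_unit_iff_degree)
    qed
  qed
  with r that show thesis
    by blast
qed

context carlitz_setting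
begin

lemma monic_irreducible_dvd_rho:
  assumes "irreducible p" "lead_coeff p = 1" "p dvd rho S"
  shows "p = rho S"
proof -
  obtain e where e: "rho S = p * e"
    using assms(3) by (auto elim: dvdE)
  have "\<not> p dvd 1"
    using assms(1) by (simp add: irreducible_def)
  then have "e dvd 1"
    using rho_irreducible e by (auto simp: irreducible_def)
  then obtain c where "e = [:c:]"
    using is_unit_polyE by (metis is_unit_poly_iff)
  moreover have "lead_coeff e = 1"
    using rho_monic assms(2) by (simp add: e lead_coeff_mult)
  ultimately show ?thesis
    by (simp add: e)
qed

lemma degree_rho_power: "degree (rho S ^ m) = m * N"
  using rho_nonzero by (simp add: degree_power_eq NN_def)

lemma ringA_Fract:
  assumes "degree p \<le> m * N"
  shows "Fract p (rho S ^ m) \<in> ringA S"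
  unfolding ringA_def
proof (intro CollectI conjI allI impI)
  show "regular_at_infinity (Fract p (rho S ^ m))"
    unfolding regular_at_infinity_def using assms rho_nonzero
    by (intro exI[of _ p] exI[of _ "rho S ^ m"]) (simp add: degree_rho_power)
  fix r assume r: "irreducible r \<and> lead_coeff r = 1 \<and> r \<noteq> rho S"
  then have "prime_elem r"
    by (intro field_poly_irreducible_imp_prime) simp
  then have "\<not> r dvd rho S ^ m"
    using r monic_irreducible_dvd_rho prime_elem_dvd_power by blast
  then show "regular_at r (Fract p (rho S ^ m))"
    unfolding regular_at_def by blast
qed

text \<open>A denominator of least degree divides every other denominator. Once all powers of
  \<open>rho S\<close> are removed from it, a remaining irreducible factor would be a pole
  elsewhere, so only a constant is left; regularity at infinity then bounds the degree.\<close>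

lemma ringA_denominator:
  assumes "a \<in> ringA S"
  obtains p m where "a = Fract p (rho S ^ m)" "degree p \<le> m * N"
proof -
  define P where "P n \<longleftrightarrow> (\<exists>d p. d \<noteq> 0 \<and> a = Fract p d \<and> degree d = n)" for n
  have "P (LEAST n. P n)"
  proof -
    obtain p d where "a = Fract p d" "d \<noteq> 0"
      by (cases a)
    then have "P (degree d)"
      by (auto simp: P_def)
    then show ?thesis
      by (rule LeastI)
  qed
  then obtain d p where d: "d \<noteq> 0" "a = Fract p d" "degree d = (LEAST n. P n)"
    by (auto simp: P_def)
  have dvd: "d dvd r" if r: "r \<noteq> 0" "a = Fract s r" for r s
  proof (rule ccontr)
    assume "\<not> d dvd r"
    define v where "v = r mod d"
    have v: "v \<noteq> 0"
      using \<open>\<not> d dvd r\<close> by (simp add: v_def dvd_eq_mod_eq_0)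
    have "s * d = p * r"
      using d r by (simp add: eq_fract)
    also have "r = d * (r div d) + v"
      by (simp add: v_def)
    finally have "p * v = (s - p * (r div d)) * d"
      by (simp add: algebra_simps)
    then have "a = Fract (s - p * (r div d)) v"
      using d v by (simp add: eq_fract)
    then have "(LEAST n. P n) \<le> degree v"
      using v by (intro Least_le) (auto simp: P_def)
    then show False
      using v d degree_mod_less[of d r] by (simp add: v_def)
  qed
  \<comment> \<open>Minimizing the degree of the cofactor \<open>e\<close> extracts the full power
    of \<open>rho S\<close>.\<close>
  define Q where "Q n \<longleftrightarrow> (\<exists>e m. d = rho S ^ m * e \<and> degree e = n)" for n
  have "Q (degree d)"
    unfolding Q_def by (rule exI[of _ d], rule exI[of _ 0]) simp
  then have "Q (LEAST n. Q n)"
    by (rule LeastI)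
  then obtain e m where e: "d = rho S ^ m * e" "degree e = (LEAST n. Q n)"
    by (auto simp: Q_def)
  have e0: "e \<noteq> 0"
    using d e by auto
  have rho_e: "\<not> rho S dvd e"
  proof
    assume "rho S dvd e"
    then obtain e' where e': "e = rho S * e'"
      by (auto elim: dvdE)
    then have "(LEAST n. Q n) \<le> degree e'"
      using e by (intro Least_le) (auto simp: Q_def intro!: exI[of _ e'] exI[of _ "Suc m"])
    moreover have "degree e = N + degree e'"
      using e' e0 rho_nonzero by (auto simp: degree_mult_eq NN_def)
    ultimately show False
      using e N_ge_2 by simp
  qed
  have "degree e = 0"
  proof (rule ccontr)
    assume "degree e \<noteq> 0"
    then obtain r where r: "irreducible r" "lead_coeff r = 1" "r dvd e"
      using nonunit_has_monic_irreducible_factor[of e] by blast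
    then have "r \<noteq> rho S"
      using rho_e by blast
    then have "regular_at r a"
      using assms r by (auto simp: ringA_def)
    then obtain s b where "\<not> r dvd b" "a = Fract s b"
      by (auto simp: regular_at_def)
    moreover have "r dvd d"
      using r(3) by (simp add: e)
    ultimately show False
      using dvd[of b s] by (metis dvd_0_right dvd_trans)
  qed
  then obtain c where c: "e = [:c:]"
    by (rule degree_eq_zeroE)
  then have c0: "c \<noteq> 0"
    using e0 by auto
  have a: "a = Fract (smult (inverse c) p) (rho S ^ m)"
    using d c0 rho_nonzero by (simp add: e c eq_fract)
  obtain s b where sb: "b \<noteq> 0" "degree s \<le> degree b" "a = Fract s b"
    using assms by (auto simp: ringA_def regular_at_infinity_def)
  have "smult (inverse c) p * b = s * rho S ^ m"
    using a sb rho_nonzero by (simp add: eq_fract)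
  then have "degree (smult (inverse c) p) \<le> m * N"
  proof (cases "p = 0")
    case False
    have "degree (smult (inverse c) p) + degree b = degree (smult (inverse c) p * b)"
      using False c0 sb by (subst degree_mult_eq) auto
    also have "\<dots> = degree (s * rho S ^ m)"
      using \<open>smult (inverse c) p * b = s * rho S ^ m\<close> by simp
    also have "\<dots> \<le> degree b + m * N"
      using degree_mult_le[of s "rho S ^ m"] sb(2) by (simp add: degree_rho_power)
    finally show ?thesis
      by simp
  qed simp
  with a that show thesis
    by blast
qed

lemma base_ext_Fract:
  assumes "b \<noteq> 0"
  shows "base_ext S (Fract a b) = Fract (ep a) (ep b)"
  unfolding base_ext_def
proof (rule the_equality)
  show "\<exists>a' b'. b' \<noteq> 0 \<and> Fract a b = Fract a' b' \<and> Fract (ep a) (ep b) = Fract (ep a') (ep b')"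
    using assms by blast
next
  fix y assume "\<exists>a' b'. b' \<noteq> 0 \<and> Fract a b = Fract a' b' \<and> y = Fract (ep a') (ep b')"
  then obtain a' b' where *: "b' \<noteq> 0" "Fract a b = Fract a' b'" "y = Fract (ep a') (ep b')"
    by blast
  then have "a * b' = a' * b"
    using assms by (simp add: eq_fract)
  then have "ep a * ep b' = ep a' * ep b"
    by (simp flip: ep_mult)
  then show "y = Fract (ep a) (ep b)"
    using * assms by (simp add: eq_fract)
qed

lemma iota_Fract: "b \<noteq> 0 \<Longrightarrow> iota S (Fract a b) = poly (ep a) (theta S) / poly (ep b) (theta S)"
  unfolding iota_def
  using poly_ep_th_neq_0[of b 0] by (intro rat_eval_eq) (simp add: base_ext_Fract has_valI)

text \<open>Frobenius fixes the coefficients, so it can be moved from the argument \<theta> to the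
  value.\<close>

lemma has_val_base_ext: "has_val (base_ext S a) (th n) (iota S a ^ q ^ n)"
proof (cases a)
  case (Fract x b)
  then have "has_val (base_ext S a) (th n) (poly (ep x) (th n) / poly (ep b) (th n))"
    using poly_ep_th_neq_0[of b n] by (simp add: base_ext_Fract has_valI)
  then show ?thesis
    using Fract by (simp add: iota_Fract power_divide poly_ep_frob)
qed


subsection \<open>The field \<open>K(\<eta>)\<close>\<close>

lemma field_gen_zero: "0 \<in> field_gen (X :: 'c set)"
  using field_gen.diff[OF field_gen.one field_gen.one] by simp

lemma field_gen_add: "x \<in> field_gen (X :: 'c set) \<Longrightarrow> y \<in> field_gen X \<Longrightarrow> x + y \<in> field_gen X"
  using field_gen.diff[OF _ field_gen.diff[OF field_gen_zero]] by fastforce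

lemma field_gen_divide: "x \<in> field_gen (X :: 'c set) \<Longrightarrow> y \<in> field_gen X \<Longrightarrow> x / y \<in> field_gen X"
  unfolding divide_inverse by (intro field_gen.mult field_gen.inverse)

lemma field_gen_power: "x \<in> field_gen (X :: 'c set) \<Longrightarrow> x ^ n \<in> field_gen X"
  by (induction n) (auto intro: field_gen.one field_gen.mult)

lemma field_gen_sum: "(\<And>i. i \<in> A \<Longrightarrow> f i \<in> field_gen (X :: 'c set)) \<Longrightarrow> (\<Sum>i\<in>A. f i) \<in> field_gen X"
  by (induction A rule: infinite_finite_induct) (auto intro: field_gen_zero field_gen_add)

lemma field_gen_prod: "(\<And>i. i \<in> A \<Longrightarrow> f i \<in> field_gen (X :: 'c set)) \<Longrightarrow> (\<Prod>i\<in>A. f i) \<in> field_gen X"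
  by (induction A rule: infinite_finite_induct) (auto intro: field_gen.one field_gen.mult)

lemmas Keta_intros =
  field_gen_zero[of "insert (eta S) (Kfield S)", folded Keta_def]
  field_gen.one[of "insert (eta S) (Kfield S)", folded Keta_def]
  field_gen.diff[of _ "insert (eta S) (Kfield S)", folded Keta_def]
  field_gen.mult[of _ "insert (eta S) (Kfield S)", folded Keta_def]
  field_gen_add[of _ "insert (eta S) (Kfield S)", folded Keta_def]
  field_gen_divide[of _ "insert (eta S) (Kfield S)", folded Keta_def]
  field_gen_power[of _ "insert (eta S) (Kfield S)", folded Keta_def]
  field_gen_sum[of _ _ "insert (eta S) (Kfield S)", folded Keta_def]
  field_gen_prod[of _ _ "insert (eta S) (Kfield S)", folded Keta_def]

lemma Kfield_subset_Keta: "x \<in> Kfield S \<Longrightarrow> x \<in> Keta S"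
  unfolding Keta_def by (rule field_gen.base) simp

lemma theta_in_Kfield: "theta S \<in> Kfield S"
  unfolding Kfield_def by (rule field_gen.base) simp

lemma one_in_Kfield: "1 \<in> Kfield S"
  unfolding Kfield_def by (rule field_gen.one)

lemma zero_in_Kfield: "0 \<in> Kfield S"
  unfolding Kfield_def by (rule field_gen_zero)

lemma theta_in_Keta: "theta S \<in> Keta S"
  by (rule Kfield_subset_Keta[OF theta_in_Kfield])

lemma etac_in_Keta: "etac S i \<in> Keta S"
proof -
  have "eta S \<in> Keta S"
    unfolding Keta_def by (rule field_gen.base) simp
  then show ?thesis
    unfolding etac_def by (rule Keta_intros)
qed

lemma poly_ep_in_Kfield: "poly (ep p) (theta S) \<in> Kfield S"
proof -
  have "emb S u \<in> Kfield S" for u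
    unfolding Kfield_def by (rule field_gen.base) simp
  then show ?thesis
    using theta_in_Kfield unfolding poly_altdef Kfield_def
    by (intro field_gen_sum field_gen.mult field_gen_power) (simp_all add: coeff_map_poly)
qed

lemma iota_in_Kfield: "iota S a \<in> Kfield S"
proof (cases a)
  case (Fract x b)
  then show ?thesis
    using poly_ep_in_Kfield unfolding Kfield_def by (simp add: iota_Fract field_gen_divide)
qed

definition sigma2 :: "'c \<Rightarrow> 'c" where
  "sigma2 x = sigma S (sigma S x)"

lemma sigma_in_Keta: "x \<in> Keta S \<Longrightarrow> sigma S x \<in> Keta S"
  using sigma_bij by (rule bij_betw_apply)

lemma sigma2_add: "x \<in> Keta S \<Longrightarrow> y \<in> Keta S \<Longrightarrow> sigma2 (x + y) = sigma2 x + sigma2 y"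
  by (simp add: sigma2_def sigma_add sigma_in_Keta)

lemma sigma2_mult: "x \<in> Keta S \<Longrightarrow> y \<in> Keta S \<Longrightarrow> sigma2 (x * y) = sigma2 x * sigma2 y"
  by (simp add: sigma2_def sigma_mult sigma_in_Keta)

lemma sigma2_Kfield: "x \<in> Kfield S \<Longrightarrow> sigma2 x = x"
  by (simp add: sigma2_def sigma_fixes)

lemma sigma2_0 [simp]: "sigma2 0 = 0" and sigma2_1 [simp]: "sigma2 1 = 1"
  by (simp_all add: sigma2_Kfield one_in_Kfield zero_in_Kfield)

lemma sigma2_diff:
  assumes "x \<in> Keta S" "y \<in> Keta S"
  shows "sigma2 (x - y) = sigma2 x - sigma2 y"
proof -
  have "x - y \<in> Keta S"
    using assms by (intro Keta_intros)
  from sigma2_add[OF this assms(2)] show ?thesis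
    by (simp add: algebra_simps)
qed

lemma sigma2_power: "x \<in> Keta S \<Longrightarrow> sigma2 (x ^ n) = sigma2 x ^ n"
  by (induction n) (auto simp: sigma2_mult Keta_intros)

lemma sigma2_sum: "(\<And>i. i \<in> A \<Longrightarrow> f i \<in> Keta S) \<Longrightarrow> sigma2 (\<Sum>i\<in>A. f i) = (\<Sum>i\<in>A. sigma2 (f i))"
  by (induction A rule: infinite_finite_induct) (auto simp: sigma2_add Keta_intros)

lemma sigma2_divide:
  assumes "x \<in> Keta S" "y \<in> Keta S" "y \<noteq> 0"
  shows "sigma2 (x / y) = sigma2 x / sigma2 y" and "sigma2 y \<noteq> 0"
proof -
  have *: "sigma2 (x / y) * sigma2 y = sigma2 x" if "x \<in> Keta S" for x
    using assms(2,3) that by (subst sigma2_mult [symmetric]) (auto intro!: Keta_intros)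
  have "sigma2 (1 / y) * sigma2 y = 1"
    using *[of 1] by (simp add: Keta_intros)
  then show "sigma2 y \<noteq> 0"
    by auto
  then show "sigma2 (x / y) = sigma2 x / sigma2 y"
    using *[OF assms(1)] by (simp add: field_simps)
qed

lemma sigma2_etac: "sigma2 (etac S i) = etac S (i + 2)"
proof -
  have eta: "eta S \<in> Keta S"
    using etac_in_Keta[of 0] by simp
  have sigma_pow: "sigma S (x ^ n) = sigma S x ^ n" if "x \<in> Keta S" for x n
  proof (induction n)
    case (Suc n)
    then show ?case
      using that by (simp add: sigma_mult Keta_intros)
  qed (simp add: sigma_fixes one_in_Kfield)
  have "sigma S (etac S i) = etac S (i + 1)" for i
  proof -
    have "sigma S (etac S i) = (eta S ^ q) ^ q ^ nat (i mod int N)"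
      using eta by (simp add: etac_conv_nat sigma_pow sigma_eta)
    also have "\<dots> = etac S i ^ q"
      by (simp add: etac_conv_nat mult.commute flip: power_mult)
    also have "\<dots> = etac S (i + 1)"
      by (rule etac_power_q)
    finally show ?thesis .
  qed
  then show ?thesis
    by (simp add: sigma2_def add.assoc)
qed

lemma sigma2_theta: "sigma2 (theta S) = theta S"
  by (rule sigma2_Kfield[OF theta_in_Kfield])


subsection \<open>Coefficients of \<open>\<Psi>\<close>\<close>

definition s_val :: "nat \<Rightarrow> 'c \<Rightarrow> 'c" where
  "s_val i x = (\<Prod>j<i. f_val S j x)"

lemma Thc_0: "Thc S 0 = 1 / (theta S - eta S)"
  by (simp add: Thc_def)

lemma Xn_power:
  "Xn m ^ q ^ j = (th j - th (m + j)) / ((th (m + j) - etac S (int j)) * (theta S - eta S) ^ q ^ j)"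
  by (simp add: Xn_def power_divide power_mult_distrib frob_diff etac_nat flip: power_q_add)

text \<open>\<open>Thc S 0 ^ q ^ j\<close> is \<open>1/(th j - etac S (int j))\<close>, which makes
  \<open>f^(j)\<close> a difference of two reciprocals. At \<open>j = n\<close> the value is 0, the
  source of the triangular structure.\<close>

lemma f_val_th:
  assumes "j \<le> n"
  shows "f_val S j (th n) = Xn (n - j) ^ q ^ j"
proof -
  have "(theta S - eta S) ^ q ^ j = th j - etac S (int j)"
    by (simp add: th_minus_etac)
  then have "f_val S j (th n) = 1 / (th n - etac S (int j)) - 1 / (th j - etac S (int j))"
    by (simp add: f_val_def Thc_0 power_divide)
  also have "\<dots> = (th j - th n) / ((th n - etac S (int j)) * (th j - etac S (int j)))"
    by (simp add: diff_frac_eq)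
  also have "\<dots> = Xn (n - j) ^ q ^ j"
    using assms by (simp add: Xn_power th_minus_etac)
  finally show ?thesis .
qed

text \<open>Each step unfolds \<open>D_(n-i)\<close> once: the \<open>q^i\<close>-th power of its
  last factor \<open>Xn (n - i)\<close> is the next factor \<open>f^(i)\<close> at the node.\<close>

lemma s_val_th:
  assumes "i \<le> n"
  shows "s_val i (th n) * Dn S (n - i) ^ q ^ i = Dn S n"
  using assms
proof (induction i)
  case (Suc i)
  then have "n - i = Suc (n - Suc i)"
    by simp
  then have "Dn S (n - i) = Dn S (n - Suc i) ^ q * Xn (n - i)"
    by (metis Dn_Suc_Xn)
  then have "Dn S (n - i) ^ q ^ i = Dn S (n - Suc i) ^ q ^ Suc i * f_val S i (th n)"
    using Suc.prems by (simp add: power_mult_distrib f_val_th flip: power_mult)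
  then show ?case
    using Suc by (simp add: s_val_def mult_ac)
qed (simp add: s_val_def)

lemma s_val_th_eq: "i \<le> n \<Longrightarrow> s_val i (th n) = Dn S n / Dn S (n - i) ^ q ^ i"
  using s_val_th[of i n] by (simp add: field_simps)

lemma s_val_th_eq_0: "n < i \<Longrightarrow> s_val i (th n) = 0"
  unfolding s_val_def
  by (rule prod_zero[of _]) (auto intro!: bexI[of _ n] simp: f_val_th Xn_def power_0_left)

lemma s_val_th_neq_0: "s_val n (th n) \<noteq> 0"
  by (simp add: s_val_th_eq)

lemma has_val_f_rat: "x \<noteq> etac S (int k) \<Longrightarrow> has_val (f_rat S k) x (f_val S k x)"
proof -
  assume "x \<noteq> etac S (int k)"
  then have "has_val (1 / (tvar - constC (etac S (int k))) + constC (- (Thc S 0 ^ q ^ k))) x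
      (1 / (x - etac S (int k)) + (- (Thc S 0 ^ q ^ k)))"
    by (intro has_val_add has_val_inverse has_val_tvar_minus_const has_val_const) auto
  moreover have "constC (- c) = - constC c" for c :: 'c
    by (simp add: constC_def)
  ultimately show ?thesis
    by (simp add: f_rat_def f_val_def)
qed

lemma has_val_s_rat: "has_val (s_rat S i) (th n) (s_val i (th n))"
  unfolding s_rat_def s_val_def by (intro has_val_prod has_val_f_rat) simp

section \<open>The Newton basis spans the functions with poles at the conjugates of \<eta>\<close>

definition s_den :: "nat \<Rightarrow> 'c poly" where
  "s_den n = (\<Prod>j<n. [:- etac S (int j), 1:])"

definition s_num :: "nat \<Rightarrow> 'c poly" where
  "s_num n = (\<Prod>j<n. [:1 + Thc S 0 ^ q ^ j * etac S (int j), - (Thc S 0 ^ q ^ j):])"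

lemma s_den_neq_0 [simp]: "s_den n \<noteq> 0"
  by (simp add: s_den_def prod_zero_iff)

lemma s_rat_eq: "s_rat S n = Fract (s_num n) (s_den n)"
proof (induction n)
  case 0
  then show ?case
    by (simp add: s_rat_def s_num_def s_den_def One_fract_def)
next
  case (Suc n)
  have "f_rat S n = Fract [:1 + Thc S 0 ^ q ^ n * etac S (int n), - (Thc S 0 ^ q ^ n):]
      [:- etac S (int n), 1:]"
  proof -
    have "f_rat S n = Fract 1 [:- etac S (int n), 1:] - Fract [:Thc S 0 ^ q ^ n:] 1"
      unfolding f_rat_def tvar_minus_const One_fract_def by (simp add: constC_def)
    then show ?thesis
      by (simp add: algebra_simps one_pCons)
  qed
  then show ?case
    using Suc by (simp add: s_rat_def s_num_def s_den_def)
qed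

lemma degree_s_num: "degree (s_num n) \<le> n"
proof (induction n)
  case (Suc n)
  have "degree (s_num (Suc n)) \<le> degree (s_num n) + 1"
  proof -
    have "degree (s_num (Suc n)) \<le> degree (s_num n) +
        degree [:1 + Thc S 0 ^ q ^ n * etac S (int n), - (Thc S 0 ^ q ^ n):]"
      unfolding s_num_def prod.lessThan_Suc by (rule degree_mult_le)
    also have "\<dots> \<le> degree (s_num n) + 1"
      by simp
    finally show ?thesis .
  qed
  with Suc show ?case
    by simp
qed (simp add: s_num_def)

text \<open>The j-th factor of \<open>s_num\<close> vanishes only at the node \<open>th j\<close>,
  which is never a conjugate of \<eta>.\<close>

lemma s_num_etac_neq_0: "poly (s_num n) (etac S i) \<noteq> 0"
proof -
  have "1 - Thc S 0 ^ q ^ j * (etac S i - etac S (int j)) \<noteq> 0" for j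
  proof
    assume "1 - Thc S 0 ^ q ^ j * (etac S i - etac S (int j)) = 0"
    then have "1 - (etac S i - etac S (int j)) / (th j - etac S (int j)) = 0"
      by (simp add: Thc_0 power_divide th_minus_etac)
    then have "etac S i - etac S (int j) = th j - etac S (int j)"
      by simp
    then show False
      by simp
  qed
  then show ?thesis
    by (simp add: s_num_def poly_prod prod_zero_iff algebra_simps)
qed

text \<open>A multiple of the top basis function is subtracted so that the numerator vanishes at the
  newest pole; this is possible because \<open>s_num\<close> does not vanish there. The factor
  cancels and one pole fewer remains.\<close>

lemma s_basis_spanning:
  "degree p \<le> n \<Longrightarrow> \<exists>c. Fract p (s_den n) = (\<Sum>i\<le>n. constC (c i) * s_rat S i)"
proof (induction n arbitrary: p)
  case 0
  then obtain a where "p = [:a:]"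
    by (metis degree_eq_zeroE le_zero_eq)
  then show ?case
    by (intro exI[of _ "\<lambda>_. a"]) (simp add: s_den_def s_rat_def constC_def)
next
  case (Suc n)
  let ?e = "etac S (int n)"
  define c where "c = poly p ?e / poly (s_num (Suc n)) ?e"
  have "poly (p - smult c (s_num (Suc n))) ?e = 0"
    using s_num_etac_neq_0[of "Suc n" "int n"] by (simp add: c_def)
  then obtain p' where p': "p - smult c (s_num (Suc n)) = [:- ?e, 1:] * p'"
    unfolding poly_eq_0_iff_dvd by (rule dvdE)
  have "degree p' \<le> n"
  proof (cases "p' = 0")
    case False
    have "Suc (degree p') = degree ([:- ?e, 1:] * p')"
      using False by (subst degree_mult_eq) auto
    also have "\<dots> \<le> Suc n"
      unfolding p' [symmetric]
      using Suc.prems degree_s_num[of "Suc n"] by (intro degree_diff_le) auto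
    finally show ?thesis
      by simp
  qed simp
  then obtain c' where c': "Fract p' (s_den n) = (\<Sum>i\<le>n. constC (c' i) * s_rat S i)"
    using Suc.IH by blast
  have s_den: "s_den (Suc n) = s_den n * [:- ?e, 1:]"
    by (simp add: s_den_def)
  have p: "p = smult c (s_num (Suc n)) + [:- ?e, 1:] * p'"
    using p' by (simp add: algebra_simps)
  have "Fract ([:- ?e, 1:] * p') (s_den (Suc n)) = Fract p' (s_den n)"
  proof (subst eq_fract(1))
    show "[:- ?e, 1:] * p' * s_den n = p' * s_den (Suc n)"
      unfolding s_den by (simp only: mult_ac)
  qed simp_all
  moreover have "Fract (smult c (s_num (Suc n))) (s_den (Suc n)) = constC c * s_rat S (Suc n)"
    by (simp add: constC_def s_rat_eq)
  moreover have "Fract p (s_den (Suc n)) =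
      Fract (smult c (s_num (Suc n))) (s_den (Suc n)) + Fract ([:- ?e, 1:] * p') (s_den (Suc n))"
    unfolding p by (simp add: eq_fract algebra_simps)
  ultimately have "Fract p (s_den (Suc n)) =
      (\<Sum>i\<le>Suc n. constC ((c'(Suc n := c)) i) * s_rat S i)"
    using c' by simp
  then show ?case
    by blast
qed

text \<open>The conjugates recur with period \<open>N\<close>, so each block of \<open>N\<close>
  factors is one copy of \<rho>; this matches the denominators found for the ring.\<close>

lemma s_den_mult_N: "s_den (m * N) = rhoC S ^ m"
proof (induction m)
  case (Suc m)
  have "s_den (Suc m * N) = s_den (m * N + N)"
    by (simp add: add.commute)
  also have "\<dots> = s_den (m * N) * (\<Prod>j<N. [:- etac S (int (m * N + j)), 1:])"
  proof -
    have "(\<Prod>j<m * N + k. g j) = (\<Prod>j<m * N. g j) * (\<Prod>j<k. g (m * N + j))" for k and g :: "nat \<Rightarrow> 'c poly"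
      by (induction k) (auto simp: mult_ac)
    then show ?thesis
      unfolding s_den_def .
  qed
  also have "(\<Prod>j<N. [:- etac S (int (m * N + j)), 1:]) = rhoC S"
    unfolding rhoC_eq_prod by (intro prod.cong refl) (simp add: etac_cong)
  finally show ?case
    by (simp add: Suc)
qed (simp add: s_den_def)

definition s_expansion :: "'k poly fract \<Rightarrow> 'c poly \<Rightarrow> bool" where
  "s_expansion a c \<longleftrightarrow> base_ext S a = (\<Sum>i\<le>degree c. constC (coeff c i) * s_rat S i)"

lemma s_expansion_exists:
  assumes "a \<in> ringA S"
  shows "\<exists>c. s_expansion a c"
proof -
  obtain p m where a: "a = Fract p (rho S ^ m)" "degree p \<le> m * N"
    using ringA_denominator[OF assms] by blast
  have "base_ext S a = Fract (ep p) (s_den (m * N))"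
    using rho_nonzero by (simp add: a base_ext_Fract s_den_mult_N ep_power rhoC_def)
  then obtain c where c: "base_ext S a = (\<Sum>i\<le>m * N. constC (c i) * s_rat S i)"
    using s_basis_spanning[of "ep p" "m * N"] a(2) by auto
  define d where "d = (\<Sum>i\<le>m * N. monom (c i) i)"
  have d: "coeff d i = (if i \<le> m * N then c i else 0)" for i
    by (simp add: d_def coeff_sum if_distrib cong: if_cong)
  have "degree d \<le> m * N"
    by (rule degree_le) (simp add: d)
  have "(\<Sum>i\<le>degree d. constC (coeff d i) * s_rat S i) = (\<Sum>i\<le>m * N. constC (coeff d i) * s_rat S i)"
    using \<open>degree d \<le> m * N\<close>
    by (intro sum.mono_neutral_left) (auto simp: coeff_eq_0 constC_def Zero_fract_def [symmetric])
  also have "\<dots> = base_ext S a"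
    unfolding c by (intro sum.cong) (auto simp: d)
  finally show ?thesis
    unfolding s_expansion_def by metis
qed

text \<open>At \<open>th n\<close> all basis functions of index above \<open>n\<close> vanish, so
  both sums can be extended to the larger of \<open>n\<close> and the degree.\<close>

lemma s_expansion_eval:
  assumes "s_expansion a c"
  shows "(\<Sum>i\<le>n. coeff c i * s_val i (th n)) = iota S a ^ q ^ n"
proof -
  have "has_val (base_ext S a) (th n) (\<Sum>i\<le>degree c. coeff c i * s_val i (th n))"
    unfolding assms[unfolded s_expansion_def]
    by (intro has_val_sum has_val_mult has_val_const has_val_s_rat)
  then have "(\<Sum>i\<le>degree c. coeff c i * s_val i (th n)) = iota S a ^ q ^ n"
    using has_val_base_ext has_val_unique by blast
  moreover have "(\<Sum>i\<le>degree c. coeff c i * s_val i (th n)) = (\<Sum>i\<le>max n (degree c). coeff c i * s_val i (th n))"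
    by (intro sum.mono_neutral_left) (auto simp: coeff_eq_0)
  moreover have "(\<Sum>i\<le>n. coeff c i * s_val i (th n)) = (\<Sum>i\<le>max n (degree c). coeff c i * s_val i (th n))"
    by (intro sum.mono_neutral_left) (auto simp: s_val_th_eq_0)
  ultimately show ?thesis
    by simp
qed

text \<open>Solves the triangular system. The recursion serves twice: for uniqueness of the
  expansion and for membership of its coefficients in \<open>Keta S\<close>.\<close>

lemma s_expansion_coeff:
  assumes "s_expansion a c"
  shows "coeff c n = (iota S a ^ q ^ n - (\<Sum>i<n. coeff c i * s_val i (th n))) / s_val n (th n)"
proof (rule eq_divide_imp[OF s_val_th_neq_0])
  have "(\<Sum>i<n. coeff c i * s_val i (th n)) + coeff c n * s_val n (th n) = iota S a ^ q ^ n"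
    using s_expansion_eval[OF assms, of n] by (simp flip: lessThan_Suc_atMost)
  then show "coeff c n * s_val n (th n) = iota S a ^ q ^ n - (\<Sum>i<n. coeff c i * s_val i (th n))"
    unfolding eq_diff_eq by (simp only: add.commute)
qed

lemma s_expansion_unique:
  assumes "s_expansion a c" "s_expansion a d"
  shows "c = d"
proof (rule poly_eqI)
  show "coeff c n = coeff d n" for n
  proof (induction n rule: less_induct)
    case (less n)
    then have "(\<Sum>i<n. coeff c i * s_val i (th n)) = (\<Sum>i<n. coeff d i * s_val i (th n))"
      by (intro sum.cong) auto
    then show ?case
      unfolding s_expansion_coeff[OF assms(1), of n] s_expansion_coeff[OF assms(2), of n]
      by simp
  qed
qed

lemma Psi_expansion:
  assumes "a \<in> ringA S"
  shows "s_expansion a (Psi S a)"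
proof -
  obtain c where c: "s_expansion a c"
    using s_expansion_exists[OF assms] by blast
  then have "Psi S a = c"
    unfolding Psi_def using s_expansion_unique
    by (intro the_equality) (auto simp: s_expansion_def)
  with c show ?thesis
    by simp
qed

lemma th_in_Keta: "th n \<in> Keta S"
  by (intro Keta_intros theta_in_Keta)

lemma Xn_in_Keta: "Xn n \<in> Keta S"
  using etac_in_Keta[of 0] unfolding Xn_def by (intro Keta_intros theta_in_Keta th_in_Keta) auto

lemma Dn_in_Keta: "Dn S n \<in> Keta S"
proof (induction n)
  case (Suc n)
  then show ?case
    unfolding Dn_Suc_Xn by (intro Keta_intros Xn_in_Keta)
qed (simp add: Keta_intros)

lemma s_val_in_Keta: "i \<le> n \<Longrightarrow> s_val i (th n) \<in> Keta S"
  by (simp add: s_val_th_eq Keta_intros Dn_in_Keta)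

lemma Psi_coeff_in_Keta:
  assumes "a \<in> ringA S"
  shows "coeff (Psi S a) n \<in> Keta S"
proof (induction n rule: less_induct)
  case (less n)
  then show ?case
    unfolding s_expansion_coeff[OF Psi_expansion[OF assms], of n]
    by (intro Keta_intros Kfield_subset_Keta[OF iota_in_Kfield] s_val_in_Keta) auto
qed

text \<open>The interpolation identity divided by \<open>D_n\<close>: this is the coefficient of the
  \<open>q^n\<close>-th power in \<open>Psi_a(exp(x)) = exp(a x)\<close>.\<close>

lemma Psi_coeff_sum:
  assumes "a \<in> ringA S"
  shows "(\<Sum>i\<le>n. coeff (Psi S a) i / Dn S (n - i) ^ q ^ i) = iota S a ^ q ^ n / Dn S n"
proof -
  have "iota S a ^ q ^ n / Dn S n = (\<Sum>i\<le>n. coeff (Psi S a) i * s_val i (th n)) / Dn S n"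
    by (simp add: s_expansion_eval[OF Psi_expansion[OF assms]])
  also have "\<dots> = (\<Sum>i\<le>n. coeff (Psi S a) i / Dn S (n - i) ^ q ^ i)"
    by (simp add: sum_divide_distrib s_val_th_eq)
  finally show ?thesis ..
qed


subsection \<open>The exponential\<close>

definition Dn2 :: "nat \<Rightarrow> 'c" where
  "Dn2 n = sigma2 (Dn S n)"

lemma Dn2_neq_0 [simp]: "Dn2 n \<noteq> 0"
  unfolding Dn2_def using sigma2_divide(2)[OF Dn_in_Keta Dn_in_Keta] by simp

lemma Psi2_coeff_sum:
  assumes "a \<in> ringA S"
  shows "(\<Sum>i\<le>n. sigma2 (coeff (Psi S a) i) / Dn2 (n - i) ^ q ^ i) = iota S a ^ q ^ n / Dn2 n"
proof -
  have "sigma2 (\<Sum>i\<le>n. coeff (Psi S a) i / Dn S (n - i) ^ q ^ i) = sigma2 (iota S a ^ q ^ n / Dn S n)"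
    by (simp add: Psi_coeff_sum[OF assms])
  also have "sigma2 (iota S a ^ q ^ n / Dn S n) = iota S a ^ q ^ n / Dn2 n"
    by (simp add: sigma2_divide Keta_intros Kfield_subset_Keta[OF iota_in_Kfield] Dn_in_Keta
        sigma2_power sigma2_Kfield[OF iota_in_Kfield] Dn2_def)
  also have "sigma2 (\<Sum>i\<le>n. coeff (Psi S a) i / Dn S (n - i) ^ q ^ i) =
      (\<Sum>i\<le>n. sigma2 (coeff (Psi S a) i) / Dn2 (n - i) ^ q ^ i)"
    by (subst sigma2_sum)
      (auto simp: sigma2_divide Keta_intros Psi_coeff_in_Keta[OF assms] Dn_in_Keta sigma2_power Dn2_def)
  finally show ?thesis .
qed

lemma Dn2_0 [simp]: "Dn2 0 = 1"
  by (simp add: Dn2_def)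

lemma Dn2_Suc:
  "Dn2 (Suc n) = Dn2 n ^ q *
    ((theta S - th (Suc n)) / ((th (Suc n) - etac S 2) * (theta S - etac S 2)))"
proof -
  have eta: "eta S = etac S 0"
    by simp
  have "sigma2 (Xn (Suc n)) = (theta S - th (Suc n)) / ((th (Suc n) - etac S 2) * (theta S - etac S 2))"
    unfolding Xn_def eta
    using th_neq_etac(1)[of 0 0] th_neq_etac(1)[of "Suc n" 0]
    by (simp add: sigma2_divide sigma2_mult sigma2_diff sigma2_power sigma2_theta sigma2_etac
        Keta_intros th_in_Keta theta_in_Keta etac_in_Keta del: etac_0 power_Suc)
  then show ?thesis
    unfolding Dn2_def Dn_Suc_Xn
    by (simp add: sigma2_mult sigma2_power Keta_intros Dn_in_Keta Xn_in_Keta)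
qed

lemma theta_neq_etac [simp]: "theta S \<noteq> etac S i" "theta S \<noteq> eta S"
  using th_neq_etac(1)[of 0 i] th_neq_etac(1)[of 0 0] by auto

lemma th_neq_eta [simp]: "th n \<noteq> eta S"
  using th_neq_etac(1)[of n 0] by simp

lemma C02_power:
  "C02 S ^ (q - 1) = (theta S - eta S) / (theta S - etac S 2) *
     ((theta S - eta S) / (theta S - etac S 1)) ^ (q - 1)"
  unfolding C02_def power_mult_distrib root_C by (simp add: Thc_def)

lemma C02_neq_0 [simp]: "C02 S \<noteq> 0"
proof -
  have "C02 S ^ (q - 1) \<noteq> 0"
    unfolding C02_power by simp
  then show ?thesis
    using q_ge_2 by (cases "C02 S = 0") (simp_all add: power_0_left)
qed

text \<open>The coefficient of \<open>U^(q^n)\<close> in the exponential of the \<sigma>^2-conjugate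
  module, rescaled by \<open>C02 S\<close> inside and its inverse outside.\<close>

definition E_coeff :: "nat \<Rightarrow> 'c" where
  "E_coeff n = C02 S ^ (q ^ n - 1) / Dn2 n"

lemma E_coeff_0 [simp]: "E_coeff 0 = 1"
  by (simp add: E_coeff_def)

lemma C02_power_q: "C02 S ^ (q ^ n - 1) = C02 S ^ q ^ n / C02 S"
  using power_diff[of "C02 S" 1 "q ^ n"] q_power_pos[of n] by (simp add: Suc_le_eq del: q_power_pos)

lemma E_coeff_Suc:
  "E_coeff (Suc n) = C02 S ^ (q - 1) * E_coeff n ^ q *
     ((th (Suc n) - etac S 2) * (theta S - etac S 2) / (theta S - th (Suc n)))"
proof -
  have "q ^ Suc n - 1 = (q - 1) + (q ^ n - 1) * q"
  proof -
    obtain r where "q ^ n = Suc r"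
      by (metis gr0_conv_Suc q_power_pos)
    then have "q ^ Suc n = q + (q ^ n - 1) * q"
      by simp
    then show ?thesis
      using q_ge_2 by linarith
  qed
  then have "C02 S ^ (q ^ Suc n - 1) = C02 S ^ (q - 1) * (C02 S ^ (q ^ n - 1)) ^ q"
    by (simp add: power_add power_mult)
  then show ?thesis
    by (simp add: E_coeff_def Dn2_Suc power_divide)
qed

text \<open>Recursion step for the closed form. Here a, b, e2 are \<theta> minus \<eta>,
  \<open>\<eta>^(1)\<close>, \<open>\<eta>^(2)\<close>; t0, t1, t2 are the same differences for the
  new node; T is its distance vector to its own conjugate and \<open>X\<close> is \<theta> minus the
  node. For \<open>X = 0\<close> both sides are 0 by the convention on division.\<close>

lemma E_coeff_closed_form_aux:
  fixes a b e2 T Tm D :: "'a::field"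
  assumes nz: "a \<noteq> 0" "b \<noteq> 0" "e2 \<noteq> 0" "T \<noteq> 0" "t1 \<noteq> 0" "t2 \<noteq> 0" "t0 \<noteq> 0" "D \<noteq> 0" and q: "0 < q"
  shows "a / e2 * (a / b) ^ (q - 1) * (b ^ q * T ^ 2 / (D * a ^ q * t1 * t2)) * (t2 * e2 / X) =
    b * T ^ 2 / (D * (X / (t0 * a)) * a * t0 * t1)"
proof -
  obtain r where r: "q = Suc r"
    using q by (cases q) auto
  show ?thesis
    using nz by (cases "X = 0") (simp_all add: r power_divide field_simps)
qed

text \<open>\<open>Dn2 n\<close> and \<open>Dn S n\<close> differ only in which conjugates occur in
  their denominators; the powers of \<open>C02 S\<close> are tuned so that their ratio collapses to
  a few factors at the two ends.\<close>

lemma E_coeff_eq: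
  "E_coeff n = (theta S - etac S 1) * (th n - etac S (int n))\<^sup>2 /
     (Dn S n * (theta S - eta S) * (th n - eta S) * (th n - etac S 1))"
proof (induction n)
  case 0
  show ?case
    by (simp add: power2_eq_square)
next
  case (Suc n)
  let ?t = "th (Suc n)"
  have tq: "(th n - etac S i) ^ q = ?t - etac S (i + 1)" for i
    by (simp add: frobenius_diff etac_power_q mult.commute flip: power_mult)
  have tq0: "(th n - eta S) ^ q = ?t - etac S 1"
    using tq[of 0] by simp
  have pw: "((th n - etac S (int n))\<^sup>2) ^ q = (?t - etac S (int (Suc n)))\<^sup>2"
    using tq[of "int n"] by (simp add: add.commute mult.commute flip: power_mult)
      (simp add: power_mult)
  have IH: "E_coeff n ^ q = (theta S - etac S 1) ^ q * (?t - etac S (int (Suc n)))\<^sup>2 /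
      (Dn S n ^ q * (theta S - eta S) ^ q * (?t - etac S 1) * (?t - etac S 2))"
    unfolding Suc.IH by (simp only: power_divide power_mult_distrib tq tq0 pw) simp
  show ?case
    unfolding E_coeff_Suc C02_power IH Dn_Suc_Xn Xn_def
    by (rule E_coeff_closed_form_aux) (simp_all del: power_Suc)
qed

lemma etac_1_neq: "1 mod int N \<noteq> 0 mod int N"
  using N_ge_2 by simp

text \<open>Because \<open>N\<close> is at least 2, \<eta> and \<open>\<eta>^(1)\<close> are
  different and \<open>th n\<close> can be close to only one of them; so one factor
  \<open>rad n\<close> of the square is left over.\<close>

lemma absv_E_coeff_le: "absv (E_coeff n) \<le> real q * rad n / absv (Dn S n)"
proof -
  have prod: "rad n \<le> absv (th n - eta S) * absv (th n - etac S 1)"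
  proof -
    have "absv (th n - eta S) = (if int n mod int N = 0 mod int N then rad n else 1)"
      using absv_th_minus_etac[of n 0] by simp
    then show ?thesis
      using etac_1_neq by (auto simp: absv_th_minus_etac)
  qed
  have D: "0 < absv (Dn S n)"
    by simp
  have "absv (E_coeff n) = absv (theta S - etac S 1) * (real q * (rad n / absv (Dn S n)) *
      (rad n / (absv (th n - eta S) * absv (th n - etac S 1))))"
    by (simp add: E_coeff_eq absv_divide absv_times absv_power uniformizer absv_th_minus_etac_self
        power2_eq_square mult_ac)
  also have "\<dots> \<le> 1 * (real q * (rad n / absv (Dn S n)) * 1)"
    using prod absv_th_minus_etac_le_1[of 0 1]
    by (intro mult_mono mult_left_mono) (auto simp: divide_le_eq_1 mult_nonneg_nonneg)
  finally show ?thesis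
    by simp
qed

definition E_fun :: "'c \<Rightarrow> 'c" where
  "E_fun x = (\<Sum>n. E_coeff n * x ^ q ^ n)"

lemma E_term_bound:
  "absv (E_coeff n * x ^ q ^ n) \<le> real q * (absv x * (1 / real q) ^ (n div N)) ^ q ^ n"
proof -
  have "absv (E_coeff n) \<le> real q * 1 / absv (Dn S n)"
    by (rule order_trans[OF absv_E_coeff_le]) (auto intro!: divide_right_mono mult_left_mono)
  then have "absv (E_coeff n * x ^ q ^ n) \<le> real q * 1 / absv (Dn S n) * absv x ^ q ^ n"
    unfolding absv_times absv_power by (rule mult_right_mono) simp
  also have "\<dots> = real q * absv (x ^ q ^ n / Dn S n)"
    by (simp add: absv_divide absv_power)
  also have "\<dots> \<le> real q * (absv x * (1 / real q) ^ (n div N)) ^ q ^ n"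
    by (intro mult_left_mono absv_power_div_Dn_le) simp
  finally show ?thesis .
qed

lemma E_term_tendsto_0: "(\<lambda>n. absv (E_coeff n * x ^ q ^ n)) \<longlonglongrightarrow> 0"
proof (rule tendsto_sandwich[OF _ _ tendsto_const])
  show "(\<lambda>n. real q * (absv x * (1 / real q) ^ (n div N)) ^ q ^ n) \<longlonglongrightarrow> 0"
    using tendsto_mult_right_zero[OF growth_tendsto_0[of "absv x"]] by simp
qed (auto intro: always_eventually E_term_bound)

lemma E_sums: "(\<lambda>n. E_coeff n * x ^ q ^ n) sums E_fun x"
  unfolding E_fun_def by (rule summable_sums, rule summable_absv[OF E_term_tendsto_0])

lemma E_fun_add: "E_fun (x + y) = E_fun x + E_fun y"
  using sums_unique2[OF E_sums[of "x + y"]] sums_plus[OF E_sums[of x] E_sums[of y]]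
  by (simp add: frob_add distrib_left)

lemma E_fun_emb: "E_fun (emb S u * x) = emb S u * E_fun x"
  using sums_unique2[OF E_sums[of "emb S u * x"]] sums_times_left[OF E_sums[of x], of "emb S u"]
  by (simp add: power_mult_distrib emb_power_q_power mult_ac)

text \<open>The i-th term of \<open>Phi_a\<close> shifts the series by i places; after alignment the
  coefficient of each \<open>q^k\<close>-th power is the finite sum in
  \<open>Psi2_coeff_sum\<close>.\<close>

lemma E_fun_functional_equation:
  assumes a: "a \<in> ringA S"
  shows "Phi_map S a (E_fun x) = E_fun (iota S a * x)"
proof -
  define c where "c i = sigma2 (coeff (Psi S a) i)" for i
  define D where "D = degree (Psi S a)"
  have c0: "c i = 0" if "D < i" for i
    using that by (simp add: c_def D_def coeff_eq_0)
  have term_eq: "(C02 S * (E_coeff n * x ^ q ^ n)) ^ q ^ i = (C02 S * x) ^ q ^ (n + i) / Dn2 n ^ q ^ i" for n i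
    unfolding E_coeff_def C02_power_q power_q_add by (simp add: power_mult_distrib power_divide)
  have "(\<lambda>k. if k < i then 0 else (C02 S * x) ^ q ^ k / Dn2 (k - i) ^ q ^ i) sums (C02 S * E_fun x) ^ q ^ i" for i
  proof -
    have "(\<lambda>n. (C02 S * (E_coeff n * x ^ q ^ n)) ^ q ^ i) sums (C02 S * E_fun x) ^ q ^ i"
      by (intro sums_frob sums_times_left E_sums)
    from sums_shift_zero[OF this, of i] show ?thesis
      unfolding term_eq by (auto elim!: sums_cong[THEN iffD1, rotated])
  qed
  then have "(\<lambda>k. inverse (C02 S) * (\<Sum>i\<le>D. c i * (if k < i then 0 else (C02 S * x) ^ q ^ k / Dn2 (k - i) ^ q ^ i)))
      sums (inverse (C02 S) * (\<Sum>i\<le>D. c i * (C02 S * E_fun x) ^ q ^ i))"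
    by (intro sums_times_left sums_finite_sum)
  also have "inverse (C02 S) * (\<Sum>i\<le>D. c i * (C02 S * E_fun x) ^ q ^ i) = Phi_map S a (E_fun x)"
    by (simp add: Phi_map_def Psi2_map_def c_def D_def sigma2_def)
  also have "(\<lambda>k. inverse (C02 S) * (\<Sum>i\<le>D. c i * (if k < i then 0 else (C02 S * x) ^ q ^ k / Dn2 (k - i) ^ q ^ i))) =
     (\<lambda>k. E_coeff k * (iota S a * x) ^ q ^ k)"
  proof
    fix k
    have "(\<Sum>i\<le>D. c i * (if k < i then 0 else (C02 S * x) ^ q ^ k / Dn2 (k - i) ^ q ^ i)) =
        (\<Sum>i\<le>max k D. c i * (if k < i then 0 else (C02 S * x) ^ q ^ k / Dn2 (k - i) ^ q ^ i))"
      by (intro sum.mono_neutral_left) (auto simp: c0)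
    also have "\<dots> = (\<Sum>i\<le>k. c i * ((C02 S * x) ^ q ^ k / Dn2 (k - i) ^ q ^ i))"
      by (intro sum.mono_neutral_cong_right) auto
    also have "\<dots> = (C02 S * x) ^ q ^ k * (\<Sum>i\<le>k. c i / Dn2 (k - i) ^ q ^ i)"
      by (simp add: sum_distrib_left mult_ac)
    also have "(\<Sum>i\<le>k. c i / Dn2 (k - i) ^ q ^ i) = iota S a ^ q ^ k / Dn2 k"
      unfolding c_def by (rule Psi2_coeff_sum[OF a])
    finally show "inverse (C02 S) * (\<Sum>i\<le>D. c i * (if k < i then 0 else (C02 S * x) ^ q ^ k / Dn2 (k - i) ^ q ^ i)) =
        E_coeff k * (iota S a * x) ^ q ^ k"
      unfolding E_coeff_def C02_power_q by (simp add: power_mult_distrib divide_inverse mult_ac)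
  qed
  finally show ?thesis
    using E_sums sums_unique2 by blast
qed

section \<open>Characterization of the exponential by its functional equation\<close>

lemma strict_mono_q_power: "strict_mono (\<lambda>n. q ^ n)"
  using q_ge_2 by (auto simp: strict_mono_def intro: power_strict_increasing)

lemma E_is_exponential: "is_exponential S E_fun"
  unfolding is_exponential_def
proof (intro conjI allI ballI)
  \<comment> \<open>An ordinary power series is required, so the coefficients are spread out to the
    exponents \<open>q^n\<close> with zeros elsewhere.\<close>
  define c where "c m = (if m \<in> range (\<lambda>n. q ^ n) then E_coeff (inv (\<lambda>n. q ^ n) m) else 0)" for m
  have c_q: "c (q ^ n) = E_coeff n" for n
    using strict_mono_imp_inj_on[OF strict_mono_q_power] by (simp add: c_def inv_f_f)
  have "(\<lambda>n. c n * x ^ n) sums E_fun x" for x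
    using E_sums[of x] sums_mono_reindex[OF strict_mono_q_power, of "\<lambda>n. c n * x ^ n" "E_fun x"]
    by (simp add: c_q) (simp add: c_def)
  moreover have "c 1 = 1"
    using c_q[of 0] by simp
  ultimately show "\<exists>c. (\<forall>x. (\<lambda>n. c n * x ^ n) sums E_fun x) \<and> c 1 = 1"
    by blast
  show "E_fun (x + y) = E_fun x + E_fun y" for x y
    by (rule E_fun_add)
  show "E_fun (emb S u * x) = emb S u * E_fun x" for u x
    by (rule E_fun_emb)
  show "Phi_map S a (E_fun x) = E_fun (iota S a * x)" if "a \<in> ringA S" for a x
    by (rule E_fun_functional_equation[OF that])
qed

lemma Phi_map_diff: "Phi_map S a (x - y) = Phi_map S a x - Phi_map S a y"
  by (simp add: Phi_map_def Psi2_map_def right_diff_distrib frob_diff sum_subtractf)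

text \<open>The linear coefficient is \<open>iota S a\<close>; all other terms have exponent at
  least 2 and are dominated by it near 0. Its being nonzero makes the radius positive.\<close>

lemma Phi_map_small:
  assumes a: "a \<in> ringA S" and "iota S a \<noteq> 0"
  obtains d where "0 < d" "\<And>y :: 'c. absv y \<le> d \<Longrightarrow> absv (Phi_map S a y) \<le> absv (iota S a) * absv y"
proof -
  define p where "p i = inverse (C02 S) * (sigma2 (coeff (Psi S a) i) * C02 S ^ q ^ i)" for i
  define D where "D = degree (Psi S a)"
  have Phi: "Phi_map S a y = (\<Sum>i\<le>D. p i * y ^ q ^ i)" for y
    by (simp add: Phi_map_def Psi2_map_def p_def D_def sum_distrib_left power_mult_distrib
        sigma2_def mult_ac)
  have p0: "p 0 = iota S a"
    using Psi2_coeff_sum[OF a, of 0] by (simp add: p_def)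
  define M where "M = 1 + (\<Sum>i\<le>D. absv (p i))"
  have M: "1 \<le> M" "\<And>i. i \<le> D \<Longrightarrow> absv (p i) \<le> M"
    using member_le_sum[of _ "{..D}" "\<lambda>i. absv (p i)"] by (force simp: M_def sum_nonneg)+
  show thesis
  proof (rule that)
    show "0 < min 1 (absv (iota S a) / M)"
      using assms(2) M(1) by simp
    fix y :: 'c assume y: "absv y \<le> min 1 (absv (iota S a) / M)"
    show "absv (Phi_map S a y) \<le> absv (iota S a) * absv y"
      unfolding Phi
    proof (rule absv_sum_le)
      fix i assume "i \<in> {..D}"
      show "absv (p i * y ^ q ^ i) \<le> absv (iota S a) * absv y"
      proof (cases "i = 0")
        case True
        then show ?thesis
          by (simp add: p0 absv_times)
      next
        case False
        then have "2 \<le> q ^ i"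
          using q_ge_2 by (metis One_nat_def Suc_1 Suc_leI one_less_power less_le_trans neq0_conv lessI)
        then have "absv y ^ q ^ i \<le> absv y ^ 2"
          using y by (intro power_decreasing) auto
        then have "absv (p i * y ^ q ^ i) \<le> M * (absv y ^ 2)"
          using M \<open>i \<in> {..D}\<close> unfolding absv_times absv_power by (intro mult_mono) auto
        also have "\<dots> = (M * absv y) * absv y"
          by (simp add: power2_eq_square)
        also have "\<dots> \<le> absv (iota S a) * absv y"
          using y M(1) by (intro mult_right_mono) (auto simp: field_simps)
        finally show ?thesis .
      qed
    qed simp
  qed
qed

text \<open>
  The difference \<open>h\<close> of two exponentials is \<open>O(x\<^sup>2)\<close> at \<open>0\<close>, while \<open>h(\<alpha>x) = \<Phi>\<^sub>a(h(x))\<close> for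
  \<open>\<alpha> = \<iota>(a)\<close> and \<open>\<Phi>\<^sub>a\<close> scales small elements by at most \<open>|\<alpha>|\<close>; with \<open>|\<alpha>| > 1\<close> this forces \<open>h = 0\<close>.
\<close>

lemma exponential_unique:
  assumes e: "is_exponential S e"
  shows "e x = E_fun x"
proof -
  \<comment> \<open>\<open>1/\<rho>\<close> is an element of the ring whose image under \<iota> has
    absolute value above 1.\<close>
  define a where "a = Fract 1 (rho S ^ 1)"
  define \<alpha> where "\<alpha> = iota S a"
  have a: "a \<in> ringA S"
    unfolding a_def by (rule ringA_Fract) simp
  have \<alpha>_eq: "\<alpha> = 1 / poly (rhoC S) (theta S)"
    using rho_nonzero by (simp add: \<alpha>_def a_def iota_Fract rhoC_def)
  have "absv (poly (rhoC S) (theta S)) < 1"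
    using absv_rhoC_th[of 0] real_q_gt_1 by (auto intro: le_less_trans)
  then have \<alpha>1: "1 < absv \<alpha>"
    using rhoC_th_neq_0[of 0] by (simp add: \<alpha>_eq absv_divide)
  then have \<alpha>0: "\<alpha> \<noteq> 0"
    by auto
  define h where "h y = e y - E_fun y" for y
  have h_fe: "h (\<alpha> * y) = Phi_map S a (h y)" for y
    using e E_is_exponential a by (simp add: h_def Phi_map_diff is_exponential_def \<alpha>_def)
  obtain B where B: "0 < B" "\<And>y. absv y \<le> 1 \<Longrightarrow> absv (h y) \<le> B * absv y ^ 2"
  proof -
    obtain c where c: "\<And>y. (\<lambda>n. c n * y ^ n) sums e y" "c 1 = 1"
      using e unfolding is_exponential_def by blast
    obtain d where d: "\<And>y. (\<lambda>n. d n * y ^ n) sums E_fun y" "d 1 = 1"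
      using E_is_exponential unfolding is_exponential_def by blast
    have hs: "(\<lambda>n. (c n - d n) * y ^ n) sums h y" for y
      using sums_minus_diff[OF c(1)[of y] d(1)[of y]] by (simp add: h_def left_diff_distrib)
    have "(\<lambda>n. absv (c n - d n)) \<longlonglongrightarrow> 0"
      using sums_imp_absv_tendsto_zero[OF hs[of 1]] by simp
    then have "Bseq (\<lambda>n. absv (c n - d n))"
      by (rule convergent_imp_Bseq[OF convergentI])
    then obtain B where B: "0 < B" "\<And>n. absv (c n - d n) \<le> B"
      by (auto simp: Bseq_def)
    have h0: "h 0 = 0"
    proof -
      have "e (0 + 0) = e 0 + e 0" "E_fun (0 + 0) = E_fun 0 + E_fun 0"
        using e E_is_exponential unfolding is_exponential_def by blast+
      then have "e 0 = 0" "E_fun 0 = 0"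
        by (metis add_cancel_right_right)+
      then show ?thesis
        by (simp add: h_def)
    qed
    have "(\<lambda>n. (c n - d n) * 0 ^ n) sums (c 0 - d 0)"
      using sums_finite[of "{0}" "\<lambda>n. (c n - d n) * 0 ^ n"] by simp
    then have "c 0 - d 0 = 0"
      using hs[of 0] h0 sums_unique2 by metis
    have "absv (h y) \<le> B * absv y ^ 2" if y: "absv y \<le> 1" for y
    proof (rule sums_absv_le[OF hs])
      fix n
      show "absv ((c n - d n) * y ^ n) \<le> B * absv y ^ 2"
      proof (cases "2 \<le> n")
        case True
        then have "absv y ^ n \<le> absv y ^ 2"
          using y by (intro power_decreasing) auto
        then show ?thesis
          using B unfolding absv_times absv_power by (intro mult_mono) auto
      next
        case False
        then have "n = 0 \<or> n = 1"
          by auto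
        then have "c n - d n = 0"
          using \<open>c 0 - d 0 = 0\<close> c(2) d(2) by auto
        then show ?thesis
          using B(1) by simp
      qed
    qed
    with B(1) that show thesis
      by blast
  qed
  obtain \<delta> where \<delta>: "0 < \<delta>" "\<And>y. absv y \<le> \<delta> \<Longrightarrow> absv (Phi_map S a y) \<le> absv \<alpha> * absv y"
    using Phi_map_small[OF a] \<alpha>0 unfolding \<alpha>_def by blast
  \<comment> \<open>Chosen so that the quadratic bound puts \<open>h\<close> of the ball of radius
    \<epsilon> into the ball where \<open>Phi_a\<close> is controlled.\<close>
  define \<epsilon> where "\<epsilon> = min 1 (sqrt (\<delta> / B))"
  have \<epsilon>: "0 < \<epsilon>" "\<epsilon> \<le> 1" "B * \<epsilon> ^ 2 \<le> \<delta>"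
  proof -
    show "0 < \<epsilon>" "\<epsilon> \<le> 1"
      using \<delta> B by (auto simp: \<epsilon>_def)
    have "\<epsilon> ^ 2 \<le> sqrt (\<delta> / B) ^ 2"
      using \<open>0 < \<epsilon>\<close> by (intro power_mono) (auto simp: \<epsilon>_def)
    then have "\<epsilon> ^ 2 \<le> \<delta> / B"
      using \<delta> B by simp
    then show "B * \<epsilon> ^ 2 \<le> \<delta>"
      using B by (simp add: field_simps)
  qed
  have inv_tendsto: "(\<lambda>n. (1 / absv \<alpha>) ^ n) \<longlonglongrightarrow> 0"
    using \<alpha>1 by (intro LIMSEQ_power_zero) (simp add: divide_less_eq)
  have scale: "absv (y / \<alpha> ^ n) = absv y * (1 / absv \<alpha>) ^ n" for y n
    by (simp add: absv_divide absv_power power_divide)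
  have scale_le: "absv (y / \<alpha> ^ n) \<le> absv y" for y n
    unfolding scale using \<alpha>1 by (intro mult_left_le power_le_one) (auto simp: divide_le_eq)
  have small: "h y = 0" if y: "absv y \<le> \<epsilon>" for y
  proof -
    have bound: "absv (h (y / \<alpha> ^ n)) \<le> B * (absv y * (1 / absv \<alpha>) ^ n) ^ 2" for n
      using B(2)[of "y / \<alpha> ^ n"] scale_le[of y n] y \<epsilon> by (simp add: scale)
    have h_le: "absv (h (y / \<alpha> ^ n)) \<le> \<delta>" for n
    proof -
      have "absv (h (y / \<alpha> ^ n)) \<le> B * absv (y / \<alpha> ^ n) ^ 2"
        using B(2) scale_le[of y n] y \<epsilon> by auto
      also have "\<dots> \<le> B * \<epsilon> ^ 2"
        using B(1) scale_le[of y n] y by (intro mult_left_mono power_mono) auto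
      finally show ?thesis
        using \<epsilon> by simp
    qed
    have iter: "absv (h y) \<le> absv \<alpha> ^ n * absv (h (y / \<alpha> ^ n))" for n
    proof (induction n)
      case (Suc n)
      have "h (y / \<alpha> ^ n) = Phi_map S a (h (y / \<alpha> ^ Suc n))"
        using \<alpha>0 by (simp flip: h_fe)
      then have "absv (h (y / \<alpha> ^ n)) \<le> absv \<alpha> * absv (h (y / \<alpha> ^ Suc n))"
        using \<delta>(2) h_le by metis
      then have "absv \<alpha> ^ n * absv (h (y / \<alpha> ^ n)) \<le> absv \<alpha> ^ n * (absv \<alpha> * absv (h (y / \<alpha> ^ Suc n)))"
        by (intro mult_left_mono) auto
      with Suc show ?case
        by (simp add: mult_ac)
    qed simp
    \<comment> \<open>Shrinking the argument by \<open>\<alpha>^n\<close> gains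
      \<open>|\<alpha>|^(-2n)\<close> from the quadratic bound, while undoing it through
      \<open>Phi_a\<close> costs only \<open>|\<alpha>|^n\<close>.\<close>
    have "absv (h y) \<le> B * absv y ^ 2 * (1 / absv \<alpha>) ^ n" for n
    proof -
      have "absv (h y) \<le> absv \<alpha> ^ n * (B * (absv y * (1 / absv \<alpha>) ^ n) ^ 2)"
        by (rule order_trans[OF iter mult_left_mono[OF bound]]) simp
      also have "\<dots> = B * absv y ^ 2 * (1 / absv \<alpha>) ^ n"
        using \<alpha>0 by (simp add: power2_eq_square power_divide field_simps)
      finally show ?thesis .
    qed
    moreover have "(\<lambda>n. B * absv y ^ 2 * (1 / absv \<alpha>) ^ n) \<longlonglongrightarrow> B * absv y ^ 2 * 0"
      by (intro tendsto_intros inv_tendsto)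
    ultimately have "absv (h y) \<le> 0"
      using LIMSEQ_le_const[of "\<lambda>n. B * absv y ^ 2 * (1 / absv \<alpha>) ^ n" 0] by auto
    then show ?thesis
      using absv_nonneg[of "h y"] absv_eq_0_iff[of "h y"] by linarith
  qed
  have up: "h (\<alpha> ^ n * y) = 0" if "h y = 0" for n y
  proof (induction n)
    case (Suc n)
    have "Phi_map S a 0 = 0"
      using Phi_map_diff[of a 0 0] by simp
    then show ?case
      using Suc h_fe[of "\<alpha> ^ n * y"] by (simp add: mult.assoc)
  qed (use that in simp)
  have "(\<lambda>n. absv x * (1 / absv \<alpha>) ^ n) \<longlonglongrightarrow> absv x * 0"
    by (intro tendsto_intros inv_tendsto)
  then obtain n where "absv x * (1 / absv \<alpha>) ^ n < \<epsilon>"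
    using order_tendstoD(2)[of _ "absv x * 0" sequentially \<epsilon>] \<epsilon>(1)
    by (auto simp: eventually_sequentially)
  then have "h (x / \<alpha> ^ n) = 0"
    by (intro small) (simp add: scale)
  from up[OF this, of n] have "h x = 0"
    using \<alpha>0 by simp
  then show ?thesis
    by (simp add: h_def)
qed

lemma exp_Phi_eq: "exp_Phi S = E_fun"
  unfolding exp_Phi_def using E_is_exponential exponential_unique by (intro the_equality) auto


subsection \<open>The Frobenius difference equation\<close>

text \<open>Comparison of the coefficients of \<open>u = U^(q^(n+1))\<close>, with \<open>T\<close>
  the new node, w the square \<open>(T - \<eta>^(n+1))^2\<close>, and \<open>D\<close> the q-th
  power of \<open>D_n\<close>. Up to the common factor \<open>k\<close> it is a partial fraction
  identity.\<close>

lemma G_frobenius_identity: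
  fixes \<theta> T z \<eta> \<eta>1 w D u :: "'a::field"
  assumes "\<theta> \<noteq> T" "z \<noteq> T" "T \<noteq> \<eta>1" "T \<noteq> \<eta>" "\<theta> \<noteq> \<eta>" "z \<noteq> \<eta>" "D \<noteq> 0"
    and D': "D' = D * ((\<theta> - T) / ((T - \<eta>) * (\<theta> - \<eta>)))"
  shows "u / D * (w / (T - \<eta>1)) * ((z - \<eta>1) / (z - T)) =
    (1 / (z - \<eta>) - 1 / (\<theta> - \<eta>)) * (u / D' * (w / (T - \<eta>)) * ((z - \<eta>) / (z - T))) +
    (\<theta> - \<eta>1) * w / (D' * (\<theta> - \<eta>) * (T - \<eta>) * (T - \<eta>1)) * u"
proof -
  have nz: "\<theta> - T \<noteq> 0" "z - T \<noteq> 0" "T - \<eta>1 \<noteq> 0" "T - \<eta> \<noteq> 0" "\<theta> - \<eta> \<noteq> 0" "z - \<eta> \<noteq> 0"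
    using assms by auto
  define k where "k = u * w / D"
  have "(1 / (z - \<eta>) - 1 / (\<theta> - \<eta>)) * (u / D' * (w / (T - \<eta>)) * ((z - \<eta>) / (z - T))) =
      k * ((\<theta> - z) / ((\<theta> - T) * (z - T)))"
  proof -
    have "1 / (z - \<eta>) - 1 / (\<theta> - \<eta>) = (\<theta> - z) / ((z - \<eta>) * (\<theta> - \<eta>))"
      using nz by (simp add: diff_frac_eq)
    then show ?thesis
      unfolding D' k_def using nz by (simp add: mult_ac)
  qed
  moreover have "(\<theta> - \<eta>1) * w / (D' * (\<theta> - \<eta>) * (T - \<eta>) * (T - \<eta>1)) * u =
      k * ((\<theta> - \<eta>1) / ((\<theta> - T) * (T - \<eta>1)))"
    unfolding D' k_def using nz by (simp add: mult_ac)
  moreover have "u / D * (w / (T - \<eta>1)) * ((z - \<eta>1) / (z - T)) = k * ((z - \<eta>1) / ((T - \<eta>1) * (z - T)))"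
    by (simp add: k_def)
  moreover have "(z - \<eta>1) / ((T - \<eta>1) * (z - T)) =
      (\<theta> - z) / ((\<theta> - T) * (z - T)) + (\<theta> - \<eta>1) / ((\<theta> - T) * (T - \<eta>1))"
  proof -
    \<comment> \<open>In these letters both sides equal \<open>1/b + 1/c\<close>; the terms
      \<open>1/a\<close> cancel.\<close>
    define a b c where "a = \<theta> - T" and "b = z - T" and "c = T - \<eta>1"
    have "a \<noteq> 0" "b \<noteq> 0" "c \<noteq> 0"
      using nz by (auto simp: a_def b_def c_def)
    then have "(b + c) / (c * b) = (a - b) / (a * b) + (a + c) / (a * c)"
      by (simp add: divide_simps) (simp add: algebra_simps)
    then show ?thesis
      by (simp add: a_def b_def c_def)
  qed
  ultimately show ?thesis
    by (simp add: distrib_left)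
qed

text \<open>The q-th power of the n-th term belongs to \<open>U^(q^(n+1))\<close>, so the left
  series is shifted by one and starts with a zero, and the equation is checked term by term.\<close>

lemma G_frobenius_equation:
  assumes y: "y \<in> Dom S"
  shows "G_fun S U y ^ q = f_val S 0 (y ^ q) * G_fun S U (y ^ q) + E_fun U"
proof -
  define z where "z = y ^ q"
  have z: "z \<in> Dom S"
    using y Dom_frob by (simp add: z_def)
  have f: "f_val S 0 z = 1 / (z - eta S) - 1 / (theta S - eta S)"
    by (simp add: f_val_def Thc_0)
  have z_nz: "z \<noteq> eta S" "\<And>n. z \<noteq> th n"
    using Dom_neq_etac[OF z, of 0] Dom_neq_th[OF z] by auto
  have "(\<lambda>m. if m < 1 then 0 else G_term S U (m - 1) y ^ q ^ 1) sums (G_fun S U y ^ q ^ 1)"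
    by (intro sums_shift_zero[of "\<lambda>n. G_term S U n y ^ q ^ 1"] sums_frob G_sums y)
  also have "(\<lambda>m. if m < 1 then 0 else G_term S U (m - 1) y ^ q ^ 1) =
      (\<lambda>m. f_val S 0 z * G_term S U m z + E_coeff m * U ^ q ^ m)"
  proof
    fix m
    show "(if m < 1 then 0 else G_term S U (m - 1) y ^ q ^ 1) =
        f_val S 0 z * G_term S U m z + E_coeff m * U ^ q ^ m"
    proof (cases m)
      case 0
      \<comment> \<open>At index 0 there is no term on the left: \<open>f\<close> times the first
        term of \<open>G\<close> is \<open>-U\<close>, cancelling the leading term of the
        exponential.\<close>
      have "(1 / (z - eta S) - 1 / (theta S - eta S)) * (U * (theta S - eta S) * ((z - eta S) / (z - theta S))) = - U"
      proof -
        have "1 / (z - eta S) - 1 / (theta S - eta S) = (theta S - z) / ((z - eta S) * (theta S - eta S))"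
          using z_nz by (simp add: diff_frac_eq)
        also have "\<dots> * (U * (theta S - eta S) * ((z - eta S) / (z - theta S))) = U * ((theta S - z) / (z - theta S))"
          using z_nz by simp
        also have "(theta S - z) / (z - theta S) = -1"
          using z_nz(2)[of 0] minus_divide_left[of "z - theta S" "z - theta S"] by simp
        finally show ?thesis
          by simp
      qed
      then show ?thesis
        using z 0 by (simp add: f G_term_eq node_weight_def pole_ratio_def power2_eq_square)
    next
      case (Suc n)
      let ?T = "th (Suc n)"
      have e: "(th n - etac S i) ^ q = ?T - etac S (i + 1)" for i
        by (simp add: frobenius_diff etac_power_q mult.commute flip: power_mult)
      have weight: "node_weight n ^ q = (?T - etac S (int (Suc n)))\<^sup>2 / (?T - etac S 1)"
      proof -
        have "((th n - etac S (int n))\<^sup>2) ^ q = ((th n - etac S (int n)) ^ q)\<^sup>2"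
          by (simp add: mult.commute flip: power_mult)
        then show ?thesis
          using e[of 0] e[of "int n"] by (simp add: node_weight_def power_divide add.commute)
      qed
      have "pole_ratio n y ^ q = (z - etac S 1) / (z - ?T)"
        using etac_power_q[of 0]
        by (simp add: pole_ratio_def power_divide frobenius_diff z_def mult.commute flip: power_mult)
      then have lhs: "G_term S U n y ^ q = U ^ q ^ Suc n / Dn S n ^ q *
          ((?T - etac S (int (Suc n)))\<^sup>2 / (?T - etac S 1)) * ((z - etac S 1) / (z - ?T))"
        unfolding G_term_eq[OF y] power_mult_distrib weight power_divide power_q_Suc by simp
      show ?thesis
        unfolding Suc G_term_eq[OF z] f E_coeff_eq node_weight_def pole_ratio_def
        using lhs G_frobenius_identity[of "theta S" ?T z "etac S 1" "eta S" "Dn S n ^ q" "Dn S (Suc n)"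
            "U ^ q ^ Suc n" "(?T - etac S (int (Suc n)))\<^sup>2"]
          z_nz th_neq_th[of 0 "Suc n"] Dn_Suc_Xn[of n] Xn_def[of "Suc n"]
        by (simp del: power_Suc Dn.simps)
    qed
  qed
  finally have "(\<lambda>m. f_val S 0 z * G_term S U m z + E_coeff m * U ^ q ^ m) sums (G_fun S U y ^ q)"
    by simp
  moreover have "(\<lambda>m. f_val S 0 z * G_term S U m z + E_coeff m * U ^ q ^ m) sums
      (f_val S 0 z * G_fun S U z + E_fun U)"
    by (intro sums_plus sums_times_left G_sums E_sums z)
  ultimately show ?thesis
    unfolding z_def using sums_unique2 by blast
qed

lemma twist_G:
  assumes "z \<in> Dom S"
  shows "twist S (G_fun S U) z = f_val S 0 z * G_fun S U z + exp_Phi S U"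
proof -
  obtain y where y: "y ^ q = z"
    using frob_root_exists[of 1 z] by auto
  then have yD: "y \<in> Dom S"
    using assms Dom_frob by metis
  show ?thesis
    using twist_eq[OF G_in_tate yD, of U] G_frobenius_equation[OF yD, of U] by (simp add: y exp_Phi_eq)
qed


subsection \<open>The Anderson-type function\<close>

lemma iota_neq_0: "a \<noteq> 0 \<Longrightarrow> iota S a \<noteq> 0"
proof (cases a)
  case (Fract p d)
  moreover assume "a \<noteq> 0"
  ultimately have "p \<noteq> 0"
    by (auto simp: Zero_fract_def eq_fract)
  then show ?thesis
    using Fract poly_ep_th_neq_0[of p 0] poly_ep_th_neq_0[of d 0] by (simp add: iota_Fract)
qed

definition exp_act_rep :: "'c poly fract \<Rightarrow> 'c \<Rightarrow> 'c \<Rightarrow> bool" where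
  "exp_act_rep g U w \<longleftrightarrow> (\<exists>a m b l.
     a \<in> ringA S \<and> a \<noteq> 0 \<and> (\<forall>i<m. b i \<in> ringA S) \<and>
     g = 1 / base_ext S a * (\<Sum>i<(m::nat). base_ext S (b i) * constC (l i)) \<and>
     w = (\<Sum>i<m. l i * Phi_map S (b i) (exp_Phi S (U / iota S a))))"

text \<open>By the functional equation, \<open>g \<triangleright> U\<close> depends only on the values of \<open>g\<close> at the nodes \<open>\<theta>\<^bsup>q\<^sup>n\<^esup>\<close>.\<close>

lemma exp_act_rep_sums:
  assumes "exp_act_rep g U w" and g: "\<And>n. has_val g (th n) (v n)"
  shows "(\<lambda>n. E_coeff n * v n * U ^ q ^ n) sums w"
proof -
  obtain a m b l where a: "a \<in> ringA S" "a \<noteq> 0" and b: "\<And>i. i < m \<Longrightarrow> b i \<in> ringA S"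
    and g_eq: "g = 1 / base_ext S a * (\<Sum>i<(m::nat). base_ext S (b i) * constC (l i))"
    and w: "w = (\<Sum>i<m. l i * Phi_map S (b i) (exp_Phi S (U / iota S a)))"
    using assms(1) unfolding exp_act_rep_def by blast
  have a0: "iota S a \<noteq> 0"
    by (rule iota_neq_0[OF a(2)])
  have v: "v n = 1 / iota S a ^ q ^ n * (\<Sum>i<m. iota S (b i) ^ q ^ n * l i)" for n
  proof (rule has_val_unique[OF g])
    show "has_val g (th n) (1 / iota S a ^ q ^ n * (\<Sum>i<m. iota S (b i) ^ q ^ n * l i))"
      unfolding g_eq using a0
      by (intro has_val_mult has_val_inverse has_val_sum has_val_base_ext has_val_const) auto
  qed
  have "w = (\<Sum>i<m. l i * E_fun (iota S (b i) * (U / iota S a)))"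
    unfolding w exp_Phi_eq by (intro sum.cong refl) (simp add: E_fun_functional_equation b)
  moreover have "(\<lambda>n. \<Sum>i<m. l i * (E_coeff n * (iota S (b i) * (U / iota S a)) ^ q ^ n)) sums
      (\<Sum>i<m. l i * E_fun (iota S (b i) * (U / iota S a)))"
    by (intro sums_finite_sum sums_times_left E_sums)
  moreover have "(\<Sum>i<m. l i * (E_coeff n * (iota S (b i) * (U / iota S a)) ^ q ^ n)) =
      E_coeff n * v n * U ^ q ^ n" for n
    by (simp add: v sum_distrib_left sum_distrib_right power_mult_distrib power_divide mult_ac)
  ultimately show ?thesis
    by simp
qed

text \<open>A polynomial of degree \<open>d\<close> is made admissible by dividing by
  \<open>\<rho>^d\<close>: both \<open>1/\<rho>^d\<close> and \<open>t^i/\<rho>^d\<close> with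
  \<open>i \<le> d\<close> are regular at infinity.\<close>

lemma exp_act_rep_polynomial: "\<exists>w. exp_act_rep (Fract p 1) U w"
proof -
  define d where "d = degree p"
  define a where "a = Fract 1 (rho S ^ d)"
  define b where "b i = Fract (monom 1 i) (rho S ^ d)" for i
  define R where "R = rhoC S ^ d"
  have R0: "R \<noteq> 0"
    using rho_nonzero by (simp add: R_def rhoC_def)
  have a: "a \<in> ringA S" "a \<noteq> 0"
    using rho_nonzero unfolding a_def by (auto intro: ringA_Fract simp: Zero_fract_def eq_fract)
  have b: "b i \<in> ringA S" if "i < Suc d" for i
  proof -
    have "i \<le> d * N"
      using that N_ge_2 by (metis le_trans less_Suc_eq_le mult_le_mono2 nat_mult_1_right one_le_numeral)
    then show ?thesis
      unfolding b_def by (intro ringA_Fract) (simp add: degree_monom_eq)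
  qed
  have "(\<Sum>i<Suc d. base_ext S (b i) * constC (coeff p i)) = Fract p R"
  proof -
    have "base_ext S (b i) * constC (coeff p i) = Fract (monom (coeff p i) i) R" for i
      using rho_nonzero
      by (simp add: b_def base_ext_Fract constC_def map_poly_monom emb_one ep_power R_def rhoC_def smult_monom)
    then have "(\<Sum>i<Suc d. base_ext S (b i) * constC (coeff p i)) = (\<Sum>i<Suc d. Fract (monom (coeff p i) i) R)"
      by simp
    also have "\<dots> = Fract (\<Sum>i<k. monom (coeff p i) i) R" if "k = Suc d" for k
      unfolding that [symmetric]
    proof (induction k)
      case (Suc k)
      then show ?case
        using R0 by (simp add: eq_fract algebra_simps)
    qed (use R0 in \<open>simp add: Zero_fract_def eq_fract\<close>)
    also have "(\<Sum>i<Suc d. monom (coeff p i) i) = p"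
      unfolding d_def lessThan_Suc_atMost by (rule poly_as_sum_of_monoms)
    finally show ?thesis
      by simp
  qed
  moreover have "base_ext S a = Fract 1 R"
    using rho_nonzero by (simp add: a_def base_ext_Fract ep_power R_def rhoC_def)
  ultimately have "Fract p 1 = 1 / base_ext S a * (\<Sum>i<Suc d. base_ext S (b i) * constC (coeff p i))"
    using R0 by (simp add: One_fract_def eq_fract mult.commute)
  then show ?thesis
    unfolding exp_act_rep_def using a b by blast
qed

definition kernel_val :: "nat \<Rightarrow> nat \<Rightarrow> 'c" where
  "kernel_val k n = (th n - etac S 1) * (\<Prod>j<k. th n - etac S (- int j))"

lemma exp_act_kernel:
  "(\<lambda>n. E_coeff n * kernel_val k n * U ^ q ^ n) sums exp_act S (kernel_t S k) U"
proof -
  have val: "has_val (kernel_t S k) (th n) (kernel_val k n)" for n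
    unfolding kernel_t_def kernel_val_def
    by (intro has_val_mult has_val_prod has_val_tvar_minus_const)
  have Fract_prod: "(\<Prod>j<k. tvar - constC (c j)) = Fract (\<Prod>j<k. [:- c j, 1:]) 1" for c :: "nat \<Rightarrow> 'c"
    by (induction k) (simp_all add: tvar_minus_const One_fract_def)
  have "kernel_t S k = Fract ([:- etac S 1, 1:] * (\<Prod>j<k. [:- etac S (- int j), 1:])) 1"
    unfolding kernel_t_def Fract_prod by (simp add: tvar_minus_const)
  then obtain w where w: "exp_act_rep (kernel_t S k) U w"
    using exp_act_rep_polynomial by metis
  have "exp_act S (kernel_t S k) U = w"
    unfolding exp_act_def
  proof (rule the_equality)
    show "\<exists>a m b l. a \<in> ringA S \<and> a \<noteq> 0 \<and> (\<forall>i<m. b i \<in> ringA S) \<and>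
        kernel_t S k = 1 / base_ext S a * (\<Sum>i<(m::nat). base_ext S (b i) * constC (l i)) \<and>
        w = (\<Sum>i<m. l i * Phi_map S (b i) (exp_Phi S (U / iota S a)))"
      using w unfolding exp_act_rep_def .
    fix w' assume "\<exists>a m b l. a \<in> ringA S \<and> a \<noteq> 0 \<and> (\<forall>i<m. b i \<in> ringA S) \<and>
        kernel_t S k = 1 / base_ext S a * (\<Sum>i<(m::nat). base_ext S (b i) * constC (l i)) \<and>
        w' = (\<Sum>i<m. l i * Phi_map S (b i) (exp_Phi S (U / iota S a)))"
    then have "exp_act_rep (kernel_t S k) U w'"
      unfolding exp_act_rep_def .
    from sums_unique2[OF exp_act_rep_sums[OF this val] exp_act_rep_sums[OF w val]]
    show "w' = w" .
  qed
  then show ?thesis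
    using exp_act_rep_sums[OF w val] by simp
qed

section \<open>Telescoping of the kernel at a node\<close>

definition kernel_tail :: "nat \<Rightarrow> nat \<Rightarrow> 'c \<Rightarrow> 'c" where
  "kernel_tail m n z = (\<Prod>j<m. (th n - etac S (- int j)) / (z - etac S (- int j)))"

text \<open>From \<open>1 - (th n - e)/(z - e) = (z - th n)/(z - e)\<close>, each kernel term is
  \<open>pole_ratio n z\<close> times the difference of two consecutive tails.\<close>

lemma kernel_telescope:
  assumes z: "z \<in> Dom S"
  shows "(\<Sum>k<m. kernel_z S k z * (\<Prod>j<k. th n - etac S (- int j))) = pole_ratio n z * (1 - kernel_tail m n z)"
proof (induction m)
  case (Suc m)
  define e where "e = etac S (- int m)"
  define A where "A = (\<Prod>j<m. th n - etac S (- int j))"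
  define B where "B = (\<Prod>j<m. z - etac S (- int j))"
  define B' where "B' = (\<Prod>j=1..m. z - etac S (- int j))"
  have nz: "z - etac S i \<noteq> 0" "z - th n \<noteq> 0" for i
    using Dom_neq_etac[OF z] Dom_neq_th[OF z] by auto
  then have B0: "B \<noteq> 0" "B' \<noteq> 0" "z - e \<noteq> 0"
    by (auto simp: B_def B'_def e_def prod_zero_iff)
  \<comment> \<open>The product in \<open>kernel_z\<close> starts at \<open>j = 1\<close> and that
    in the tail at \<open>j = 0\<close>; the offset produces the numerator \<open>z - eta S\<close>
    of \<open>pole_ratio\<close>.\<close>
  have BB': "B * (z - e) = (z - eta S) * B'"
  proof -
    have "B * (z - e) = (\<Prod>j\<in>{0..m}. z - etac S (- int j))"
      by (simp add: B_def e_def lessThan_atLeast0 atLeast0_lessThan_Suc flip: atLeastLessThanSuc_atLeastAtMost)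
    also have "\<dots> = (z - eta S) * B'"
      unfolding B'_def by (subst prod.atLeast_Suc_atMost) auto
    finally show ?thesis .
  qed
  have tail: "kernel_tail m n z = A / B" "kernel_tail (Suc m) n z = A / B * ((th n - e) / (z - e))"
    by (simp_all add: kernel_tail_def A_def B_def e_def prod_dividef)
  have "1 / B' * A = (z - eta S) / (z - th n) * (A / B - A / B * ((th n - e) / (z - e)))"
  proof -
    have "A / B - A / B * ((th n - e) / (z - e)) = A / B * ((z - th n) / (z - e))"
      using B0 by (simp add: divide_simps) (simp add: algebra_simps)
    then have "(z - eta S) / (z - th n) * (A / B - A / B * ((th n - e) / (z - e))) =
        A * (z - eta S) / (B * (z - e))"
      using nz by simp
    also have "\<dots> = 1 / B' * A"
      unfolding BB' using nz(1)[of 0] by simp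
    finally show ?thesis ..
  qed
  then have "kernel_z S m z * A = pole_ratio n z * (kernel_tail m n z - kernel_tail (Suc m) n z)"
    unfolding tail pole_ratio_def kernel_z_def B'_def .
  then show ?case
    unfolding sum.lessThan_Suc Suc by (simp add: A_def [symmetric] right_diff_distrib)
qed (simp add: kernel_tail_def)

lemma absv_kernel_tail_factor:
  assumes z: "z \<in> Dom S"
  shows "absv ((th n - etac S i) / (z - etac S i)) \<le> absv (th n - etac S i)"
proof -
  have "absv (th n - etac S i) * absv (1 / (z - etac S i)) \<le> absv (th n - etac S i) * 1"
    by (intro mult_left_mono absv_inverse_diff_le_1 z) simp
  then show ?thesis
    by (simp flip: absv_times)
qed

text \<open>All factors are at most 1, and among any \<open>N\<close> consecutive ones the conjugate
  near \<open>th n\<close> occurs once, giving a factor at most \<open>1/q\<close>. The bound is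
  uniform in both \<open>n\<close> and \<open>z\<close>.\<close>

lemma absv_kernel_tail_le:
  assumes z: "z \<in> Dom S"
  shows "absv (kernel_tail m n z) \<le> (1 / real q) ^ (m div N)"
proof -
  define f where "f j = absv ((th n - etac S (- int j)) / (z - etac S (- int j)))" for j
  have f: "f j \<le> absv (th n - etac S (- int j))" "f j \<le> 1" "0 \<le> f j" for j
    using absv_kernel_tail_factor[OF z, of n "- int j"] absv_th_minus_etac_le_1[of n "- int j"]
    by (auto simp: f_def intro: order_trans)
  have block: "(\<Prod>j\<in>{m..<m+N}. f j) \<le> 1 / real q" for m
  proof -
    \<comment> \<open>The index of the block for which \<open>-j0\<close> is congruent to
      \<open>n\<close> modulo \<open>N\<close>.\<close>
    define j0 where "j0 = m + nat ((- int (m + n)) mod int N)"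
    have j0: "j0 \<in> {m..<m+N}"
      using pos_mod_bound[of "int N" "- int (m + n)"] N_pos by (simp add: j0_def nat_less_iff del: N_pos)
    have "int j0 + int n = (- int (m + n)) mod int N + int (m + n)"
      using pos_mod_sign[of "int N" "- int (m + n)"] N_pos by (simp add: j0_def del: N_pos)
    then have "(int j0 + int n) mod int N = 0"
      by (simp only: mod_add_left_eq) simp
    then have "(int n - (- int j0)) mod int N = 0"
      by (simp add: add.commute)
    then have "int n mod int N = (- int j0) mod int N"
      by (metis mod_0_imp_dvd mod_eq_dvd_iff)
    then have "f j0 \<le> 1 / real q"
      using f(1)[of j0] rad_le[of n] by (simp add: absv_th_minus_etac)
    moreover have "(\<Prod>j\<in>{m..<m+N} - {j0}. f j) \<le> 1"
      using f by (intro prod_le_1) auto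
    moreover have "(\<Prod>j\<in>{m..<m+N}. f j) = f j0 * (\<Prod>j\<in>{m..<m+N} - {j0}. f j)"
      using j0 by (intro prod.remove) auto
    ultimately show ?thesis
      using mult_mono[of "f j0" "1 / real q" "\<Prod>j\<in>{m..<m+N} - {j0}. f j" 1] f by (simp add: prod_nonneg)
  qed
  have blocks: "(\<Prod>j<k * N. f j) \<le> (1 / real q) ^ k" for k
  proof (induction k)
    case (Suc k)
    have ivl: "{..<Suc k * N} = {..<k * N} \<union> {k * N..<k * N + N}"
      by auto
    have "(\<Prod>j<Suc k * N. f j) = (\<Prod>j<k * N. f j) * (\<Prod>j\<in>{k * N..<k * N + N}. f j)"
      unfolding ivl by (rule prod.union_disjoint) auto
    also have "\<dots> \<le> (1 / real q) ^ k * (1 / real q)"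
      using Suc block f by (intro mult_mono) (auto intro!: prod_nonneg)
    finally show ?case
      by (simp add: mult.commute)
  qed simp
  have "absv (kernel_tail m n z) = (\<Prod>j<m. f j)"
    by (simp add: kernel_tail_def absv_prod f_def)
  also have "\<dots> = (\<Prod>j<m div N * N. f j) * (\<Prod>j\<in>{m div N * N..<m}. f j)"
    unfolding lessThan_atLeast0
    by (rule prod.atLeastLessThan_concat [symmetric]) (simp_all add: div_times_less_eq_dividend)
  also have "\<dots> \<le> (1 / real q) ^ (m div N) * 1"
    using blocks f by (intro mult_mono prod_le_1 prod_nonneg) auto
  finally show ?thesis
    by simp
qed

definition H_factor :: 'c where
  "H_factor = (theta S - eta S) / (theta S - etac S 1)"

lemma H_factor_neq_0: "H_factor \<noteq> 0"
  by (simp add: H_factor_def)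

text \<open>The factor \<open>t - \<eta>^(1)\<close> of the kernel cancels the extra denominator of
  \<open>E_coeff\<close>, and the prefactor of \<open>H\<close> removes the remaining
  constant.\<close>

lemma E_coeff_G_coeff: "H_factor * (E_coeff n * (th n - etac S 1) * U ^ q ^ n) = G_coeff U n"
  by (simp add: H_factor_def E_coeff_eq G_coeff_def node_weight_def)

text \<open>Only finitely many kernel terms are combined, so the sums over \<open>k\<close> and
  \<open>n\<close> are exchanged without a double series; the truncation error sits in
  \<open>kernel_tail\<close>.\<close>

lemma H_partial_sums:
  assumes z: "z \<in> Dom S"
  shows "(\<lambda>n. G_term S U n z * (1 - kernel_tail m n z)) sums (H_factor * (\<Sum>k<m. H_term S U k z))"
proof -
  have "(\<lambda>n. H_factor * (\<Sum>k<m. kernel_z S k z * (E_coeff n * kernel_val k n * U ^ q ^ n))) sums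
      (H_factor * (\<Sum>k<m. kernel_z S k z * exp_act S (kernel_t S k) U))"
    by (intro sums_times_left sums_finite_sum exp_act_kernel)
  also have "(\<lambda>n. H_factor * (\<Sum>k<m. kernel_z S k z * (E_coeff n * kernel_val k n * U ^ q ^ n))) =
      (\<lambda>n. G_term S U n z * (1 - kernel_tail m n z))"
  proof
    fix n
    have "H_factor * (\<Sum>k<m. kernel_z S k z * (E_coeff n * kernel_val k n * U ^ q ^ n)) =
        H_factor * (E_coeff n * (th n - etac S 1) * U ^ q ^ n) *
        (\<Sum>k<m. kernel_z S k z * (\<Prod>j<k. th n - etac S (- int j)))"
      by (simp add: kernel_val_def sum_distrib_left mult_ac)
    then show "H_factor * (\<Sum>k<m. kernel_z S k z * (E_coeff n * kernel_val k n * U ^ q ^ n)) =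
        G_term S U n z * (1 - kernel_tail m n z)"
      unfolding E_coeff_G_coeff kernel_telescope[OF z] G_term_coeff[OF z] by (simp add: mult.assoc)
  qed
  finally show ?thesis
    by (simp add: H_term_def mult.commute)
qed

lemma G_coeff_bounded:
  obtains M where "0 < M" "\<And>n. absv (G_coeff U n) \<le> M"
proof -
  have "Bseq (\<lambda>n. absv (G_coeff U n))"
    by (rule convergent_imp_Bseq[OF convergentI[OF G_coeff_tendsto_0]])
  then show thesis
    using that by (auto simp: Bseq_def)
qed

lemma div_N_tendsto_0: "(\<lambda>m. (1 / real q) ^ (m div N)) \<longlonglongrightarrow> 0"
proof (rule LIMSEQ_I)
  fix e :: real assume "0 < e"
  have "(\<lambda>m. (1 / real q) ^ m) \<longlonglongrightarrow> 0"
    using real_q_gt_1 by (intro LIMSEQ_power_zero) auto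
  from LIMSEQ_D[OF this \<open>0 < e\<close>] obtain k where k: "\<And>m. k \<le> m \<Longrightarrow> norm ((1 / real q) ^ m - 0) < e"
    by blast
  show "\<exists>n0. \<forall>m\<ge>n0. norm ((1 / real q) ^ (m div N) - 0) < e"
  proof (intro exI allI impI)
    fix m assume "k * N \<le> m"
    then have "k \<le> m div N"
      by (simp add: less_eq_div_iff_mult_less_eq)
    then show "norm ((1 / real q) ^ (m div N) - 0) < e"
      by (rule k)
  qed
qed

lemma H_partial_uniform: "uniform_limit (Dom S) (\<lambda>m z. H_factor * (\<Sum>k<m. H_term S U k z)) (G_fun S U) sequentially"
proof (rule uniform_limitI)
  fix e :: real assume e: "0 < e"
  obtain M where M: "0 < M" "\<And>n. absv (G_coeff U n) \<le> M"
    using G_coeff_bounded[of U] by blast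
  have "(\<lambda>m. M * (1 / real q) ^ (m div N)) \<longlonglongrightarrow> M * 0"
    by (intro tendsto_intros div_N_tendsto_0)
  then have "\<forall>\<^sub>F m in sequentially. M * (1 / real q) ^ (m div N) < e"
    using order_tendstoD(2)[of _ "M * 0" sequentially e] e by simp
  then show "\<forall>\<^sub>F m in sequentially. \<forall>z\<in>Dom S. dist (H_factor * (\<Sum>k<m. H_term S U k z)) (G_fun S U z) < e"
  proof (eventually_elim, intro ballI)
    fix m z assume m: "M * (1 / real q) ^ (m div N) < e" and z: "z \<in> Dom S"
    have "(\<lambda>n. G_term S U n z - G_term S U n z * (1 - kernel_tail m n z)) sums
        (G_fun S U z - H_factor * (\<Sum>k<m. H_term S U k z))"
      by (intro sums_minus_diff G_sums H_partial_sums z)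
    then have "absv (G_fun S U z - H_factor * (\<Sum>k<m. H_term S U k z)) \<le> M * (1 / real q) ^ (m div N)"
    proof (rule sums_absv_le)
      fix n
      have "absv (G_term S U n z) * absv (kernel_tail m n z) \<le> M * (1 / real q) ^ (m div N)"
        using absv_G_term_le[OF z, of U n] M absv_kernel_tail_le[OF z]
        by (intro mult_mono) (auto intro: order_trans)
      then show "absv (G_term S U n z - G_term S U n z * (1 - kernel_tail m n z)) \<le> M * (1 / real q) ^ (m div N)"
        by (simp add: algebra_simps flip: absv_times)
    qed
    then show "dist (H_factor * (\<Sum>k<m. H_term S U k z)) (G_fun S U z) < e"
      using m by (simp add: dist_conv_absv absv_minus_commute)
  qed
qed

lemma G_eq_H:
  assumes "z \<in> Dom S"
  shows "G_fun S U z = H_fun S U z"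
proof -
  have "(\<lambda>m. H_factor * (\<Sum>k<m. H_term S U k z)) \<longlonglongrightarrow> G_fun S U z"
    using H_partial_uniform assms by (rule tendsto_uniform_limitI)
  then have "(\<lambda>m. inverse H_factor * (H_factor * (\<Sum>k<m. H_term S U k z))) \<longlonglongrightarrow> inverse H_factor * G_fun S U z"
    by (rule tendsto_times_left)
  then have "(\<lambda>k. H_term S U k z) sums (inverse H_factor * G_fun S U z)"
    using H_factor_neq_0 by (simp add: sums_def flip: mult.assoc)
  then have "(\<Sum>k. H_term S U k z) = inverse H_factor * G_fun S U z"
    by (simp add: sums_iff)
  then show ?thesis
    using H_factor_neq_0 by (simp add: H_fun_def flip: H_factor_def mult.assoc)
qed

lemma uniform_limit_Dom_cong:
  "uniform_limit (Dom S) u g sequentially \<Longrightarrow> (\<And>z. z \<in> Dom S \<Longrightarrow> g z = h z) \<Longrightarrow>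
    uniform_limit (Dom S) u h sequentially"
  by (simp add: uniform_limit_iff)

lemma H_tate_limit:
  "tate_limit S (\<lambda>m z. (theta S - eta S) / (theta S - etac S 1) * (\<Sum>k<m. H_term S U k z)) (H_fun S U)"
  unfolding tate_limit_def H_factor_def [symmetric]
  using tate_cong[OF G_in_tate G_eq_H] uniform_limit_Dom_cong[OF H_partial_uniform G_eq_H] by blast


subsection \<open>The Anderson--Thakur function\<close>

lemma omega_factor_eq:
  assumes "z \<noteq> etac S (int k)" "z \<noteq> th k"
  shows "omega_factor S k z = (z - etac S (int k)) / (z - th k)"
proof -
  define a b where "a = th k - etac S (int k)" and "b = z - etac S (int k)"
  have nz: "a \<noteq> 0" "b \<noteq> 0" "b - a \<noteq> 0"
    using assms by (auto simp: a_def b_def)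
  have "Thc S 0 ^ q ^ k = 1 / a"
    by (simp add: Thc_0 power_divide a_def th_minus_etac)
  then have "omega_factor S k z = (1 / a) / (1 / a - 1 / b)"
    by (simp add: omega_factor_def b_def)
  also have "\<dots> = b / (b - a)"
    using nz by (simp add: diff_frac_eq)
  finally show ?thesis
    by (simp add: a_def b_def)
qed

lemma pi_factor_eq_omega_factor: "pi_factor S k = omega_factor S k (theta S)"
  by (simp add: pi_factor_def omega_factor_def Thc_def)

lemma pi_factor_Suc:
  "pi_factor S (Suc k) = (theta S - etac S (int (Suc k))) / (theta S - th (Suc k))"
  unfolding pi_factor_eq_omega_factor
  using th_neq_th[of 0 "Suc k"] by (intro omega_factor_eq) auto

lemma absv_pi_factor: "absv (pi_factor S (Suc k)) = 1"
  using absv_th_minus_th[of 0 "Suc k"] theta_neq_etac(1)[of "int (Suc k)"]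
  unfolding pi_factor_Suc absv_divide by (simp del: power_Suc)

lemma absv_pi_factor_minus_1: "absv (pi_factor S (Suc k) - 1) \<le> real q * rad (Suc k)"
proof -
  have nz: "theta S - th (Suc k) \<noteq> 0"
    using th_neq_th[of 0 "Suc k"] by simp
  then have "pi_factor S (Suc k) - 1 = (th (Suc k) - etac S (int (Suc k))) / (theta S - th (Suc k))"
    unfolding pi_factor_Suc by (simp add: divide_simps)
  then have "absv (pi_factor S (Suc k) - 1) = rad (Suc k) / absv (theta S - etac S (int (Suc k)))"
    using absv_th_minus_th[of 0 "Suc k"] by (simp only: absv_divide absv_th_minus_etac_self) simp
  \<comment> \<open>The factor \<open>q\<close> is necessary when \<open>N\<close> divides
    \<open>Suc k\<close>: the conjugate is then \<eta>, at distance only \<open>1/q\<close> from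
    \<theta>.\<close>
  also have "\<dots> \<le> rad (Suc k) / (1 / real q)"
    using absv_th_minus_etac_ge[of 0 "int (Suc k)"] q_ge_2
    by (intro divide_left_mono mult_pos_pos) (auto simp: rad_0)
  finally show ?thesis
    by (simp add: mult.commute)
qed

definition pi_partial :: "nat \<Rightarrow> 'c" where
  "pi_partial m = (\<Prod>k<m. pi_factor S (Suc k))"

definition pi_limit :: 'c where
  "pi_limit = (\<Prod>k. pi_factor S (Suc k))"

lemma pi_has_prod: "(\<lambda>k. pi_factor S (Suc k)) has_prod pi_limit"
  and pi_partial_tendsto: "pi_partial \<longlonglongrightarrow> pi_limit"
proof -
  have "(\<lambda>k. real q * rad (Suc k)) \<longlonglongrightarrow> real q * 0"
    by (intro tendsto_intros LIMSEQ_Suc rad_tendsto_0)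
  then have 0: "(\<lambda>k. real q * rad (Suc k)) \<longlonglongrightarrow> 0"
    by simp
  have "absv (pi_factor S (Suc k)) \<le> 1" for k
    by (simp only: absv_pi_factor)
  then obtain L where "(\<lambda>m. \<Prod>k<m. pi_factor S (Suc k)) \<longlonglongrightarrow> L"
    by (rule prod_minus_one_le[OF _ absv_pi_factor_minus_1 0])
  then have L: "pi_partial \<longlonglongrightarrow> L"
    unfolding pi_partial_def [abs_def] .
  then have L_prod: "(\<lambda>k. pi_factor S (Suc k)) has_prod L"
    unfolding pi_partial_def [abs_def] by (intro has_prod_unit_factors absv_pi_factor)
  have "pi_limit = L"
    unfolding pi_limit_def by (rule has_prod_unique[OF L_prod, symmetric])
  with L L_prod show "(\<lambda>k. pi_factor S (Suc k)) has_prod pi_limit" "pi_partial \<longlonglongrightarrow> pi_limit"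
    by simp_all
qed

lemma absv_pi_partial: "absv (pi_partial m) = 1"
  unfolding pi_partial_def absv_prod absv_pi_factor by simp

lemma absv_pi_limit: "absv pi_limit = 1"
  using LIMSEQ_unique[OF tendsto_absv[OF pi_partial_tendsto]] by (simp add: absv_pi_partial)

lemma absv_omega_factor:
  assumes "z \<in> Dom S"
  shows "absv (omega_factor S k z) = 1" "absv (omega_factor S k z - 1) \<le> rad k"
proof -
  have nz: "z \<noteq> etac S (int k)" "z \<noteq> th k"
    using Dom_neq_etac[OF assms] Dom_neq_th[OF assms] by auto
  have ge: "1 \<le> absv (z - etac S (int k))"
    by (rule absv_Dom_minus_etac[OF assms])
  show "absv (omega_factor S k z) = 1"
    using ge nz by (simp add: omega_factor_eq[OF nz] absv_divide absv_Dom_minus_th[OF assms])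
  have "omega_factor S k z - 1 = (th k - etac S (int k)) / (z - th k)"
    using nz by (simp add: omega_factor_eq divide_simps)
  then have "absv (omega_factor S k z - 1) = rad k / absv (z - etac S (int k))"
    by (simp only: absv_divide absv_th_minus_etac_self absv_Dom_minus_th[OF assms])
  also have "\<dots> \<le> rad k / 1"
    using ge by (intro divide_left_mono) auto
  finally show "absv (omega_factor S k z - 1) \<le> rad k"
    by simp
qed

lemma omega_partial:
  assumes z: "z \<in> Dom S"
  shows "(\<lambda>m. root_om S * (\<Prod>k<m. omega_factor S k z)) \<longlonglongrightarrow> omega S z"
    and "absv (root_om S * (\<Prod>k<m. omega_factor S k z) - omega S z) \<le> absv (root_om S) * rad m"
proof -
  obtain L where L: "(\<lambda>m. \<Prod>k<m. omega_factor S k z) \<longlonglongrightarrow> L"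
    "\<And>m B. 0 \<le> B \<Longrightarrow> (\<And>k. k \<ge> m \<Longrightarrow> rad k \<le> B) \<Longrightarrow> absv ((\<Prod>k<m. omega_factor S k z) - L) \<le> B"
    using prod_minus_one_le[of "\<lambda>k. omega_factor S k z", OF _ absv_omega_factor(2)[OF z] rad_tendsto_0]
    by (auto simp: absv_omega_factor(1)[OF z])
  have "(\<lambda>k. omega_factor S k z) has_prod L"
    by (rule has_prod_unit_factors[OF absv_omega_factor(1)[OF z] L(1)])
  from has_prod_unique[OF this] have omega: "omega S z = root_om S * L"
    by (simp add: omega_def)
  show "(\<lambda>m. root_om S * (\<Prod>k<m. omega_factor S k z)) \<longlonglongrightarrow> omega S z"
    unfolding omega by (rule tendsto_times_left[OF L(1)])
  have "absv ((\<Prod>k<m. omega_factor S k z) - L) \<le> rad m"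
    using L(2) rad_mono by auto
  then show "absv (root_om S * (\<Prod>k<m. omega_factor S k z) - omega S z) \<le> absv (root_om S) * rad m"
    unfolding omega by (simp add: absv_times mult_left_mono flip: right_diff_distrib)
qed

text \<open>Residue at \<open>th n\<close> of the product of the factors with index up to
  \<open>n\<close>, divided by \<open>th n - eta S\<close>, the residue of
  \<open>pole_ratio n\<close>.\<close>

definition residue_weight :: "nat \<Rightarrow> 'c" where
  "residue_weight n = (th n - etac S (int n)) / (th n - eta S) *
     (\<Prod>k<n. (th n - etac S (int k)) / (th n - th k))"

lemma pi_factor_power:
  "pi_factor S (Suc k) ^ q ^ n = (th n - etac S (int (n + Suc k))) / (th n - th (n + Suc k))"
proof -
  have "th (Suc k) ^ q ^ n = th (n + Suc k)"
    by (metis add.commute power_q_add)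
  then show ?thesis
    by (simp add: pi_factor_Suc power_divide frob_diff etac_power ac_simps del: power_Suc)
qed

text \<open>
  In the residue at the \<open>n\<close>-th node, the later nodes contribute a Frobenius twist of the partial
  product for the period.
\<close>

lemma omega_partial_fractions:
  assumes "\<And>n. n < Suc m \<Longrightarrow> z \<noteq> th n"
  shows "(\<Prod>k<Suc m. (z - etac S (int k)) / (z - th k)) =
     (\<Sum>n<Suc m. residue_weight n * pi_partial (m - n) ^ q ^ n * pole_ratio n z)"
  using assms
proof (induction m arbitrary: z)
  case 0
  then show ?case
    by (simp add: residue_weight_def pi_partial_def pole_ratio_def)
next
  case (Suc m)
  let ?M = "Suc m"
  define c where "c n = residue_weight n * pi_partial (m - n) ^ q ^ n" for n
  define P where "P z = (\<Prod>k<?M. (z - etac S (int k)) / (z - th k))" for z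
  have IH: "P x = (\<Sum>n<?M. c n * pole_ratio n x)" if "\<And>n. n < ?M \<Longrightarrow> x \<noteq> th n" for x
    unfolding P_def c_def by (rule Suc.IH[OF that])
  have zM: "z - th ?M \<noteq> 0" and zn: "\<And>n. n < ?M \<Longrightarrow> z - th n \<noteq> 0"
    unfolding right_minus_eq by (rule Suc.prems, simp)+
  have Mn: "th ?M - th n \<noteq> 0" "th n - th ?M \<noteq> 0" if "n < ?M" for n
    using that th_neq_th[of ?M n] by auto
  \<comment> \<open>Multiplication by the new factor splits each old pole into itself and the new
    node; the contributions at the new node add up to the previous product evaluated there.\<close>
  have step: "c n * pole_ratio n z * ((z - etac S (int ?M)) / (z - th ?M)) =
      residue_weight n * pi_partial (?M - n) ^ q ^ n * pole_ratio n z +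
      (th ?M - etac S (int ?M)) / (th ?M - eta S) * (c n * pole_ratio n (th ?M)) * pole_ratio ?M z"
    if n: "n < ?M" for n
  proof -
    have "?M - n = Suc (m - n)"
      using n by simp
    then have "pi_partial (?M - n) ^ q ^ n =
        pi_partial (m - n) ^ q ^ n * ((th n - etac S (int ?M)) / (th n - th ?M))"
      using n by (simp add: pi_partial_def power_mult_distrib pi_factor_power)
    then have c': "residue_weight n * pi_partial (?M - n) ^ q ^ n =
        c n * ((th n - etac S (int ?M)) / (th n - th ?M))"
      by (simp add: c_def)
    define a b e where "a = z - th n" and "b = z - th ?M" and "e = th ?M - etac S (int ?M)"
    have nz: "a \<noteq> 0" "b \<noteq> 0" "a - b \<noteq> 0"
      using zM zn[OF n] Mn[OF n] by (auto simp: a_def b_def)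
    have "(b + e) / (a * b) = (b - a + e) / (b - a) / a + e / (a - b) / b"
    proof -
      define d where "d = a - b"
      have "b - a = - d" "a = b + d" "d \<noteq> 0"
        using nz by (auto simp: d_def)
      then show ?thesis
        using nz by (simp add: divide_simps) (simp add: algebra_simps)
    qed
    then have "(z - etac S (int ?M)) / ((z - th n) * (z - th ?M)) =
        (th n - etac S (int ?M)) / (th n - th ?M) / (z - th n) +
        (th ?M - etac S (int ?M)) / (th ?M - th n) / (z - th ?M)"
      by (simp add: a_def b_def e_def)
    then have "c n * (z - eta S) * ((z - etac S (int ?M)) / ((z - th n) * (z - th ?M))) =
        c n * (z - eta S) * ((th n - etac S (int ?M)) / (th n - th ?M) / (z - th n) +
          (th ?M - etac S (int ?M)) / (th ?M - th n) / (z - th ?M))"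
      by (simp only:)
    moreover have "(th ?M - etac S (int ?M)) / (th ?M - eta S) * (c n * pole_ratio n (th ?M)) =
        c n * ((th ?M - etac S (int ?M)) / (th ?M - th n))"
      by (simp add: pole_ratio_def del: power_Suc)
    ultimately show ?thesis
      unfolding c' by (simp add: pole_ratio_def distrib_left mult_ac del: power_Suc)
  qed
  have P_M: "P (th ?M) = (\<Sum>n<?M. c n * pole_ratio n (th ?M))"
    by (rule IH) (simp del: power_Suc)
  have "(\<Prod>k<Suc ?M. (z - etac S (int k)) / (z - th k)) = P z * ((z - etac S (int ?M)) / (z - th ?M))"
    by (simp add: P_def del: power_Suc)
  also have "\<dots> = (\<Sum>n<?M. c n * pole_ratio n z * ((z - etac S (int ?M)) / (z - th ?M)))"
  proof -
    have "P z = (\<Sum>n<?M. c n * pole_ratio n z)"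
      by (rule IH, rule Suc.prems) simp
    then show ?thesis
      by (simp only: sum_distrib_right)
  qed
  also have "\<dots> = (\<Sum>n<?M. residue_weight n * pi_partial (?M - n) ^ q ^ n * pole_ratio n z +
      (th ?M - etac S (int ?M)) / (th ?M - eta S) * (c n * pole_ratio n (th ?M)) * pole_ratio ?M z)"
    by (intro sum.cong refl step) simp
  also have "\<dots> = (\<Sum>n<?M. residue_weight n * pi_partial (?M - n) ^ q ^ n * pole_ratio n z) +
      (th ?M - etac S (int ?M)) / (th ?M - eta S) * P (th ?M) * pole_ratio ?M z"
    unfolding P_M by (simp only: sum.distrib sum_distrib_left sum_distrib_right)
  also have "(th ?M - etac S (int ?M)) / (th ?M - eta S) * P (th ?M) = residue_weight ?M"
    by (simp add: residue_weight_def P_def del: power_Suc prod.lessThan_Suc)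
  finally show ?case
    by (simp add: pi_partial_def del: power_Suc)
qed

text \<open>As \<open>-\<Theta>\<close> is the \<open>(q-1)\<close>-th power of the root, the
  exponents add up to \<open>1 + (q-1)(1 + q + ... + q^(n-1)) = q^n\<close>.\<close>

lemma root_om_prod: "root_om S * (\<Prod>j<n. (- Thc S 0) ^ q ^ j) = root_om S ^ q ^ n"
proof (induction n)
  case (Suc n)
  have "root_om S ^ q ^ n * (- Thc S 0) ^ q ^ n = root_om S ^ q ^ n * (root_om S ^ (q - 1)) ^ q ^ n"
    by (simp only: root_om)
  also have "\<dots> = (root_om S * root_om S ^ (q - 1)) ^ q ^ n"
    by (simp add: power_mult_distrib)
  also have "root_om S * root_om S ^ (q - 1) = root_om S ^ q"
    using q_ge_2 by (simp flip: power_Suc)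
  finally show ?case
    using Suc by (simp add: mult.assoc [symmetric] power_mult)
qed simp

lemma Dn_eq_prod: "Dn S n = (\<Prod>j<n. f_val S j (th n))"
  using s_val_th[of n n] by (simp add: s_val_def)

text \<open>\<open>D_n\<close> is the product of the \<open>f^(j)\<close> at \<open>th n\<close>,
  and each of these cancels against a factor of the residue, leaving
  \<open>(-\<Theta>)^(q^j)\<close>.\<close>

lemma root_om_residue_weight:
  "root_om S * residue_weight n = root_om S ^ q ^ n * (th n - etac S (int n)) / (Dn S n * (th n - eta S))"
proof -
  have "Dn S n * (\<Prod>k<n. (th n - etac S (int k)) / (th n - th k)) = (\<Prod>j<n. (- Thc S 0) ^ q ^ j)"
    unfolding Dn_eq_prod prod.distrib [symmetric]
  proof (intro prod.cong refl)
    fix j assume "j \<in> {..<n}"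
    then have "j \<noteq> n" "j \<le> n"
      by auto
    define a b where "a = th n - etac S (int j)" and "b = th j - etac S (int j)"
    have nz: "a \<noteq> 0" "b \<noteq> 0" "a - b \<noteq> 0"
      using \<open>j \<noteq> n\<close> by (auto simp: a_def b_def)
    have "Thc S 0 ^ q ^ j = 1 / b"
      by (simp add: Thc_0 power_divide b_def th_minus_etac)
    then have "f_val S j (th n) = 1 / a - 1 / b" "(- Thc S 0) ^ q ^ j = - (1 / b)"
      by (simp_all add: f_val_def a_def frob_minus)
    moreover have "(1 / a - 1 / b) * (a / (a - b)) = - (1 / b)"
    proof -
      have "1 / a - 1 / b = - ((a - b) / (a * b))"
        using nz by (simp add: divide_simps)
      then show ?thesis
        using nz by simp
    qed
    ultimately show "f_val S j (th n) * ((th n - etac S (int j)) / (th n - th j)) = (- Thc S 0) ^ q ^ j"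
      by (simp add: a_def b_def)
  qed
  then have "root_om S * (Dn S n * (\<Prod>k<n. (th n - etac S (int k)) / (th n - th k))) = root_om S ^ q ^ n"
    by (simp add: root_om_prod)
  then have "root_om S * (\<Prod>k<n. (th n - etac S (int k)) / (th n - th k)) = root_om S ^ q ^ n / Dn S n"
    by (simp add: eq_divide_eq mult_ac)
  then have "(th n - etac S (int n)) / (th n - eta S) *
      (root_om S * (\<Prod>k<n. (th n - etac S (int k)) / (th n - th k))) =
      (th n - etac S (int n)) / (th n - eta S) * (root_om S ^ q ^ n / Dn S n)"
    by (simp only:)
  then show ?thesis
    unfolding residue_weight_def mult.left_commute[of "root_om S"] by (simp add: mult.commute)
qed

text \<open>By the compatibility of the roots, dividing by \<open>C02 S\<close> replaces
  \<open>root_pi\<close> by \<open>root_om\<close>, and \<open>\<Theta>^\<sigma>\<close> by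
  \<Theta>.\<close>

lemma pi_Phi_eq: "pi_Phi S = root_om S * pi_limit / (theta S - eta S)"
proof -
  have "root_C S \<noteq> 0"
    using C02_neq_0 by (auto simp: C02_def)
  then show ?thesis
    by (simp add: pi_Phi_def pi_tilde_def roots_compatible C02_def Thc_def pi_limit_def)
qed

lemma G_coeff_pi_Phi: "G_coeff (pi_Phi S) n = root_om S * residue_weight n * pi_limit ^ q ^ n"
proof -
  have "pi_Phi S ^ q ^ n = root_om S ^ q ^ n * pi_limit ^ q ^ n / (th n - etac S (int n))"
    by (simp add: pi_Phi_eq power_divide power_mult_distrib th_minus_etac)
  then show ?thesis
    unfolding root_om_residue_weight G_coeff_def node_weight_def by (simp add: power2_eq_square)
qed

text \<open>If \<open>n\<close> is large the first factor is small; otherwise \<open>m - n\<close>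
  is large and the second one is.\<close>

lemma null_convolution:
  fixes a d :: "nat \<Rightarrow> real"
  assumes "a \<longlonglongrightarrow> 0" "d \<longlonglongrightarrow> 0" "0 < e" "\<And>n. 0 \<le> a n" "\<And>n. 0 \<le> d n"
  obtains m0 where "\<And>m n. m0 \<le> m \<Longrightarrow> n \<le> m \<Longrightarrow> a n * d (m - n) < e"
proof -
  obtain A where A: "0 < A" "\<And>n. a n \<le> A"
    using convergent_imp_Bseq[OF convergentI[OF assms(1)]] assms(4) by (auto simp: Bseq_def)
  obtain B where B: "0 < B" "\<And>n. d n \<le> B"
    using convergent_imp_Bseq[OF convergentI[OF assms(2)]] assms(5) by (auto simp: Bseq_def)
  obtain n0 where n0: "\<And>n. n0 \<le> n \<Longrightarrow> a n < e / B"
    using order_tendstoD(2)[OF assms(1), of "e / B"] assms(3) B(1) by (auto simp: eventually_sequentially)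
  obtain j0 where j0: "\<And>j. j0 \<le> j \<Longrightarrow> d j < e / A"
    using order_tendstoD(2)[OF assms(2), of "e / A"] assms(3) A(1) by (auto simp: eventually_sequentially)
  show thesis
  proof (rule that)
    fix m n assume mn: "n0 + j0 \<le> m" "n \<le> m"
    show "a n * d (m - n) < e"
    proof (cases "n0 \<le> n")
      case True
      have "a n * d (m - n) \<le> a n * B"
        using B assms(4) by (intro mult_left_mono) auto
      also have "\<dots> < e"
        using n0[OF True] B(1) by (simp add: field_simps)
      finally show ?thesis .
    next
      case False
      have "a n * d (m - n) \<le> A * d (m - n)"
        using A assms(5) by (intro mult_right_mono) auto
      also have "\<dots> < e"
        using j0[of "m - n"] A(1) mn False by (simp add: field_simps)
      finally show ?thesis .
    qed
  qed
qed

text \<open>The finite product and the partial sum of \<open>G\<close> have the same poles; their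
  coefficients differ by replacing \<open>pi_partial (m - n)\<close> by its limit. Frobenius turns
  the difference of powers into a power of the difference, and \<open>null_convolution\<close> makes
  all terms small at once.\<close>

lemma omega_eq_G:
  assumes z: "z \<in> Dom S"
  shows "omega S z = G_fun S (pi_Phi S) z"
proof -
  define P where "P m = root_om S * (\<Prod>k<Suc m. omega_factor S k z)" for m
  define Gm where "Gm m = (\<Sum>n<Suc m. G_term S (pi_Phi S) n z)" for m
  have P_eq: "P m = (\<Sum>n<Suc m. root_om S * residue_weight n * pi_partial (m - n) ^ q ^ n * pole_ratio n z)" for m
  proof -
    have "P m = root_om S * (\<Prod>k<Suc m. (z - etac S (int k)) / (z - th k))"
      unfolding P_def using Dom_neq_etac[OF z] Dom_neq_th[OF z]
      by (intro arg_cong[of _ _ "(*) _"] prod.cong refl omega_factor_eq) auto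
    also have "\<dots> = root_om S * (\<Sum>n<Suc m. residue_weight n * pi_partial (m - n) ^ q ^ n * pole_ratio n z)"
      using Dom_neq_th[OF z] by (subst omega_partial_fractions) auto
    finally show ?thesis
      by (simp add: sum_distrib_left mult.assoc del: sum.lessThan_Suc)
  qed
  have G_eq: "Gm m = (\<Sum>n<Suc m. root_om S * residue_weight n * pi_limit ^ q ^ n * pole_ratio n z)" for m
    unfolding Gm_def by (intro sum.cong refl) (simp add: G_term_coeff[OF z] G_coeff_pi_Phi)
  have diff: "P m - Gm m = (\<Sum>n<Suc m. root_om S * residue_weight n * (pi_partial (m - n) - pi_limit) ^ q ^ n * pole_ratio n z)" for m
    unfolding P_eq G_eq sum_subtractf [symmetric]
    by (intro sum.cong refl) (simp add: frob_diff algebra_simps)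
  define a where "a n = absv (root_om S * residue_weight n)" for n
  define d where "d j = absv (pi_partial j - pi_limit)" for j
  \<comment> \<open>Since \<open>pi_limit\<close> has absolute value 1, the weights have the size of
    the coefficients of \<open>G\<close> at the period.\<close>
  have a: "a \<longlonglongrightarrow> 0"
  proof -
    have "a n = absv (G_coeff (pi_Phi S) n)" for n
      by (simp add: a_def G_coeff_pi_Phi absv_times absv_power absv_pi_limit)
    then show ?thesis
      using G_coeff_tendsto_0[of "pi_Phi S"] by (simp add: a_def[abs_def])
  qed
  have d: "d \<longlonglongrightarrow> 0"
    using pi_partial_tendsto unfolding d_def[abs_def] tendsto_iff_absv[of pi_partial] .
  have d1: "d j \<le> 1" for j
    unfolding d_def by (rule absv_diff_le) (simp_all add: absv_pi_partial absv_pi_limit)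
  have term_le: "absv (root_om S * residue_weight n * (pi_partial (m - n) - pi_limit) ^ q ^ n * pole_ratio n z)
      \<le> a n * d (m - n)" for m n
  proof -
    have "d (m - n) ^ q ^ n \<le> d (m - n) ^ 1"
      using d1 by (intro power_decreasing) (auto simp: d_def Suc_le_eq)
    then have "a n * d (m - n) ^ q ^ n * absv (pole_ratio n z) \<le> a n * d (m - n) * 1"
      using absv_pole_ratio_le_1[OF z] by (intro mult_mono) (auto simp: a_def d_def)
    then show ?thesis
      by (simp add: a_def d_def absv_times absv_power)
  qed
  have "(\<lambda>m. absv (P m - Gm m)) \<longlonglongrightarrow> 0"
  proof (rule LIMSEQ_I)
    fix e :: real assume e: "0 < e"
    obtain m0 where m0: "\<And>m n. m0 \<le> m \<Longrightarrow> n \<le> m \<Longrightarrow> a n * d (m - n) < e"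
      using null_convolution[OF a d e] by (auto simp: a_def d_def)
    show "\<exists>m0. \<forall>m\<ge>m0. norm (absv (P m - Gm m) - 0) < e"
    proof (intro exI allI impI)
      fix m assume "m0 \<le> m"
      then have "absv (P m - Gm m) < e"
        unfolding diff using e by (intro absv_sum_less le_less_trans[OF term_le] m0) auto
      then show "norm (absv (P m - Gm m) - 0) < e"
        by simp
    qed
  qed
  then have "(\<lambda>m. P m - Gm m) \<longlonglongrightarrow> 0"
    by (simp add: tendsto_iff_absv)
  moreover have "(\<lambda>m. P m - Gm m) \<longlonglongrightarrow> omega S z - G_fun S (pi_Phi S) z"
    unfolding P_def Gm_def
    using LIMSEQ_Suc[OF omega_partial(1)[OF z]] LIMSEQ_Suc[OF G_sums[OF z, unfolded sums_def]]
    by (rule tendsto_minus_diff)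
  ultimately show ?thesis
    using LIMSEQ_unique by fastforce
qed

lemma omega_tate_limit:
  "tate_limit S (\<lambda>m z. root_om S * (\<Prod>k<m. omega_factor S k z)) (omega S)"
  unfolding tate_limit_def
proof
  show "omega S \<in> tate S"
    by (rule tate_cong[OF G_in_tate[of "pi_Phi S"]]) (simp add: omega_eq_G)
  show "uniform_limit (Dom S) (\<lambda>m z. root_om S * (\<Prod>k<m. omega_factor S k z)) (omega S) sequentially"
  proof (rule uniform_limitI)
    fix e :: real assume e: "0 < e"
    have "(\<lambda>m. absv (root_om S) * rad m) \<longlonglongrightarrow> absv (root_om S) * 0"
      by (intro tendsto_intros rad_tendsto_0)
    then have "\<forall>\<^sub>F m in sequentially. absv (root_om S) * rad m < e"
      using order_tendstoD(2)[of _ "absv (root_om S) * 0" sequentially e] e by simp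
    then show "\<forall>\<^sub>F m in sequentially. \<forall>z\<in>Dom S. dist (root_om S * (\<Prod>k<m. omega_factor S k z)) (omega S z) < e"
      by eventually_elim (auto simp: dist_conv_absv intro: le_less_trans[OF omega_partial(2)])
  qed
qed


subsection \<open>The deformed logarithm\<close>

text \<open>The absolute value of \<open>root_om S\<close>; the period then has absolute value
  \<open>q * radix\<close>.\<close>

definition radix :: real where
  "radix = real q powr (1 / (real q - 1))"

lemma radix_pos: "0 < radix"
  using real_q_gt_1 by (simp add: radix_def)

lemma radix_power_q: "radix ^ q = real q * radix"
proof -
  have "radix ^ q = real q powr (1 / (real q - 1) * real q)"
    using radix_pos by (simp add: radix_def powr_powr flip: powr_realpow)
  also have "1 / (real q - 1) * real q = 1 + 1 / (real q - 1)"
    using real_q_gt_1 by (simp add: field_simps)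
  also have "real q powr (1 + 1 / (real q - 1)) = real q * radix"
    using real_q_gt_1 by (simp add: powr_add radix_def)
  finally show ?thesis .
qed

lemma period_radius: "real q powr (real q / (real q - 1)) = real q * radix"
proof -
  have "real q / (real q - 1) = 1 + 1 / (real q - 1)"
    using real_q_gt_1 by (simp add: field_simps)
  then show ?thesis
    using real_q_gt_1 by (simp add: powr_add radix_def)
qed

text \<open>Induction with \<open>radix^q = q * radix\<close>, every multiplier \<open>Xn\<close>
  having absolute value at least \<open>q\<close>.\<close>

lemma absv_Dn_ge_radix: "radix ^ q ^ n \<le> absv (Dn S n) * radix"
proof (induction n)
  case (Suc n)
  have "radix ^ q ^ Suc n = (radix ^ q ^ n) ^ q"
    by (simp add: mult.commute flip: power_mult)
  also have "\<dots> \<le> (absv (Dn S n) * radix) ^ q"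
    using Suc radix_pos by (intro power_mono) auto
  also have "\<dots> = absv (Dn S n) ^ q * real q * radix"
    by (simp add: power_mult_distrib radix_power_q)
  also have "\<dots> \<le> absv (Dn S n) ^ q * absv (Xn (Suc n)) * radix"
    using absv_Xn_ge[of "Suc n"] radix_pos by (intro mult_right_mono mult_left_mono) auto
  also have "\<dots> = absv (Dn S (Suc n)) * radix"
    by (simp only: Dn_Suc_Xn absv_times absv_power)
  finally show ?case .
qed simp

text \<open>The factor \<open>rad n\<close> supplied by \<open>node_weight\<close> enlarges the
  relevant radius from \<open>radix\<close> to \<open>q * radix\<close>.\<close>

lemma rad_power_div_Dn_le:
  "absv (U::'c) ^ q ^ n * rad n / absv (Dn S n) \<le> radix * (absv U / (real q * radix)) ^ q ^ n"
proof -
  have "absv U ^ q ^ n * rad n / absv (Dn S n) \<le> absv U ^ q ^ n * rad n / (radix ^ q ^ n / radix)"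
    using absv_Dn_ge_radix[of n] radix_pos
    by (intro divide_left_mono mult_nonneg_nonneg mult_pos_pos zero_le_power) (auto simp: field_simps)
  also have "\<dots> = radix * (absv U / (real q * radix)) ^ q ^ n"
    using radix_pos q_ge_2 by (simp add: rad_def power_divide power_mult_distrib field_simps)
  finally show ?thesis .
qed

lemma power_q_power_le: "0 \<le> (x::real) \<Longrightarrow> x \<le> 1 \<Longrightarrow> x ^ q ^ n \<le> x"
  using power_decreasing[of 1 "q ^ n" x] by (simp add: Suc_le_eq)

lemma prod_rad_radix: "radix * (\<Prod>i<n. 1 / rad i) = radix ^ q ^ n"
proof (induction n)
  case (Suc n)
  have "radix * (\<Prod>i<Suc n. 1 / rad i) = radix ^ q ^ n * real q ^ q ^ n"
    using Suc by (simp add: rad_def power_divide mult.assoc [symmetric])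
  also have "\<dots> = (radix ^ q) ^ q ^ n"
    by (simp add: radix_power_q power_mult_distrib)
  finally show ?case
    by (simp add: power_mult)
qed simp

lemma absv_f_val:
  assumes z: "z \<in> Dom S"
  shows "absv (f_val S i z) = 1 / rad i"
proof -
  have "absv (Thc S 0 ^ q ^ i) = 1 / rad i"
    by (simp add: Thc_0 absv_power absv_divide uniformizer rad_def power_divide)
  moreover have "absv (1 / (z - etac S (int i))) < 1 / rad i"
    by (rule le_less_trans[OF absv_inverse_diff_le_1[OF z]]) simp
  ultimately have "absv (Thc S 0 ^ q ^ i - 1 / (z - etac S (int i))) = 1 / rad i"
    using absv_add_eq[of "- (1 / (z - etac S (int i)))" "Thc S 0 ^ q ^ i"] by simp
  then show ?thesis
    unfolding f_val_def by (subst absv_minus_commute)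
qed

lemma f_val_Dom_neq_0: "z \<in> Dom S \<Longrightarrow> f_val S i z \<noteq> 0"
  using absv_f_val[of z i] by force

context
  fixes U :: 'c and \<kappa> :: real
  assumes U: "absv U < real q powr (real q / (real q - 1))"
  defines "\<kappa> \<equiv> absv U / (real q * radix)"
begin

text \<open>\<kappa> is the size of \<open>U\<close> relative to the period.\<close>

lemma kappa: "0 \<le> \<kappa>" "\<kappa> < 1" "absv U = real q * radix * \<kappa>"
  using U radix_pos q_ge_2 unfolding period_radius \<kappa>_def by (auto simp: field_simps)

lemma absv_G_fun_le:
  assumes z: "z \<in> Dom S"
  shows "absv (G_fun S U z) \<le> radix * \<kappa>"
proof (rule sums_absv_le[OF G_sums[OF z]])
  fix n
  have "absv (G_coeff U n) \<le> absv U ^ q ^ n * rad n / absv (Dn S n)"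
    using absv_node_weight_le[of n]
    by (simp add: G_coeff_def absv_times absv_divide absv_power divide_right_mono mult_left_mono)
  also have "\<dots> \<le> radix * \<kappa> ^ q ^ n"
    unfolding \<kappa>_def by (rule rad_power_div_Dn_le)
  also have "\<dots> \<le> radix * \<kappa>"
    using kappa radix_pos by (intro mult_left_mono power_q_power_le) auto
  finally show "absv (G_term S U n z) \<le> radix * \<kappa>"
    using absv_G_term_le[OF z] order_trans by blast
qed

text \<open>
  Iterating \<open>G = (G\<^sup>(\<^sup>1\<^sup>) - \<xi>)/f\<close>, where \<open>G\<^sup>(\<^sup>n\<^sup>)(z) = G(y)\<^bsup>q\<^sup>n\<^esup>\<close> for \<open>y\<^bsup>q\<^sup>n\<^esup> = z\<close>, produces the partial sums of the
  logarithm with a remainder that is small because \<open>|G| < q\<^bsup>1/(q-1)\<^esup>\<close>.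
\<close>

lemma Log_partial:
  assumes "y \<in> Dom S"
  shows "f_val S 0 (y ^ q ^ n) * (G_fun S U y ^ q ^ n / (\<Prod>i<n. f_val S i (y ^ q ^ n)) - G_fun S U (y ^ q ^ n)) =
    (\<Sum>k<n. Log_term S (E_fun U) k (y ^ q ^ n))"
  using assms
proof (induction n arbitrary: y)
  case (Suc n)
  define x where "x = y ^ q"
  define z where "z = x ^ q ^ n"
  have x: "x \<in> Dom S"
    using Suc.prems Dom_frob by (simp add: x_def)
  have z_eq: "y ^ q ^ Suc n = z"
    by (simp add: z_def x_def power_mult)
  have z: "z \<in> Dom S"
    unfolding z_def
  proof (induction n)
    case (Suc n)
    then show ?case
      unfolding power_q_Suc by (simp only: Dom_frob)
  qed (simp add: x)
  have f_nz: "f_val S i z \<noteq> 0" for i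
    using f_val_Dom_neq_0[OF z] .
  \<comment> \<open>Frobenius twists the coefficients of \<open>f\<close> and moves the argument
    from \<open>x\<close> to \<open>z\<close>, so earlier twists accumulate in the denominator at
    the fixed point \<open>z\<close>.\<close>
  have f_frob: "f_val S 0 x ^ q ^ n = f_val S n z"
    by (simp add: f_val_def frob_diff power_divide etac_nat z_def)
  have "G_fun S U y ^ q ^ Suc n = (G_fun S U y ^ q) ^ q ^ n"
    by (simp add: power_mult)
  also have "\<dots> = f_val S n z * G_fun S U x ^ q ^ n + E_fun U ^ q ^ n"
    unfolding G_frobenius_equation[OF Suc.prems] x_def [symmetric] frob_add power_mult_distrib f_frob ..
  finally have "G_fun S U y ^ q ^ Suc n / (\<Prod>i<Suc n. f_val S i z) =
      G_fun S U x ^ q ^ n / (\<Prod>i<n. f_val S i z) + E_fun U ^ q ^ n / (\<Prod>i<Suc n. f_val S i z)"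
    using f_nz by (simp add: add_divide_distrib)
  moreover have "f_val S 0 z * (E_fun U ^ q ^ n / (\<Prod>i<Suc n. f_val S i z)) = Log_term S (E_fun U) n z"
  proof -
    have "(\<Prod>i<Suc n. f_val S i z) = f_val S 0 z * (\<Prod>i=1..n. f_val S i z)"
      using prod.atLeast_Suc_atMost[of 0 n "\<lambda>i. f_val S i z"]
      by (simp only: lessThan_Suc_atMost atLeast0AtMost [symmetric]) simp
    then show ?thesis
      using f_nz by (simp add: Log_term_def del: prod.lessThan_Suc)
  qed
  ultimately show ?case
    using Suc.IH[OF x] unfolding z_eq z_def [symmetric] sum.lessThan_Suc
    by (simp add: distrib_left algebra_simps del: prod.lessThan_Suc)
qed simp

text \<open>After \<open>n\<close> iterations the remainder is \<open>f(z) G(y)^(q^n)\<close> over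
  \<open>f^(0) ... f^(n-1)\<close> at \<open>z\<close>. The denominator has size
  \<open>radix^(q^n - 1)\<close>, so the powers of \<open>radix\<close> nearly cancel and
  \<open>\<kappa>^(q^n)\<close> remains.\<close>

lemma Log_remainder:
  assumes z: "z \<in> Dom S"
  shows "absv ((\<Sum>k<n. Log_term S (E_fun U) k z) + f_val S 0 z * G_fun S U z) \<le> real q * radix * \<kappa> ^ n"
proof -
  obtain y where y: "y ^ q ^ n = z"
    using frob_root_exists by blast
  have "y \<in> Dom S"
    using z unfolding y [symmetric]
  proof (induction n)
    case (Suc n)
    then show ?case
      unfolding power_q_Suc by (simp only: Dom_frob)
  qed simp
  have "(\<Sum>k<n. Log_term S (E_fun U) k z) + f_val S 0 z * G_fun S U z =
      f_val S 0 z * (G_fun S U y ^ q ^ n / (\<Prod>i<n. f_val S i z))"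
    using Log_partial[OF \<open>y \<in> Dom S\<close>, of n] by (simp add: y algebra_simps)
  then have "absv ((\<Sum>k<n. Log_term S (E_fun U) k z) + f_val S 0 z * G_fun S U z) =
      real q * (absv (G_fun S U y) ^ q ^ n / (\<Prod>i<n. 1 / rad i))"
    by (simp add: absv_times absv_divide absv_power absv_prod absv_f_val[OF z] rad_0)
  also have "\<dots> \<le> real q * ((radix * \<kappa>) ^ q ^ n / (\<Prod>i<n. 1 / rad i))"
    using absv_G_fun_le[OF \<open>y \<in> Dom S\<close>]
    by (intro mult_left_mono divide_right_mono power_mono prod_nonneg) auto
  also have "\<dots> = real q * radix * \<kappa> ^ q ^ n"
  proof -
    have "(\<Prod>i<n. 1 / rad i) = radix ^ q ^ n / radix"
      using prod_rad_radix[of n] radix_pos by (simp add: field_simps)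
    then show ?thesis
      using radix_pos by (simp add: power_mult_distrib)
  qed
  also have "\<dots> \<le> real q * radix * \<kappa> ^ n"
    using kappa radix_pos q_power_gt[of n]
    by (intro mult_left_mono power_decreasing) (auto intro: less_imp_le)
  finally show ?thesis .
qed

lemma Log_uniform:
  "uniform_limit (Dom S) (\<lambda>m z. \<Sum>n<m. Log_term S (E_fun U) n z) (\<lambda>z. - (f_val S 0 z * G_fun S U z)) sequentially"
proof (rule uniform_limitI)
  fix e :: real assume e: "0 < e"
  have "(\<lambda>n. real q * radix * \<kappa> ^ n) \<longlonglongrightarrow> real q * radix * 0"
    using kappa by (intro tendsto_intros LIMSEQ_power_zero) auto
  then have "\<forall>\<^sub>F n in sequentially. real q * radix * \<kappa> ^ n < e"
    using order_tendstoD(2)[of _ "real q * radix * 0" sequentially e] e by simp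
  then show "\<forall>\<^sub>F m in sequentially. \<forall>z\<in>Dom S.
      dist (\<Sum>n<m. Log_term S (E_fun U) n z) (- (f_val S 0 z * G_fun S U z)) < e"
    by eventually_elim (auto simp: dist_conv_absv intro: le_less_trans[OF Log_remainder])
qed

lemma Log_fun_eq:
  assumes z: "z \<in> Dom S"
  shows "Log_fun S (E_fun U) z = - (f_val S 0 z * G_fun S U z)"
proof -
  have "(\<lambda>n. Log_term S (E_fun U) n z) sums (- (f_val S 0 z * G_fun S U z))"
    unfolding sums_def using Log_uniform z by (rule tendsto_uniform_limitI)
  then show ?thesis
    by (simp add: Log_fun_def sums_iff)
qed

text \<open>By the difference equation the logarithm is \<xi> minus the twist of \<open>G\<close>,
  which places it in the Tate algebra without a new expansion.\<close>

lemma Log_tate_limit: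
  "tate_limit S (\<lambda>m z. \<Sum>n<m. Log_term S (exp_Phi S U) n z) (Log_fun S (exp_Phi S U))"
  unfolding tate_limit_def exp_Phi_eq
proof
  have "E_fun U - twist S (G_fun S U) z = Log_fun S (E_fun U) z" if "z \<in> Dom S" for z
    using twist_G[OF that, of U] Log_fun_eq[OF that] by (simp add: exp_Phi_eq)
  then show "Log_fun S (E_fun U) \<in> tate S"
    by (rule tate_cong[OF const_minus_in_tate[OF twist_in_tate[OF G_in_tate]]])
  show "uniform_limit (Dom S) (\<lambda>m z. \<Sum>n<m. Log_term S (E_fun U) n z) (Log_fun S (E_fun U)) sequentially"
    by (rule uniform_limit_Dom_cong[OF Log_uniform]) (simp add: Log_fun_eq)
qed

lemma G_eq_Log:
  assumes z: "z \<in> Dom S"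
  shows "G_fun S U z = - (1 / f_val S 0 z) * Log_fun S (exp_Phi S U) z"
  using f_val_Dom_neq_0[OF z, of 0] by (simp add: exp_Phi_eq Log_fun_eq[OF z])

end

end

theorem theorem7:
  fixes S :: "('k::{field,finite}, 'c::{alg_closed_field,complete_space}) carlitz_data"
    and U :: 'c
  assumes "carlitz_setting S"
  shows
    "(convergent_prod (\<lambda>k. pi_factor S (Suc k)) \<and>
      tate_limit S (\<lambda>m z. root_om S * (\<Prod>k<m. omega_factor S k z)) (omega S) \<and>
      (\<forall>z\<in>Dom S. omega S z = G_fun S (pi_Phi S) z)) \<and>
     (tate_limit S (\<lambda>m z. \<Sum>n<m. G_term S U n z) (G_fun S U) \<and>
      (\<forall>z\<in>Dom S. twist S (G_fun S U) z = f_val S 0 z * G_fun S U z + exp_Phi S U)) \<and>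
     (tate_limit S (\<lambda>m z. (theta S - eta S) / (theta S - etac S 1) * (\<Sum>k<m. H_term S U k z))
        (H_fun S U) \<and>
      (\<forall>z\<in>Dom S. G_fun S U z = H_fun S U z)) \<and>
     (absv U < real (qq S) powr (real (qq S) / (real (qq S) - 1)) \<longrightarrow>
      tate_limit S (\<lambda>m z. \<Sum>n<m. Log_term S (exp_Phi S U) n z) (Log_fun S (exp_Phi S U)) \<and>
      (\<forall>z\<in>Dom S. G_fun S U z = - (1 / f_val S 0 z) * Log_fun S (exp_Phi S U) z))"
proof -
  interpret carlitz_setting S
    by (rule assms)
  have "convergent_prod (\<lambda>k. pi_factor S (Suc k))"
    using pi_has_prod by (auto simp: has_prod_def convergent_prod_def)
  then show ?thesis
    using omega_tate_limit omega_eq_G G_tate_limit twist_G H_tate_limit G_eq_H Log_tate_limit G_eq_Log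
    by blast
qed

end
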